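(* Let $A$ be a nontrivial prime associative superalgebra over $\Phi$ (where $\frac12\in\Phi$) such that $A$ is not a central order in $C(n)$ for $n=1,2,3$. Let $L$ be a Lie ideal of $A$ and let $V$ be a (graded) $\Phi$-submodule of $A$ such that $[V,L]\subseteq V$ and $[V,V]\subseteq Z$. Then either $L\subseteq Z$ or $V\subseteq Z$.
   Context: $\Phi$ is a commutative unital ring of scalars with $\frac12\in\Phi$. An associative superalgebra over $\Phi$ is a $\mathbb{Z}/2$-graded associative $\Phi$-algebra $A=A_0+A_1$ (direct sum, $A_iA_j\subseteq A_{i+j}$); it is nontrivial if $A_1\neq 0$. Elements of $A_0\cup A_1$ are called homogeneous, and $\bar a$ denotes the degree of a homogeneous element $a$. "Subalgebra", "submodule", "ideal" always mean graded subalgebra, graded submodule, graded (two-sided) ideal. $A$ is prime if the product of any two nonzero (graded) ideals of $A$ is nonzero. The superbracket is $[a,b]=ab-(-1)^{\bar a\bar b}ba$ for homogeneous $a,b$, extended bilinearly; for submodules $M,N$, $[M,N]$ is the $\Phi$-span of all $[m,n]$ with $m\in M$, $n\in N$. A Lie ideal of $A$ is a (graded) $\Phi$-submodule $L$ with $[L,A]\subseteq L$. $Z$ denotes the even part of the center of $A$. If $A$ is prime and $Z\neq0$, one forms the localization $Z^{-1}A=\{z^{-1}a: 0\neq z\in Z,\ a\in A\}$, a superalgebra over the field $Z^{-1}Z$. $A$ is called a central order in $C(n)$ if $Z\neq 0$ and $Z^{-1}A$ is isomorphic, as a superalgebra over $Z^{-1}Z$, to the Clifford superalgebra of a non-degenerate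 quadratic space of dimension $n$ over $Z^{-1}Z$ (with its usual $\mathbb{Z}/2$-grading in which vectors are odd). *)

theory Defs
  imports
    Complex_Main
    "HOL-Library.Z2"
    "HOL-Algebra.QuotRing"
    "Jordan_Normal_Form.Missing_VectorSpace"
begin

section \<open>Associative superalgebras\<close>

text \<open>
  The algebra is not assumed to be unital. The grading is indexed by the two-element field
  \<^typ>\<open>bit\<close>; \<open>G i\<close> is the homogeneous component of degree \<open>i\<close>.
\<close>

locale superalgebra = Modules.module scale
  for scale :: "'f::comm_ring_1 \<Rightarrow> 'a::ring \<Rightarrow> 'a" +
  fixes G :: "bit \<Rightarrow> 'a set"
  assumes scale_mult_left: "scale c x * y = scale c (x * y)"
    and scale_mult_right: "x * scale c y = scale c (x * y)"
    and grade_subspace: "Modules.module.subspace scale (G i)"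
    and grade_disjoint: "G 0 \<inter> G 1 = {0}"
    and grade_sum: "\<exists>a\<in>G 0. \<exists>b\<in>G 1. x = a + b"
    and grade_mult: "a \<in> G i \<Longrightarrow> b \<in> G j \<Longrightarrow> a * b \<in> G (i + j)"

text \<open>The homogeneous component of degree \<open>i\<close> of an element; \<open>i + 1\<close> is the other degree.\<close>

definition hpart :: "(bit \<Rightarrow> 'a::ring set) \<Rightarrow> bit \<Rightarrow> 'a \<Rightarrow> 'a" where
  "hpart G i x = (THE a. a \<in> G i \<and> x - a \<in> G (i + 1))"

definition graded_submodule ::
    "('f::comm_ring_1 \<Rightarrow> 'a::ring \<Rightarrow> 'a) \<Rightarrow> (bit \<Rightarrow> 'a set) \<Rightarrow> 'a set \<Rightarrow> bool" where
  "graded_submodule scale G N \<longleftrightarrow>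
     Modules.module.subspace scale N \<and> (\<forall>x\<in>N. \<forall>i. hpart G i x \<in> N)"

definition graded_ideal ::
    "('f::comm_ring_1 \<Rightarrow> 'a::ring \<Rightarrow> 'a) \<Rightarrow> (bit \<Rightarrow> 'a set) \<Rightarrow> 'a set \<Rightarrow> bool" where
  "graded_ideal scale G I \<longleftrightarrow>
     graded_submodule scale G I \<and> (\<forall>a. \<forall>x\<in>I. a * x \<in> I \<and> x * a \<in> I)"

definition ideal_product ::
    "('f::comm_ring_1 \<Rightarrow> 'a::ring \<Rightarrow> 'a) \<Rightarrow> 'a set \<Rightarrow> 'a set \<Rightarrow> 'a set" where
  "ideal_product scale I J = Modules.module.span scale {x * y | x y. x \<in> I \<and> y \<in> J}"

definition prime_superalgebra ::
    "('f::comm_ring_1 \<Rightarrow> 'a::ring \<Rightarrow> 'a) \<Rightarrow> (bit \<Rightarrow> 'a set) \<Rightarrow> bool" where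
  "prime_superalgebra scale G \<longleftrightarrow>
     (\<forall>I J. graded_ideal scale G I \<and> graded_ideal scale G J \<and> I \<noteq> {0} \<and> J \<noteq> {0}
        \<longrightarrow> ideal_product scale I J \<noteq> {0})"

text \<open>The value of the superbracket on homogeneous elements of degrees \<open>i\<close> and \<open>j\<close>,
  and its bilinear extension.\<close>

definition hbracket :: "bit \<Rightarrow> bit \<Rightarrow> 'a::ring \<Rightarrow> 'a \<Rightarrow> 'a" where
  "hbracket i j a b = (if i = 1 \<and> j = 1 then a * b + b * a else a * b - b * a)"

definition superbracket :: "(bit \<Rightarrow> 'a::ring set) \<Rightarrow> 'a \<Rightarrow> 'a \<Rightarrow> 'a" where
  "superbracket G a b = (\<Sum>i\<in>{0, 1}. \<Sum>j\<in>{0, 1}. hbracket i j (hpart G i a) (hpart G j b))"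

definition superbracket_span ::
    "('f::comm_ring_1 \<Rightarrow> 'a::ring \<Rightarrow> 'a) \<Rightarrow> (bit \<Rightarrow> 'a set) \<Rightarrow> 'a set \<Rightarrow> 'a set \<Rightarrow> 'a set" where
  "superbracket_span scale G M N =
     Modules.module.span scale {superbracket G m n | m n. m \<in> M \<and> n \<in> N}"

definition lie_ideal ::
    "('f::comm_ring_1 \<Rightarrow> 'a::ring \<Rightarrow> 'a) \<Rightarrow> (bit \<Rightarrow> 'a set) \<Rightarrow> 'a set \<Rightarrow> bool" where
  "lie_ideal scale G L \<longleftrightarrow>
     graded_submodule scale G L \<and> superbracket_span scale G L UNIV \<subseteq> L"

definition even_center :: "(bit \<Rightarrow> 'a::ring set) \<Rightarrow> 'a set" where
  "even_center G = {z \<in> G 0. \<forall>a. z * a = a * z}"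

section \<open>Superalgebras over a field, given by carriers\<close>

record ('k, 'c) superalg = "('k, 'c) module" +
  grade :: "bit \<Rightarrow> 'c set"

definition superalg_iso ::
    "('k, 'm) ring_scheme \<Rightarrow> ('k, 'c, 'x) superalg_scheme \<Rightarrow> ('k, 'd, 'y) superalg_scheme
       \<Rightarrow> ('c \<Rightarrow> 'd) set" where
  "superalg_iso K A B =
     {h \<in> ring_iso A B.
        (\<forall>c\<in>carrier K. \<forall>x\<in>carrier A. h (c \<odot>\<^bsub>A\<^esub> x) = c \<odot>\<^bsub>B\<^esub> h x) \<and>
        (\<forall>i. h ` grade A i = grade B i)}"

section \<open>Central localization\<close>

text \<open>
  Fractions \<open>z\<inverse>a\<close> with \<open>0 \<noteq> z \<in> Z\<close> are classes of pairs \<open>(a, z)\<close>. The set of denominators is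
  multiplicatively closed if the superalgebra is prime.
\<close>

definition denoms :: "(bit \<Rightarrow> 'a::ring set) \<Rightarrow> 'a set" where
  "denoms G = even_center G - {0}"

definition loc_rel :: "(bit \<Rightarrow> 'a::ring set) \<Rightarrow> (('a \<times> 'a) \<times> ('a \<times> 'a)) set" where
  "loc_rel G = {((a, z), (b, w)). z \<in> denoms G \<and> w \<in> denoms G \<and>
                  (\<exists>u\<in>denoms G. u * (w * a - z * b) = 0)}"

definition frac :: "(bit \<Rightarrow> 'a::ring set) \<Rightarrow> 'a \<Rightarrow> 'a \<Rightarrow> ('a \<times> 'a) set" where
  "frac G a z = loc_rel G `` {(a, z)}"

text \<open>
  All fractions \<open>z\<inverse>z\<close> (respectively \<open>z\<inverse>0\<close>) are the same class, so that the unions in the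
  fields \<open>one\<close> and \<open>zero\<close> only select this class; likewise for the other operations.
\<close>

definition localization ::
    "(bit \<Rightarrow> 'a::ring set) \<Rightarrow> (('a \<times> 'a) set, ('a \<times> 'a) set) superalg" where
  "localization G =
     \<lparr>carrier = {frac G a z | a z. z \<in> denoms G},
      mult = (\<lambda>X Y. \<Union>(a, z)\<in>X. \<Union>(b, w)\<in>Y. frac G (a * b) (z * w)),
      one = (\<Union>z\<in>denoms G. frac G z z),
      zero = (\<Union>z\<in>denoms G. frac G 0 z),
      add = (\<lambda>X Y. \<Union>(a, z)\<in>X. \<Union>(b, w)\<in>Y. frac G (w * a + z * b) (z * w)),
      smult = (\<lambda>X Y. \<Union>(a, z)\<in>X. \<Union>(b, w)\<in>Y. frac G (a * b) (z * w)),
      grade = (\<lambda>i. {frac G a z | a z. a \<in> G i \<and> z \<in> denoms G})\<rparr>"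

text \<open>\<open>Z\<inverse>Z\<close>, regarded as a subring of \<open>Z\<inverse>A\<close>.\<close>

definition loc_field :: "(bit \<Rightarrow> 'a::ring set) \<Rightarrow> ('a \<times> 'a) set ring" where
  "loc_field G =
     \<lparr>carrier = {frac G a z | a z. a \<in> even_center G \<and> z \<in> denoms G},
      mult = mult (localization G), one = \<one>\<^bsub>localization G\<^esub>,
      zero = \<zero>\<^bsub>localization G\<^esub>, add = add (localization G)\<rparr>"

section \<open>Quadratic spaces and Clifford superalgebras\<close>

definition polar :: "('k, 'm) ring_scheme \<Rightarrow> ('k, 'v, 'n) module_scheme \<Rightarrow> ('v \<Rightarrow> 'k)
    \<Rightarrow> 'v \<Rightarrow> 'v \<Rightarrow> 'k" where
  "polar K V q u v = q (u \<oplus>\<^bsub>V\<^esub> v) \<ominus>\<^bsub>K\<^esub> q u \<ominus>\<^bsub>K\<^esub> q v"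

text \<open>Since \<open>polar\<close> is symmetric, bilinearity only has to be required in the first argument.\<close>

definition quadratic_form ::
    "('k, 'm) ring_scheme \<Rightarrow> ('k, 'v, 'n) module_scheme \<Rightarrow> ('v \<Rightarrow> 'k) \<Rightarrow> bool" where
  "quadratic_form K V q \<longleftrightarrow>
     (\<forall>v\<in>carrier V. q v \<in> carrier K) \<and>
     (\<forall>c\<in>carrier K. \<forall>v\<in>carrier V. q (c \<odot>\<^bsub>V\<^esub> v) = c \<otimes>\<^bsub>K\<^esub> c \<otimes>\<^bsub>K\<^esub> q v) \<and>
     (\<forall>u\<in>carrier V. \<forall>v\<in>carrier V. \<forall>w\<in>carrier V.
        polar K V q (u \<oplus>\<^bsub>V\<^esub> v) w = polar K V q u w \<oplus>\<^bsub>K\<^esub> polar K V q v w) \<and>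
     (\<forall>c\<in>carrier K. \<forall>u\<in>carrier V. \<forall>w\<in>carrier V.
        polar K V q (c \<odot>\<^bsub>V\<^esub> u) w = c \<otimes>\<^bsub>K\<^esub> polar K V q u w)"

definition nondegenerate ::
    "('k, 'm) ring_scheme \<Rightarrow> ('k, 'v, 'n) module_scheme \<Rightarrow> ('v \<Rightarrow> 'k) \<Rightarrow> bool" where
  "nondegenerate K V q \<longleftrightarrow>
     (\<forall>u\<in>carrier V. (\<forall>v\<in>carrier V. polar K V q u v = \<zero>\<^bsub>K\<^esub>) \<longrightarrow> u = \<zero>\<^bsub>V\<^esub>)"

definition quadratic_space ::
    "('k, 'm) ring_scheme \<Rightarrow> ('k, 'v, 'n) module_scheme \<Rightarrow> ('v \<Rightarrow> 'k) \<Rightarrow> nat \<Rightarrow> bool" where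
  "quadratic_space K V q n \<longleftrightarrow>
     vectorspace K V \<and> vectorspace.fin_dim K V \<and> vectorspace.dim K V = n \<and> quadratic_form K V q"

text \<open>
  The free unital associative \<open>K\<close>-algebra on the set of vectors of \<open>V\<close>: finitely supported
  coefficient functions on words, with the convolution product.
\<close>

definition free_algebra ::
    "('k, 'm) ring_scheme \<Rightarrow> ('k, 'v, 'n) module_scheme \<Rightarrow> ('k, 'v list \<Rightarrow> 'k) module" where
  "free_algebra K V =
     \<lparr>carrier = {f. (\<forall>w. f w \<in> carrier K) \<and> finite {w. f w \<noteq> \<zero>\<^bsub>K\<^esub>} \<and>
                    (\<forall>w. f w \<noteq> \<zero>\<^bsub>K\<^esub> \<longrightarrow> set w \<subseteq> carrier V)},
      mult = (\<lambda>f g w. \<Oplus>\<^bsub>K\<^esub>i\<in>{..length w}. f (take i w) \<otimes>\<^bsub>K\<^esub> g (drop i w)),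
      one = (\<lambda>w. if w = [] then \<one>\<^bsub>K\<^esub> else \<zero>\<^bsub>K\<^esub>),
      zero = (\<lambda>w. \<zero>\<^bsub>K\<^esub>),
      add = (\<lambda>f g w. f w \<oplus>\<^bsub>K\<^esub> g w),
      smult = (\<lambda>c f w. c \<otimes>\<^bsub>K\<^esub> f w)\<rparr>"

definition free_gen :: "('k, 'm) ring_scheme \<Rightarrow> 'v \<Rightarrow> 'v list \<Rightarrow> 'k" where
  "free_gen K v = (\<lambda>w. if w = [v] then \<one>\<^bsub>K\<^esub> else \<zero>\<^bsub>K\<^esub>)"

text \<open>
  Dividing the free algebra by the first two families of relations gives the tensor algebra
  \<open>T(V)\<close>; the third family consists of the Clifford relations \<open>v \<otimes> v = q(v) 1\<close>.
\<close>

definition clifford_relations ::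
    "('k, 'm) ring_scheme \<Rightarrow> ('k, 'v, 'n) module_scheme \<Rightarrow> ('v \<Rightarrow> 'k) \<Rightarrow> ('v list \<Rightarrow> 'k) set" where
  "clifford_relations K V q = (let F = free_algebra K V; e = free_gen K in
     {e (u \<oplus>\<^bsub>V\<^esub> v) \<ominus>\<^bsub>F\<^esub> (e u \<oplus>\<^bsub>F\<^esub> e v) | u v. u \<in> carrier V \<and> v \<in> carrier V} \<union>
     {e (c \<odot>\<^bsub>V\<^esub> v) \<ominus>\<^bsub>F\<^esub> c \<odot>\<^bsub>F\<^esub> e v | c v. c \<in> carrier K \<and> v \<in> carrier V} \<union>
     {e v \<otimes>\<^bsub>F\<^esub> e v \<ominus>\<^bsub>F\<^esub> q v \<odot>\<^bsub>F\<^esub> \<one>\<^bsub>F\<^esub> | v. v \<in> carrier V})"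

definition clifford_ideal ::
    "('k, 'm) ring_scheme \<Rightarrow> ('k, 'v, 'n) module_scheme \<Rightarrow> ('v \<Rightarrow> 'k) \<Rightarrow> ('v list \<Rightarrow> 'k) set" where
  "clifford_ideal K V q = genideal (free_algebra K V) (clifford_relations K V q)"

text \<open>Degree \<open>i\<close> is spanned by the images of the words whose length is \<open>i\<close> modulo 2.\<close>

definition clifford ::
    "('k, 'm) ring_scheme \<Rightarrow> ('k, 'v, 'n) module_scheme \<Rightarrow> ('v \<Rightarrow> 'k)
       \<Rightarrow> ('k, ('v list \<Rightarrow> 'k) set) superalg" where
  "clifford K V q = (let F = free_algebra K V; I = clifford_ideal K V q in
     \<lparr>carrier = carrier (F Quot I), mult = mult (F Quot I), one = \<one>\<^bsub>F Quot I\<^esub>,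
      zero = \<zero>\<^bsub>F Quot I\<^esub>, add = add (F Quot I),
      smult = (\<lambda>c X. \<Union>f\<in>X. I +>\<^bsub>F\<^esub> (c \<odot>\<^bsub>F\<^esub> f)),
      grade = (\<lambda>i. {I +>\<^bsub>F\<^esub> f | f. f \<in> carrier F \<and>
                      (\<forall>w. f w \<noteq> \<zero>\<^bsub>K\<^esub> \<longrightarrow> of_nat (length w) = i)})\<rparr>)"

text \<open>
  Every space of finite dimension \<open>n\<close> over \<open>K\<close> has a copy whose vectors are functions
  \<^typ>\<open>nat \<Rightarrow> 'k\<close> (coordinates), so that fixing this type of vectors is no restriction.
\<close>

definition central_order_in_C :: "nat \<Rightarrow> (bit \<Rightarrow> 'a::ring set) \<Rightarrow> bool" where
  "central_order_in_C n G \<longleftrightarrow>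
     even_center G \<noteq> {0} \<and>
     (\<exists>(V :: (('a \<times> 'a) set, nat \<Rightarrow> ('a \<times> 'a) set) module) q.
        quadratic_space (loc_field G) V q n \<and> nondegenerate (loc_field G) V q \<and>
        superalg_iso (loc_field G) (localization G) (clifford (loc_field G) V q) \<noteq> {})"

end

theory Submission
  imports Defs
begin

text \<open>
  Let \<open>N\<close> be the set of all \<open>t\<close> with \<open>[t, A] \<subseteq> L\<close>. If \<open>[L, L] \<noteq> 0\<close>, then \<open>N\<close> contains the ideal \<open>I \<noteq> 0\<close>
  generated by \<open>[L, L]\<close>, so that \<open>[V, [I, A]] \<subseteq> V\<close>; if \<open>[L, L] = 0\<close>, then \<open>(A, L)\<close> takes the place of
  \<open>(I, V)\<close>. It therefore suffices to treat pairs with \<open>[V, [I, A]] \<subseteq> V\<close> and \<open>[V, V] \<subseteq> Z\<close>.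

  Even elements of \<open>V\<close> act on \<open>I\<close> by derivations \<open>d\<close> with \<open>d\<^sup>3 = 0\<close>; using that a square-zero element of
  \<open>V\<^sub>0\<close> vanishes one gets \<open>d = 0\<close>, hence \<open>V\<^sub>0 \<subseteq> Z\<close>. Consequently \<open>[v, l] \<in> Z\<close> for all odd \<open>v \<in> V\<close> and all odd
  brackets \<open>l \<in> [I, A]\<close>. If \<open>V\<^sub>1 \<noteq> 0\<close>, this produces one or two anticommuting odd elements
  with nonzero squares in \<open>Z\<close> whose supercentralizer \<open>C\<close> satisfies \<open>((I \<inter> C) C)\<^sub>0 \<subseteq> Z\<close>. Then the even part of \<open>C\<close> lies in \<open>Z\<close>,
  and its odd part, if nonzero, has rank one over \<open>Z\<close> and supplies a further element. Modulo denominators in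
  \<open>Z\<close>, the algebra is spanned by the ordered products of these at most three elements, which are independent; so
  the localization is their Clifford algebra.
\<close>

section \<open>Graded components and primeness\<close>

text \<open>There is no unit, and at the outset Z may be 0. So primeness is used elementwise, and
  division by a central element is always cancellation. One comparison drives the even case: if z
  and z v are central with z nonzero, then v is central. A central expression that gets multiplied
  by v when its argument x is replaced by x v must therefore vanish. This yields
  \<open>d^3 = 0\<close> on even elements and is used again and again. For odd v the obstacle is
  that v v may be 0, so that v is no Clifford generator. If v v is nonzero, v is kept, and
  noncommuting elements of its supercentralizer produce a second odd element of V. If v v = 0, some
  odd bracket l has a nonzero central bracket z with v. The elements v and l v l then form a
  hyperbolic pair, which is diagonalized by sum and difference. The bound 3 arises because brackets
  built from two generators already force all products i s of equal degree into Z, for i in I and s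
  both in the supercentralizer. This leaves room for at most one further odd direction.\<close>

locale half_superalgebra = superalgebra scale G
  for scale :: "'f::comm_ring_1 \<Rightarrow> 'a::ring \<Rightarrow> 'a" and G +
  assumes half: "(2 :: 'f) dvd 1"
begin

abbreviation "Ev \<equiv> G 0"
abbreviation "Od \<equiv> G 1"
abbreviation "Z \<equiv> even_center G"

lemma zero_G [simp, intro]: "0 \<in> G i"
  using grade_subspace subspace_0 by blast
lemma add_G [intro]: "x \<in> G i \<Longrightarrow> y \<in> G i \<Longrightarrow> x + y \<in> G i"
  using grade_subspace subspace_add by blast
lemma diff_G [intro]: "x \<in> G i \<Longrightarrow> y \<in> G i \<Longrightarrow> x - y \<in> G i"
  using grade_subspace subspace_diff by blast
lemma uminus_G [intro]: "x \<in> G i \<Longrightarrow> - x \<in> G i"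
  using grade_subspace subspace_neg by blast
lemma scale_G [intro]: "x \<in> G i \<Longrightarrow> scale c x \<in> G i"
  using grade_subspace subspace_scale by blast

lemma mult_EE [intro]: "a \<in> Ev \<Longrightarrow> b \<in> Ev \<Longrightarrow> a * b \<in> Ev" using grade_mult[of a 0 b 0] by simp
lemma mult_OO [intro]: "a \<in> Od \<Longrightarrow> b \<in> Od \<Longrightarrow> a * b \<in> Ev" using grade_mult[of a 1 b 1] by simp
lemma mult_EO [intro]: "a \<in> Ev \<Longrightarrow> b \<in> Od \<Longrightarrow> a * b \<in> Od" using grade_mult[of a 0 b 1] by simp
lemma mult_OE [intro]: "a \<in> Od \<Longrightarrow> b \<in> Ev \<Longrightarrow> a * b \<in> Od" using grade_mult[of a 1 b 0] by simp

lemma mult_comm_grade: "a \<in> G i \<Longrightarrow> b \<in> G j \<Longrightarrow> a * b \<in> G (j + i)"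
  using grade_mult by (metis add.commute)

lemma mult_E_G: "a \<in> Ev \<Longrightarrow> x \<in> G j \<Longrightarrow> a * x \<in> G j" and mult_G_E: "a \<in> Ev \<Longrightarrow> x \<in> G j \<Longrightarrow> x * a \<in> G j"
  using grade_mult[of a 0 x j] grade_mult[of x j a 0] by (simp_all only: add_0 add_0_right)

lemma E_O_zero: "x \<in> Ev \<Longrightarrow> x \<in> Od \<Longrightarrow> x = 0" using grade_disjoint by blast

lemma bit_cases2: obtains "i = (0::bit)" | "i = 1" by (cases i) auto

lemma grade_disj: "x \<in> G i \<Longrightarrow> x \<in> G (i + 1) \<Longrightarrow> x = 0"
  by (cases i rule: bit_cases2) (auto intro: E_O_zero)

lemma hpart_unique: "a \<in> G i \<Longrightarrow> x - a \<in> G (i + 1) \<Longrightarrow> hpart G i x = a"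
  unfolding hpart_def
proof (rule the_equality)
  fix b assume a: "a \<in> G i" "x - a \<in> G (i + 1)" and b: "b \<in> G i \<and> x - b \<in> G (i + 1)"
  have "b - a \<in> G i" using a b by blast
  moreover have "(x - a) - (x - b) \<in> G (i + 1)" using a b by blast
  ultimately have "b - a = 0" by (intro grade_disj[of _ i]) (simp_all)
  then show "b = a" by simp
qed simp

lemma hpart_ex: "\<exists>a\<in>G i. x - a \<in> G (i + 1)"
proof -
  obtain a b where ab: "a \<in> Ev" "b \<in> Od" "x = a + b" using grade_sum by blast
  show ?thesis
    by (cases i rule: bit_cases2) (use ab in \<open>auto intro: bexI[of _ a] bexI[of _ b]\<close>)
qed

lemma hpart_G [simp, intro]: "hpart G i x \<in> G i"
  using hpart_ex[of i x] hpart_unique by metis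

lemma hpart_compl: "x - hpart G i x \<in> G (i + 1)"
  using hpart_ex[of i x] hpart_unique by metis

lemma hpart_same [simp]: "x \<in> G i \<Longrightarrow> hpart G i x = x"
  by (rule hpart_unique) auto

lemma hpart_other: "x \<in> G (i + 1) \<Longrightarrow> hpart G i x = 0"
  by (rule hpart_unique) auto

lemma hpart_0_O [simp]: "x \<in> Od \<Longrightarrow> hpart G 0 x = 0" using hpart_other[of x 0] by simp
lemma hpart_1_E [simp]: "x \<in> Ev \<Longrightarrow> hpart G 1 x = 0" using hpart_other[of x 1] by simp

lemma hpart_sum: "hpart G 0 x + hpart G 1 x = x"
proof -
  have "x - hpart G 0 x \<in> G 1" using hpart_compl[of x 0] by simp
  then have "hpart G 1 x = x - hpart G 0 x"
    by (intro hpart_unique) auto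
  then show ?thesis by simp
qed

lemma hpart_add: "hpart G i (x + y) = hpart G i x + hpart G i y"
proof (rule hpart_unique)
  have "(x - hpart G i x) + (y - hpart G i y) \<in> G (i + 1)" using hpart_compl by blast
  then show "x + y - (hpart G i x + hpart G i y) \<in> G (i + 1)" by (simp add: algebra_simps)
qed auto

lemma hpart_scale: "hpart G i (scale c x) = scale c (hpart G i x)"
proof (rule hpart_unique)
  have "scale c (x - hpart G i x) \<in> G (i + 1)" using hpart_compl by blast
  then show "scale c x - scale c (hpart G i x) \<in> G (i + 1)" by (simp add: scale_right_diff_distrib)
qed auto

lemma hpart_0 [simp]: "hpart G i 0 = 0" by simp

lemma hpart_mult_left: "a \<in> G j \<Longrightarrow> hpart G (j + i) (a * x) = a * hpart G i x"
proof (rule hpart_unique)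
  assume a: "a \<in> G j"
  show "a * hpart G i x \<in> G (j + i)" using a grade_mult by blast
  have "a * (x - hpart G i x) \<in> G (j + (i + 1))" using a hpart_compl grade_mult by blast
  then show "a * x - a * hpart G i x \<in> G (j + i + 1)" by (metis right_diff_distrib add.assoc)
qed

lemma hpart_mult_right: "a \<in> G j \<Longrightarrow> hpart G (i + j) (x * a) = hpart G i x * a"
proof (rule hpart_unique)
  assume a: "a \<in> G j"
  show "hpart G i x * a \<in> G (i + j)" using a grade_mult by blast
  have "(x - hpart G i x) * a \<in> G ((i + 1) + j)" using a hpart_compl grade_mult by blast
  moreover have "(i + 1) + j = i + j + 1" by (simp only: ac_simps)
  ultimately show "x * a - hpart G i x * a \<in> G (i + j + 1)" by (metis left_diff_distrib)
qed

lemma half_E: "x + x \<in> G i \<Longrightarrow> x \<in> G i" and double_zero: "x + x = 0 \<Longrightarrow> x = 0"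
proof -
  obtain h :: 'f where h: "1 = 2 * h" using half by (auto elim: dvdE)
  have *: "scale h (x + x) = x"
    by (metis h mult.commute one_add_one scale_left_distrib scale_one scale_scale)
  show "x + x \<in> G i \<Longrightarrow> x \<in> G i" using * scale_G by metis
  show "x + x = 0 \<Longrightarrow> x = 0" using * by (metis scale_zero_right)
qed

lemma double_cancel: "(x::'a) + x = y + y \<Longrightarrow> x = y"
  using double_zero[of "x - y"] by (simp add: algebra_simps)

section \<open>The even part of the center\<close>

lemma ZE: "z \<in> Z \<Longrightarrow> z \<in> Ev" by (simp add: even_center_def)
lemma Zcomm: "z \<in> Z \<Longrightarrow> z * a = a * z" by (simp add: even_center_def)
lemma ZI: "z \<in> Ev \<Longrightarrow> (\<And>a. z * a = a * z) \<Longrightarrow> z \<in> Z" by (simp add: even_center_def)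

lemma Z_0 [simp, intro]: "0 \<in> Z" by (simp add: even_center_def)
lemma Z_add [intro]: "x \<in> Z \<Longrightarrow> y \<in> Z \<Longrightarrow> x + y \<in> Z" by (auto simp: even_center_def algebra_simps)
lemma Z_diff [intro]: "x \<in> Z \<Longrightarrow> y \<in> Z \<Longrightarrow> x - y \<in> Z" by (auto simp: even_center_def algebra_simps)
lemma Z_uminus [intro]: "x \<in> Z \<Longrightarrow> - x \<in> Z" by (auto simp: even_center_def)
lemma Z_mult [intro]: assumes "x \<in> Z" "y \<in> Z" shows "x * y \<in> Z"
proof (rule ZI)
  show "x * y \<in> Ev" using assms ZE by blast
  fix a
  have "x * y * a = x * (a * y)" using Zcomm[OF assms(2)] by (simp add: mult.assoc)
  also have "\<dots> = a * (x * y)"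
    using arg_cong[OF Zcomm[OF assms(1), of a], of "\<lambda>t. t * y"] by (simp add: mult.assoc)
  finally show "x * y * a = a * (x * y)" .
qed

lemma Z_half: assumes "x + x \<in> Z" shows "x \<in> Z"
proof (rule ZI)
  show "x \<in> Ev" using assms ZE half_E by blast
  fix a
  have "x * a + x * a = a * x + a * x"
    using Zcomm[OF assms, of a] by (simp add: distrib_left distrib_right)
  then show "x * a = a * x" by (rule double_cancel)
qed

lemma Z_I_homog:
  assumes "z \<in> Ev" "\<And>j a. a \<in> G j \<Longrightarrow> z * a = a * z" shows "z \<in> Z"
proof (rule ZI[OF assms(1)])
  fix a
  have "z * (hpart G 0 a + hpart G 1 a) = (hpart G 0 a + hpart G 1 a) * z"
    using assms(2)[OF hpart_G, of 0 a] assms(2)[OF hpart_G, of 1 a] by (simp add: algebra_simps)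
  then show "z * a = a * z" by (simp add: hpart_sum)
qed

lemma Z_hpart: "z \<in> Z \<Longrightarrow> hpart G i (z * a) = z * hpart G i a"
  using hpart_mult_left[OF ZE, of z i a] by (simp only: add_0)

lemma superbracket_homog:
  assumes "a \<in> G i" "b \<in> G j" shows "superbracket G a b = hbracket i j a b"
  using assms by (cases i rule: bit_cases2; cases j rule: bit_cases2)
    (auto simp: superbracket_def hbracket_def)

lemma hbracket_G: "a \<in> G i \<Longrightarrow> b \<in> G j \<Longrightarrow> hbracket i j a b \<in> G (i + j)"
  unfolding hbracket_def using grade_mult[of a i b j] mult_comm_grade[of b j a i] by auto

end

section \<open>Elementwise consequences of graded primeness\<close>

locale half_prime_superalgebra = half_superalgebra scale G
  for scale :: "'f::comm_ring_1 \<Rightarrow> 'a::ring \<Rightarrow> 'a" and G +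
  assumes prime: "prime_superalgebra scale G" and O_nonzero: "Od \<noteq> {0}"
begin

lemma graded_idealI:
  assumes "0 \<in> I" "\<And>x y. x \<in> I \<Longrightarrow> y \<in> I \<Longrightarrow> x + y \<in> I" "\<And>c x. x \<in> I \<Longrightarrow> scale c x \<in> I"
    "\<And>x i. x \<in> I \<Longrightarrow> hpart G i x \<in> I" "\<And>a x. x \<in> I \<Longrightarrow> a * x \<in> I" "\<And>a x. x \<in> I \<Longrightarrow> x * a \<in> I"
  shows "graded_ideal scale G I"
  using assms unfolding graded_ideal_def graded_submodule_def by (auto intro: subspaceI)

lemma gsub_add: "graded_submodule scale G I \<Longrightarrow> x \<in> I \<Longrightarrow> y \<in> I \<Longrightarrow> x + y \<in> I"
  and gsub_diff: "graded_submodule scale G I \<Longrightarrow> x \<in> I \<Longrightarrow> y \<in> I \<Longrightarrow> x - y \<in> I"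
  and gsub_neg: "graded_submodule scale G I \<Longrightarrow> x \<in> I \<Longrightarrow> - x \<in> I"
  and gsub_0: "graded_submodule scale G I \<Longrightarrow> 0 \<in> I"
  and gsub_scale: "graded_submodule scale G I \<Longrightarrow> x \<in> I \<Longrightarrow> scale c x \<in> I"
  and gsub_hpart: "graded_submodule scale G I \<Longrightarrow> x \<in> I \<Longrightarrow> hpart G i x \<in> I"
  unfolding graded_submodule_def
  by (auto intro: subspace_add subspace_diff subspace_neg subspace_0 subspace_scale)

lemma product_zero:
  assumes "graded_ideal scale G P" "graded_ideal scale G Q" "\<And>p q. p \<in> P \<Longrightarrow> q \<in> Q \<Longrightarrow> p * q = 0"
  shows "P = {0} \<or> Q = {0}"
proof (rule ccontr)
  assume "\<not> ?thesis"
  then have "ideal_product scale P Q \<noteq> {0}" using prime assms unfolding prime_superalgebra_def by blast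
  moreover have "ideal_product scale P Q = {0}"
  proof -
    have "{x * y | x y. x \<in> P \<and> y \<in> Q} \<subseteq> {0}" using assms(3) by auto
    then have "ideal_product scale P Q \<subseteq> span {0}" unfolding ideal_product_def by (rule span_mono)
    moreover have "span {0} = {0 :: 'a}" using span_insert_0[of "{}"] by simp
    moreover have "0 \<in> ideal_product scale P Q" unfolding ideal_product_def by (rule span_zero)
    ultimately show ?thesis by blast
  qed
  ultimately show False by simp
qed

lemma mult_homog_zero_left:
  assumes "x \<in> G i" "x * b = 0" shows "x * hpart G j b = 0"
  using hpart_mult_left[OF assms(1), of j b] assms(2) by simp

lemma mult_homog_zero_right:
  assumes "x \<in> G i" "b * x = 0" shows "hpart G j b * x = 0"
  using hpart_mult_right[OF assms(1), of j b] assms(2) by simp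

lemma split_mult_zero_left: "(\<And>j a. a \<in> G j \<Longrightarrow> x * a * y = 0) \<Longrightarrow> x * a * y = 0"
  by (metis hpart_G hpart_sum distrib_left distrib_right add_0)

lemma UNIV_ideal: "graded_ideal scale G UNIV" by (rule graded_idealI) auto

text \<open>This replaces a unit: the elements \<open>b\<close> with \<open>b A = 0\<close> form a
  graded ideal whose product with \<open>A\<close> is zero.\<close>

lemma right_ann_zero:
  assumes "\<And>a. b * a = 0" shows "b = (0::'a)"
proof -
  let ?P = "{b :: 'a. \<forall>a. b * a = 0}"
  have "graded_ideal scale G ?P"
  proof (rule graded_idealI)
    fix x i assume x: "x \<in> ?P"
    have "hpart G i x * a = 0" for a
      using mult_homog_zero_right[OF hpart_G, of x 0 a i] mult_homog_zero_right[OF hpart_G, of x 1 a i] x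
      by (metis (mono_tags, lifting) add.right_neutral distrib_left hpart_sum mem_Collect_eq)
    then show "hpart G i x \<in> ?P" by blast
  qed (auto simp: distrib_right scale_mult_left mult.assoc)
  then have "?P = {0} \<or> (UNIV :: 'a set) = {0}" using product_zero[OF _ UNIV_ideal] by blast
  then show ?thesis using assms by auto
qed

text \<open>The set \<open>?P\<close> is a graded ideal because \<open>x\<close> is homogeneous;
  \<open>y\<close> may be inhomogeneous. Its left annihilator \<open>?Q\<close> is a graded ideal
  containing \<open>x A\<close>. A nonzero \<open>y\<close> makes \<open>?P\<close> nonzero, so
  \<open>?Q = {0}\<close>, hence \<open>x A = 0\<close>, and \<open>right_ann_zero\<close>
  applies.\<close>

lemma prime_elements:
  assumes x: "x \<in> G i" and xy: "\<And>a. x * a * y = 0"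
  shows "x = 0 \<or> y = 0"
proof (rule ccontr)
  assume n: "\<not> ?thesis"
  let ?P = "{b :: 'a. \<forall>a. x * a * b = 0}"
  have P: "graded_ideal scale G ?P"
  proof (rule graded_idealI)
    fix b j assume b: "b \<in> ?P"
    have "x * a * hpart G j b = 0" for a
    proof -
      have "x * hpart G k a * hpart G j b = 0" for k
        using mult_homog_zero_left[OF grade_mult[OF x hpart_G], of k a b j] b by blast
      then show ?thesis by (metis add.right_neutral distrib_left distrib_right hpart_sum)
    qed
    then show "hpart G j b \<in> ?P" by blast
  next
    fix a b assume b: "b \<in> ?P"
    show "a * b \<in> ?P" using b by (auto simp: mult.assoc) (metis mult.assoc)
    show "b * a \<in> ?P" using b by (auto simp flip: mult.assoc)
  qed (auto simp: distrib_left scale_mult_right)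
  let ?Q = "{q. \<forall>p\<in>?P. q * p = 0}"
  have Q: "graded_ideal scale G ?Q"
  proof (rule graded_idealI)
    fix q j assume q: "q \<in> ?Q"
    show "hpart G j q \<in> ?Q"
    proof (simp only: mem_Collect_eq, intro ballI)
      fix p assume p: "p \<in> ?P"
      have "hpart G j q * hpart G k p = 0" for k
      proof -
        have "hpart G k p \<in> ?P" using P p gsub_hpart unfolding graded_ideal_def by blast
        then have "q * hpart G k p = 0" using q by blast
        then show ?thesis using mult_homog_zero_right[OF hpart_G] by blast
      qed
      then show "hpart G j q * p = 0" by (metis add.right_neutral distrib_left hpart_sum)
    qed
  next
    fix a q assume q: "q \<in> ?Q"
    show "a * q \<in> ?Q" using q by (simp add: mult.assoc)
    have "a * p \<in> ?P" if "p \<in> ?P" for p using P that unfolding graded_ideal_def by blast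
    then show "q * a \<in> ?Q" using q by (auto simp: mult.assoc)
  qed (auto simp: distrib_right scale_mult_left)
  have "?P \<noteq> {0}" using xy n by blast
  then have "?Q = {0}" using product_zero[OF Q P] by blast
  moreover have "x * a \<in> ?Q" for a by blast
  ultimately have "x * a = 0" for a by blast
  then show False using right_ann_zero n by blast
qed

text \<open>Centrality spreads \<open>z * a = 0\<close> to \<open>z * b * a = 0\<close> for all
  \<open>b\<close>. This is what makes the nonzero elements of \<open>Z\<close> usable as
  denominators.\<close>

lemma Z_regular: "z \<in> Z \<Longrightarrow> z * a = 0 \<Longrightarrow> z = 0 \<or> a = 0"
  using prime_elements[OF ZE, of z a] by (metis Zcomm mult.assoc mult_zero_right)

lemma Z_cancel: "z \<in> Z \<Longrightarrow> z \<noteq> 0 \<Longrightarrow> z * a = z * b \<Longrightarrow> a = b"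
  using Z_regular[of z "a - b"] by (simp add: algebra_simps)

text \<open>The odd part of \<open>a\<close> and all commutators of \<open>a\<close> are annihilated
  by \<open>z\<close>, so they vanish. This is the form in which division by central elements enters
  the later arguments.\<close>

lemma Z_div: assumes "z \<in> Z" "z \<noteq> 0" "z * a \<in> Z" shows "a \<in> Z"
proof (rule ZI)
  have "z * hpart G 1 a = 0" using Z_hpart[OF assms(1), of 1 a] assms(3) by (simp add: ZE)
  then have "hpart G 1 a = 0" using Z_regular assms by blast
  then show "a \<in> Ev" using hpart_sum[of a] hpart_G[of 0 a] by simp
  fix b
  have "z * (a * b) = z * (b * a)"
    using Zcomm[OF assms(3), of b] Zcomm[OF assms(1)] by (metis mult.assoc)
  then show "a * b = b * a" using Z_cancel assms by blast
qed

end

section \<open>The even part of \<open>V\<close> is central\<close>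

locale lie_pair = half_prime_superalgebra scale G
  for scale :: "'f::comm_ring_1 \<Rightarrow> 'a::ring \<Rightarrow> 'a" and G +
  fixes I V :: "'a set"
  assumes I_ideal: "graded_ideal scale G I" and I_nonzero: "I \<noteq> {0}"
    and V_sub: "graded_submodule scale G V"
    and V_I: "\<And>m k j v i a. v \<in> V \<Longrightarrow> v \<in> G m \<Longrightarrow> i \<in> I \<Longrightarrow> i \<in> G k \<Longrightarrow> a \<in> G j \<Longrightarrow>
      hbracket m (k + j) v (hbracket k j i a) \<in> V"
    and V_V: "\<And>m k v w. v \<in> V \<Longrightarrow> v \<in> G m \<Longrightarrow> w \<in> V \<Longrightarrow> w \<in> G k \<Longrightarrow> hbracket m k v w \<in> even_center G"
begin

lemma I_sub: "graded_submodule scale G I" using I_ideal by (simp add: graded_ideal_def)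

lemma I_left [intro]: "i \<in> I \<Longrightarrow> a * i \<in> I" and I_right [intro]: "i \<in> I \<Longrightarrow> i * a \<in> I"
  using I_ideal by (auto simp: graded_ideal_def)
lemmas I_add [intro] = gsub_add[OF I_sub] and I_diff [intro] = gsub_diff[OF I_sub]
  and I_neg [intro] = gsub_neg[OF I_sub] and I_hpart [intro] = gsub_hpart[OF I_sub]
lemmas V_add [intro] = gsub_add[OF V_sub] and V_diff [intro] = gsub_diff[OF V_sub]
  and V_neg [intro] = gsub_neg[OF V_sub] and V_hpart [intro] = gsub_hpart[OF V_sub]

text \<open>The normalizer of \<open>V\<close>; it contains \<open>[I, A]\<close>, and nothing else about \<open>[I, A]\<close> is needed.\<close>

definition Lie :: "bit \<Rightarrow> 'a set" where
  "Lie j = {l \<in> G j. \<forall>m. \<forall>w\<in>V. w \<in> G m \<longrightarrow> hbracket m j w l \<in> V}"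

lemma Lie_I: "i \<in> I \<Longrightarrow> i \<in> G k \<Longrightarrow> a \<in> G j \<Longrightarrow> hbracket k j i a \<in> Lie (k + j)"
  unfolding Lie_def by (rule CollectI, intro conjI ballI allI impI) (simp_all only: hbracket_G V_I)

lemma Lie_I_0: "i \<in> I \<Longrightarrow> i \<in> G k \<Longrightarrow> a \<in> Ev \<Longrightarrow> i * a - a * i \<in> Lie k"
  using Lie_I[of i k a 0] unfolding add_0_right hbracket_def by simp
lemma Lie_I_00: "i \<in> I \<Longrightarrow> i \<in> Ev \<Longrightarrow> a \<in> Ev \<Longrightarrow> i * a - a * i \<in> Lie 0"
  using Lie_I[of i 0 a 0] by (simp add: hbracket_def)
lemma Lie_I_01: "i \<in> I \<Longrightarrow> i \<in> Ev \<Longrightarrow> a \<in> Od \<Longrightarrow> i * a - a * i \<in> Lie 1"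
  using Lie_I[of i 0 a 1] by (simp add: hbracket_def)
lemma Lie_I_10: "i \<in> I \<Longrightarrow> i \<in> Od \<Longrightarrow> a \<in> Ev \<Longrightarrow> i * a - a * i \<in> Lie 1"
  using Lie_I[of i 1 a 0] by (simp add: hbracket_def)
lemma Lie_I_11: "i \<in> I \<Longrightarrow> i \<in> Od \<Longrightarrow> a \<in> Od \<Longrightarrow> i * a + a * i \<in> Lie 0"
  using Lie_I[of i 1 a 1] by (simp add: hbracket_def)

lemma Lie_G: "l \<in> Lie j \<Longrightarrow> l \<in> G j" by (simp add: Lie_def)

lemma V_Lie: "v \<in> V \<Longrightarrow> v \<in> G m \<Longrightarrow> l \<in> Lie j \<Longrightarrow> hbracket m j v l \<in> V"
  unfolding Lie_def by blast
lemma V0_Lie: "v \<in> V \<Longrightarrow> v \<in> Ev \<Longrightarrow> l \<in> Lie j \<Longrightarrow> v * l - l * v \<in> V"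
  using V_Lie[of v 0 l j] by (simp add: hbracket_def)
lemma V_Lie0: "v \<in> V \<Longrightarrow> v \<in> G m \<Longrightarrow> l \<in> Lie 0 \<Longrightarrow> v * l - l * v \<in> V"
  using V_Lie[of v m l 0] by (simp add: hbracket_def)
lemma V1_Lie1: "v \<in> V \<Longrightarrow> v \<in> Od \<Longrightarrow> l \<in> Lie 1 \<Longrightarrow> v * l + l * v \<in> V"
  using V_Lie[of v 1 l 1] by (simp add: hbracket_def)

lemma V00: "v \<in> V \<Longrightarrow> v \<in> Ev \<Longrightarrow> w \<in> V \<Longrightarrow> w \<in> Ev \<Longrightarrow> v * w - w * v \<in> Z"
  using V_V[of v 0 w 0] by (simp add: hbracket_def)
lemma V11: "v \<in> V \<Longrightarrow> v \<in> Od \<Longrightarrow> w \<in> V \<Longrightarrow> w \<in> Od \<Longrightarrow> v * w + w * v \<in> Z"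
  using V_V[of v 1 w 1] by (simp add: hbracket_def)
lemma V01: assumes "v \<in> V" "v \<in> Ev" "w \<in> V" "w \<in> Od" shows "v * w = w * v"
proof -
  have "v * w - w * v \<in> Z" using V_V[of v 0 w 1] assms by (simp add: hbracket_def)
  moreover have "v * w - w * v \<in> Od" using assms by blast
  ultimately have "v * w - w * v = 0" using ZE E_O_zero by blast
  then show ?thesis by simp
qed

lemma I_nonzero_homog: obtains i k where "i \<in> I" "i \<in> G k" "i \<noteq> 0"
proof -
  have "0 \<in> I" using gsub_0 I_sub by blast
  then obtain i where i: "i \<in> I" "i \<noteq> 0" using I_nonzero by blast
  have "hpart G 0 i \<noteq> 0 \<or> hpart G 1 i \<noteq> 0"
    using hpart_sum[of i] i(2) by (metis add_0)
  then show ?thesis using that[OF I_hpart hpart_G] i by blast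
qed

text \<open>Inserting \<open>a i b\<close> for the element of \<open>I\<close> shows that the
  homogeneous element \<open>x a i\<close> kills \<open>A y\<close>. If \<open>y\<close> is nonzero
  then \<open>x a i = 0\<close> for a fixed nonzero homogeneous \<open>i\<close>, and primeness is
  used a second time.\<close>

lemma prime_I:
  assumes x: "x \<in> G j" and xy: "\<And>k i. i \<in> I \<Longrightarrow> i \<in> G k \<Longrightarrow> x * i * y = 0"
  shows "x = 0 \<or> y = 0"
proof (rule ccontr)
  assume n: "\<not> ?thesis"
  obtain i k where i: "i \<in> I" "i \<in> G k" "i \<noteq> 0" by (rule I_nonzero_homog)
  have xI: "x * i * y = 0" if "i \<in> I" for i
    using xy[OF I_hpart[OF that] hpart_G, of 0] xy[OF I_hpart[OF that] hpart_G, of 1]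
    by (metis add.right_neutral distrib_left distrib_right hpart_sum)
  have "x * a * i = 0" if a: "a \<in> G l" for a l
  proof -
    have "x * a * i * b * y = 0" for b
      using xI[of "a * i * b"] i(1) by (simp add: mult.assoc I_left I_right)
    moreover have "x * a * i \<in> G (j + l + k)" by (intro grade_mult x a i)
    ultimately show ?thesis using prime_elements[of "x * a * i" "j + l + k" y] n by blast
  qed
  then have "x * a * i = 0" for a by (rule split_mult_zero_left)
  then show False using prime_elements[OF x, of i] n i(3) by blast
qed

lemma semiprime_I: "x \<in> G j \<Longrightarrow> (\<And>k i. i \<in> I \<Longrightarrow> i \<in> G k \<Longrightarrow> x * i * x = 0) \<Longrightarrow> x = 0"
  using prime_I[of x j x] by blast

text \<open>For a bracket \<open>l\<close>, the double bracket of \<open>p\<close> with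
  \<open>l\<close> is \<open>-2 p l p\<close>. If \<open>l\<close> is even, \<open>p l p\<close> is
  central and has square zero; if \<open>l\<close> is odd, it vanishes since even and odd elements
  of \<open>V\<close> commute. In both cases \<open>p l p = 0\<close>. For
  \<open>l = [i, p a]\<close> only \<open>p i p a p\<close> survives, and primeness gives first
  \<open>p i p = 0\<close> and then \<open>p = 0\<close>.\<close>

lemma V0_square_zero:
  assumes p: "p \<in> V" "p \<in> Ev" "p * p = 0" shows "p = 0"
proof -
  have pp: "p * (p * x) = 0" for x using p(3) by (simp flip: mult.assoc)
  have plp: "p * l * p = 0" if l: "l \<in> Lie j" for l j
  proof -
    define w where "w = p * l - l * p"
    have w: "w \<in> V" unfolding w_def by (rule V0_Lie[OF p(1,2) l])
    have wG: "w \<in> G j" unfolding w_def using diff_G[OF mult_E_G[OF p(2) Lie_G[OF l]] mult_G_E[OF p(2) Lie_G[OF l]]] .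
    have eq: "p * w - w * p = - (p * l * p + p * l * p)"
      unfolding w_def by (simp add: algebra_simps pp p(3))
    show ?thesis
    proof (cases j rule: bit_cases2)
      case 1
      have "- (p * w - w * p) \<in> Z" using V00[OF p(1,2) w wG[unfolded 1]] by (rule Z_uminus)
      then have plpZ: "p * l * p \<in> Z" unfolding eq minus_minus by (rule Z_half)
      have "p * l * p * (p * l * p) = 0" by (simp add: mult.assoc pp)
      then show ?thesis using Z_regular[OF plpZ] by blast
    next
      case 2
      have "p * w - w * p = 0" using V01[OF p(1,2) w wG[unfolded 2]] by simp
      then have "p * l * p + p * l * p = 0" unfolding eq by (simp only: neg_equal_0_iff_equal)
      then show ?thesis by (rule double_zero)
    qed
  qed
  show ?thesis
  proof (rule ccontr)
    assume n: "p \<noteq> 0"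
    have "p * i * p = 0" if i: "i \<in> I" "i \<in> G k" for i k
    proof -
      have "p * i * p * a * p = 0" if a: "a \<in> G j" for a j
      proof -
        have "p * a \<in> G j" using mult_E_G[OF p(2) a] .
        then have "hbracket k j i (p * a) \<in> Lie (k + j)" by (rule Lie_I[OF i])
        from plp[OF this] have "p * hbracket k j i (p * a) * p = 0" .
        moreover have "p * hbracket k j i (p * a) * p = p * i * p * a * p"
          unfolding hbracket_def by (simp add: algebra_simps pp)
        ultimately show ?thesis by simp
      qed
      then have "p * i * p * a * p = 0" for a by (rule split_mult_zero_left)
      moreover have "p * i * p \<in> G k" using mult_E_G mult_G_E p i by simp
      ultimately show ?thesis using prime_elements[of "p * i * p" k p] n by blast
    qed
    then have "p = 0" by (rule semiprime_I[OF p(2)])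
    then show False using n by simp
  qed
qed

text \<open>Because \<open>d (x * v) = d x * v\<close>, the comparison \<open>notZ\<close> applies
  to every central value of a power of \<open>d\<close>. The order of nilpotency of \<open>d\<close>
  on \<open>I\<close> is lowered from three to one, first in even and then in odd degree, and
  primeness carries \<open>d = 0\<close> from \<open>I\<close> to the whole algebra.\<close>

theorem V0_central:
  assumes v: "v \<in> V" "v \<in> Ev" shows "v \<in> Z"
proof (rule ccontr)
  assume nz: "v \<notin> Z"
  have notZ: "z = 0" if "z \<in> Z" "z * v \<in> Z" for z using Z_div that nz by blast
  define d where "d x = v * x - x * v" for x
  have dG: "d x \<in> G k" if "x \<in> G k" for x k
    unfolding d_def using diff_G[OF mult_E_G[OF v(2) that] mult_G_E[OF v(2) that]] .
  have dm: "d (x * y) = d x * y + x * d y" for x y by (simp add: d_def algebra_simps)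
  have da: "d (x + y) = d x + d y" for x y by (simp add: d_def algebra_simps)
  have ds: "d (x - y) = d x - d y" for x y by (simp add: d_def algebra_simps)
  have d0: "d 0 = 0" by (simp add: d_def)
  have dmv: "d (x * v) = d x * v" for x by (simp add: d_def algebra_simps)
  have dI: "d i \<in> I" if "i \<in> I" for i unfolding d_def using that by blast
  \<comment> \<open>As \<open>v\<close> is even, \<open>d i = [v, i] = [-i, v]\<close> is itself a
    bracket from \<open>[I, A]\<close>.\<close>
  have dL: "d i \<in> Lie k" if "i \<in> I" "i \<in> G k" for i k
    using Lie_I_0[of "- i" k v] that v by (auto simp: d_def)
  have dV: "d l \<in> V" if "l \<in> Lie k" for l k unfolding d_def using V0_Lie v that by blast
  have ddV: "d (d i) \<in> V" if "i \<in> I" "i \<in> G k" for i k using dV dL that by blast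
  have d3: "d (d (d i)) = 0" if i: "i \<in> I" "i \<in> G k" for i k
  proof (cases k rule: bit_cases2)
    case 1
    have *: "d (d (d j)) \<in> Z" if "j \<in> I" "j \<in> Ev" for j
      using V00[OF v ddV[OF that]] dG that unfolding d_def[of "d (d j)"] by blast
    have "i * v \<in> Ev" using i v 1 by blast
    then have "d (d (d i)) * v \<in> Z" using *[of "i * v"] i by (simp add: dmv I_right)
    then show ?thesis using notZ * i 1 by blast
  next
    case 2
    then show ?thesis using V01[OF v ddV[OF i]] dG i unfolding d_def[of "d (d i)"] by auto
  qed
  have even: "d (d i) = 0" if i: "i \<in> I" "i \<in> Ev" for i
  proof -
    define p where "p = d (d i)"
    have pV: "p \<in> V" "p \<in> Ev" unfolding p_def using ddV[OF i] dG[OF dG[OF i(2)]] by simp_all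
    have vp: "v * p = p * v" using d3[OF i] unfolding p_def d_def[of "d (d i)"] by simp
    \<comment> \<open>If some \<open>d (d l)\<close> is nonzero, then \<open>w = d l\<close> has a
      nonzero central bracket \<open>z\<close> with \<open>v\<close>, so that bracketing with
      \<open>w\<close> acts on polynomials in \<open>v\<close> as \<open>-z\<close> times the
      derivative. This turns the centrality of brackets in \<open>V\<close> into polynomial
      relations for \<open>v\<close> with central coefficients. If there is no such
      \<open>l\<close>, the identity \<open>d (d l) = 0\<close> on all even brackets is exploited
      directly.\<close>
    have "p * p = 0"
    proof (cases "\<exists>l\<in>Lie 0. d (d l) \<noteq> 0")
      case True
      then obtain l where l: "l \<in> Lie 0" "d (d l) \<noteq> 0" by blast
      define w where "w = d l"
      define z where "z = d w"
      define c where "c = w * p - p * w"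
      have w: "w \<in> V" "w \<in> Ev" unfolding w_def using dV[OF l(1)] dG[OF Lie_G[OF l(1)]] by simp_all
      have z: "z \<in> Z" unfolding z_def d_def by (rule V00[OF v w])
      have z0: "z \<noteq> 0" using l by (simp add: z_def w_def)
      have c: "c \<in> Z" unfolding c_def by (rule V00[OF w pV])
      have D: "w * p = p * w + c" by (simp add: c_def)
      have E: "w * v = v * w - z" by (simp add: z_def d_def)
      have E': "w * (v * x) = v * (w * x) - z * x" for x using E by (metis left_diff_distrib mult.assoc)
      have D': "w * (p * x) = p * (w * x) + c * x" for x using D by (metis distrib_right mult.assoc)
      have zc: "v * z = z * v" "v * (z * y) = z * (v * y)"
          "p * z = z * p" "p * (z * y) = z * (p * y)"
          "w * z = z * w" "w * (z * y) = z * (w * y)" for y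
        using Zcomm[OF z, of v] Zcomm[OF z, of p] Zcomm[OF z, of w] by (simp_all flip: mult.assoc)
      have cc: "v * c = c * v" "v * (c * y) = c * (v * y)"
          "p * c = c * p" "p * (c * y) = c * (p * y)"
          "w * c = c * w" "w * (c * y) = c * (w * y)"
          "z * c = c * z" "z * (c * y) = c * (z * y)" for y
        using Zcomm[OF c, of v] Zcomm[OF c, of p] Zcomm[OF c, of w] Zcomm[OF c, of z] by (simp_all flip: mult.assoc)
      have iv: "i * v \<in> I" "i * v \<in> Ev" "i * v * v \<in> I" "i * v * v \<in> Ev" "i * v * v * v \<in> I" "i * v * v * v \<in> Ev"
        using i v by (simp_all add: I_right mult_EE)
      \<comment> \<open>By \<open>dmv\<close>, \<open>p * v^k\<close> is the second derivative of
        \<open>i * v^k\<close>, hence again an even element of \<open>V\<close> whose bracket with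
        \<open>w\<close> is central.\<close>
      have pv: "p * v \<in> V" "p * v \<in> Ev" "p * v * v \<in> V" "p * v * v \<in> Ev" "p * v * v * v \<in> V" "p * v * v * v \<in> Ev"
        using ddV[OF iv(1,2)] ddV[OF iv(3,4)] ddV[OF iv(5,6)] dG[OF dG[OF iv(2)]] dG[OF dG[OF iv(4)]] dG[OF dG[OF iv(6)]]
        unfolding p_def dmv by simp_all
      \<comment> \<open>The bracket of \<open>w\<close> with \<open>p v\<close> is
        \<open>c v - z p = -e\<close>. So \<open>e\<close> is central and
        \<open>z p = c v + e\<close> is linear in \<open>v\<close>. Substituting this, the bracket
        with \<open>p v^2\<close> becomes \<open>-g\<close> with
        \<open>g = c v^2 + 2 e v\<close>.\<close>
      define e where "e = z * p - c * v"
      have zp: "z * p = c * v + e" by (simp add: e_def)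
      have zp': "z * (p * x) = c * (v * x) + e * x" for x using zp by (metis distrib_right mult.assoc)
      have "w * (p * v) - p * v * w = - e"
        by (simp add: e_def algebra_simps D' E E' zc cc)
      then have "- e \<in> Z" using V00[OF w pv(1,2)] by simp
      then have e: "e \<in> Z" using Z_uminus by fastforce
      have ec: "v * e = e * v" "v * (e * y) = e * (v * y)"
          "p * e = e * p" "p * (e * y) = e * (p * y)"
          "w * e = e * w" "w * (e * y) = e * (w * y)"
          "z * e = e * z" "z * (e * y) = e * (z * y)"
          "c * e = e * c" "c * (e * y) = e * (c * y)" for y
        using Zcomm[OF e, of v] Zcomm[OF e, of p] Zcomm[OF e, of w] Zcomm[OF e, of z] Zcomm[OF e, of c] by (simp_all flip: mult.assoc)
      define g where "g = c * (v * v) + e * v + e * v"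
      have "w * (p * v * v) - p * v * v * w = - g"
        by (simp add: g_def algebra_simps D' E E' zc cc zp' ec)
      then have "- g \<in> Z" using V00[OF w pv(3,4)] by simp
      then have g: "g \<in> Z" using Z_uminus by fastforce
      have gc: "v * g = g * v" "v * (g * y) = g * (v * y)"
          "p * g = g * p" "p * (g * y) = g * (p * y)"
          "w * g = g * w" "w * (g * y) = g * (w * y)"
          "z * g = g * z" "z * (g * y) = g * (z * y)"
          "c * g = g * c" "c * (g * y) = g * (c * y)"
          "e * g = g * e" "e * (g * y) = g * (e * y)" for y
        using Zcomm[OF g, of v] Zcomm[OF g, of p] Zcomm[OF g, of w] Zcomm[OF g, of z] Zcomm[OF g, of c] Zcomm[OF g, of e] by (simp_all flip: mult.assoc)
      define h where "h = w * (p * v * v * v) - p * v * v * v * w"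
      have h: "h \<in> Z" unfolding h_def using V00[OF w pv(5,6)] .
      have h': "h = e * (v * v) - (g * v + g * v)"
        by (simp add: h_def g_def algebra_simps D' E E' zc cc zp' ec)
      \<comment> \<open>This is the discriminant of the quadratic relation
        \<open>c v^2 + 2 e v = g\<close>: completing the square gives
        \<open>(c v + e)^2 = y\<close>, that is, \<open>(z p)^2 = y\<close>. The bracket
        \<open>h\<close> of \<open>w\<close> with \<open>p v^3\<close> serves to eliminate the
        higher powers: \<open>e g - c h = 2 y v\<close> is central, and so \<open>notZ\<close>
        forces \<open>y = 0\<close>.\<close>
      define y where "y = c * g + e * e"
      have "y * v + y * v = e * g - c * h"
        by (simp add: h' y_def algebra_simps ec cc gc) (simp add: g_def algebra_simps ec cc)
      moreover have "e * g - c * h \<in> Z" by (intro Z_diff Z_mult e g c h)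
      ultimately have "y * v + y * v \<in> Z" by simp
      then have "y * v \<in> Z" by (rule Z_half)
      moreover have "y \<in> Z" unfolding y_def by (intro Z_add Z_mult c g e)
      ultimately have y: "y = 0" by (intro notZ)
      have "z * (z * (p * p)) = z * p * (z * p)" by (simp add: mult.assoc zc)
      also have "\<dots> = y" unfolding zp by (simp add: y_def g_def algebra_simps ec cc)
      finally have "z * (z * (p * p)) = 0" using y by simp
      then have "z * (p * p) = 0" using Z_regular[OF z, of "z * (p * p)"] z0 by simp
      then show ?thesis using Z_regular[OF z, of "p * p"] z0 by simp
    next
      case False
      \<comment> \<open>The bracket \<open>[j, a v]\<close> equals \<open>[j, a] v - a d j\<close>,
        and \<open>d (d ([j, a] v)) = d (d [j, a]) v = 0\<close>. Hence
        \<open>d (d (a * d j)) = 0\<close>, and the Leibniz rule with \<open>d^3 j = 0\<close> gives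
        the identity. At \<open>a = i\<close> and \<open>j = d i\<close> its second term vanishes
        and the first is \<open>p * p\<close>.\<close>
      have *: "d (d a) * d j + (d a * d (d j) + d a * d (d j)) = 0" if j: "j \<in> I" "j \<in> Ev" and a: "a \<in> Ev" for a j
      proof -
        have "d (d (j * a - a * j)) = 0" "d (d (j * (a * v) - (a * v) * j)) = 0"
          using False Lie_I_00[OF j a] Lie_I_00[OF j mult_EE[OF a v(2)]] by simp_all
        moreover have "j * (a * v) - (a * v) * j = (j * a - a * j) * v - a * d j"
          by (simp add: d_def algebra_simps)
        ultimately have "d (d (a * d j)) = 0" by (simp add: ds dmv)
        then show ?thesis using d3[OF j] by (simp add: dm da algebra_simps)
      qed
      show ?thesis using *[OF dI[OF i(1)] dG[OF i(2)] i(2)] d3[OF i] by (simp add: p_def d0)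
    qed
    then have "p = 0" by (rule V0_square_zero[OF pV])
    then show ?thesis by (simp only: p_def)
  qed
  have dd0: "d i * d j = 0" if "i \<in> I" "i \<in> Ev" "j \<in> I" "j \<in> Ev" for i j
  proof -
    have "d (d (i * j)) = d i * d j + d i * d j" using even that by (simp add: dm da)
    moreover have "d (d (i * j)) = 0" using even[of "i * j"] that by (simp add: I_left mult_EE)
    ultimately have "d i * d j + d i * d j = 0" by simp
    then show ?thesis by (rule double_zero)
  qed
  have dkd: "d i * k * d j = 0" if "i \<in> I" "i \<in> Ev" "j \<in> I" "j \<in> Ev" "k \<in> I" "k \<in> Ev" for i j k
  proof -
    have "d (i * k) * d j = 0" using that by (intro dd0 I_right mult_EE)
    moreover have "d k * d j = 0" using that by (intro dd0)
    ultimately show ?thesis by (simp add: dm distrib_right mult.assoc)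
  qed
  have d_even: "d i = 0" if i: "i \<in> I" "i \<in> Ev" for i
  proof (rule semiprime_I[OF dG[OF i(2)]])
    fix k m assume k: "k \<in> I" "k \<in> G m"
    show "d i * k * d i = 0"
    proof (cases m rule: bit_cases2)
      case 1 then show ?thesis using dkd[OF i i k(1)] k(2) by simp
    next
      case 2
      have di: "d i \<in> Ev" by (rule dG[OF i(2)])
      have kO: "k \<in> Od" using k(2) unfolding 2 .
      \<comment> \<open>The relation \<open>dkd\<close> covers only an even middle factor. For odd
        \<open>k\<close> semiprimeness is applied once more, to \<open>x = d i * k * d i\<close>: in
        \<open>x * n * x\<close> there is an even factor between two copies of \<open>d i\<close>,
        namely \<open>n\<close> if \<open>n\<close> is even and \<open>k * d i * n\<close> if
        \<open>n\<close> is odd.\<close>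
      have "d i * k * d i \<in> Od" by (intro mult_OE mult_EO di kO)
      then show ?thesis
      proof (rule semiprime_I)
        fix n r assume n: "n \<in> I" "n \<in> G r"
        show "d i * k * d i * n * (d i * k * d i) = 0"
        proof (cases r rule: bit_cases2)
          case 1
          then have z: "d i * n * d i = 0" using dkd[OF i i n(1)] n(2) by simp
          have "d i * k * d i * n * (d i * k * d i) = d i * k * (d i * n * d i) * k * d i"
            by (simp only: mult.assoc)
          then show ?thesis by (simp add: z)
        next
          case r: 2
          have "k * d i * n \<in> I" "k * d i * n \<in> Ev"
            by (intro I_left n(1)) (rule mult_OO[OF mult_OE[OF kO di] n(2)[unfolded r]])
          then have z: "d i * (k * d i * n) * d i = 0" by (rule dkd[OF i i])
          have "d i * k * d i * n * (d i * k * d i) = d i * (k * d i * n) * d i * k * d i"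
            by (simp only: mult.assoc)
          then show ?thesis by (simp add: z)
        qed
      qed
    qed
  qed
  have one: "d i * j + i * d j = 0" if "i \<in> I" "i \<in> Od" "j \<in> I" "j \<in> Od" for i j
    using d_even[of "i * j"] that by (simp add: dm I_left mult_OO)
  \<comment> \<open>By \<open>d3\<close> the element \<open>v\<close> commutes with
    \<open>?P\<close>. Replacing \<open>j\<close> by \<open>j * v\<close> therefore multiplies the
    central anticommutator by \<open>v\<close>, and \<open>notZ\<close> makes it vanish.\<close>
  have pq: "d (d i) * d (d j) + d (d j) * d (d i) = 0" if i: "i \<in> I" "i \<in> Od" and j: "j \<in> I" "j \<in> Od" for i j
  proof -
    let ?P = "d (d i)" and ?Q = "d (d j)"
    have jv: "j * v \<in> I" "j * v \<in> Od" using j v by (simp_all add: I_right mult_OE)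
    have "?Q * v \<in> V" "?Q * v \<in> Od" using ddV[OF jv] dG[OF dG[OF jv(2)]] by (simp_all add: dmv)
    moreover have P: "?P \<in> V" "?P \<in> Od" and Q: "?Q \<in> V" "?Q \<in> Od"
      using ddV[OF i] ddV[OF j] dG[OF dG[OF i(2)]] dG[OF dG[OF j(2)]] by simp_all
    ultimately have "?P * (?Q * v) + ?Q * v * ?P \<in> Z" using V11[OF P] by simp
    moreover have "v * ?P = ?P * v" using d3[OF i] unfolding d_def[of "d (d i)"] by simp
    ultimately have "(?P * ?Q + ?Q * ?P) * v \<in> Z" by (simp add: algebra_simps)
    then show ?thesis by (rule notZ[OF V11[OF P Q]])
  qed
  \<comment> \<open>Differentiate \<open>one\<close> at the pair \<open>i\<close>,
    \<open>d j\<close> and subtract \<open>one\<close> at the pair \<open>d i\<close>,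
    \<open>d j\<close>.\<close>
  have dq: "d i * d (d j) = 0" if i: "i \<in> I" "i \<in> Od" and j: "j \<in> I" "j \<in> Od" for i j
  proof -
    have "d (d i * d j + i * d (d j)) = 0" using one[OF i dI[OF j(1)] dG[OF j(2)]] by (simp add: d0)
    then have "d (d i) * d j + d i * d (d j) + d i * d (d j) = 0" using d3[OF j] by (simp add: da dm algebra_simps)
    moreover have "d (d i) * d j + d i * d (d j) = 0" using one[OF dI[OF i(1)] dG[OF i(2)] dI[OF j(1)] dG[OF j(2)]] .
    ultimately show ?thesis by simp
  qed
  have odd: "d (d i) = 0" if i: "i \<in> I" "i \<in> Od" for i
  proof (rule semiprime_I[OF dG[OF dG[OF i(2)]]])
    fix k m assume k: "k \<in> I" "k \<in> G m"
    show "d (d i) * k * d (d i) = 0"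
    proof (cases m rule: bit_cases2)
      case 1
      then have "i * k \<in> I" "i * k \<in> Od" using I_right[OF i(1)] mult_OE[OF i(2)] k(2) by simp_all
      then have A: "d (d (i * k)) * d (d i) + d (d i) * d (d (i * k)) = 0" by (rule pq[OF _ _ i])
      have dk: "d k = 0" using d_even k 1 by simp
      have e: "d (d (i * k)) = d (d i) * k" by (simp add: dm dk)
      have "d (d i) * k * d (d i) + d (d i) * d (d i) * k = 0" using A unfolding e by (simp only: mult.assoc)
      moreover have "d (d i) * d (d i) = 0" by (rule double_zero[OF pq[OF i i]])
      ultimately show ?thesis by simp
    next
      case 2
      have "d (d i) * k + d i * d k = 0" using one[OF dI[OF i(1)] dG[OF i(2)] k(1)] k(2) 2 by simp
      then have "d (d i) * k = - (d i * d k)" by (simp add: eq_neg_iff_add_eq_0)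
      then have "d (d i) * k * d (d i) = - (d i * (d k * d (d i)))" by (simp add: mult.assoc)
      then show ?thesis using dq k 2 i by simp
    qed
  qed
  have dd1: "d i * d j = 0" if i: "i \<in> I" "i \<in> Od" and j: "j \<in> I" "j \<in> Od" for i j
    using one[OF i dI[OF j(1)] dG[OF j(2)]] odd[OF j] by simp
  have d_odd: "d i = 0" if i: "i \<in> I" "i \<in> Od" for i
  proof (rule semiprime_I[OF dG[OF i(2)]])
    fix k m assume k: "k \<in> I" "k \<in> G m"
    show "d i * k * d i = 0"
    proof (cases m rule: bit_cases2)
      case 1
      then have "i * k \<in> I" "i * k \<in> Od" using I_right[OF i(1)] mult_OE[OF i(2)] k(2) by simp_all
      then have A: "d (i * k) * d i = 0" by (rule dd1[OF _ _ i])
      have dk: "d k = 0" using d_even k 1 by simp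
      show ?thesis using A by (simp add: dm dk)
    next
      case 2
      then have "d i * k = - (i * d k)" using one[OF i k(1)] k by (simp add: eq_neg_iff_add_eq_0)
      then show ?thesis using dd1[OF k(1) _ i] k 2 by (simp add: mult.assoc)
    qed
  qed
  have d_I: "d i = 0" if "i \<in> I" for i
    using d_even[OF I_hpart[OF that] hpart_G] d_odd[OF I_hpart[OF that] hpart_G]
      da[of "hpart G 0 i" "hpart G 1 i"] by (simp add: hpart_sum)
  obtain i k where i: "i \<in> I" "i \<in> G k" "i \<noteq> 0" by (rule I_nonzero_homog)
  have "d a = 0" if a: "a \<in> G j" for a j
  proof -
    have "d a * b * i = 0" for b
      using d_I[of "a * (b * i)"] d_I[of "b * i"] i by (simp add: dm I_left mult.assoc)
    then show ?thesis using prime_elements[OF dG[OF a], of i] i(3) by simp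
  qed
  then have "v * a = a * v" if "a \<in> G j" for a j using that unfolding d_def by simp
  then have "v \<in> Z" by (rule Z_I_homog[OF v(2)])
  then show False using nz by blast
qed

end

section \<open>Supercentralizers of orthogonal odd elements\<close>

context half_superalgebra begin

definition parity :: "'a \<Rightarrow> 'a" where "parity x = hpart G 0 x - hpart G 1 x"

lemma parity_Ev [simp]: "x \<in> Ev \<Longrightarrow> parity x = x" and parity_Od [simp]: "x \<in> Od \<Longrightarrow> parity x = - x"
  by (simp_all add: parity_def)

lemma parity_add: "parity (x + y) = parity x + parity y"
  by (simp add: parity_def hpart_add)

lemma parity_parity [simp]: "parity (parity x) = x"
proof -
  have "parity (hpart G 0 x + hpart G 1 (- x)) = hpart G 0 x - hpart G 1 (- x)" by (simp add: parity_add)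
  moreover have "hpart G 1 (- x) = - hpart G 1 x" using hpart_scale[of 1 "- 1" x] by simp
  ultimately show ?thesis by (simp add: parity_def hpart_sum)
qed

lemma parity_minus: "parity (- x) = - parity x"
  using parity_add[of x "- x"] parity_Ev[of 0] by (simp add: add_eq_0_iff)

lemma parity_diff: "parity (x - y) = parity x - parity y"
  using parity_add[of x "- y"] by (simp add: parity_minus)

lemma parity_mult: "parity (x * y) = parity x * parity y"
proof -
  have *: "parity (a * b) = parity a * parity b" if "a \<in> G i" "b \<in> G j" for a b i j
    using that by (cases i rule: bit_cases2; cases j rule: bit_cases2)
      (simp_all add: mult_EE mult_EO mult_OE mult_OO)
  have "parity ((hpart G 0 x + hpart G 1 x) * (hpart G 0 y + hpart G 1 y)) =
      parity (hpart G 0 x + hpart G 1 x) * parity (hpart G 0 y + hpart G 1 y)"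
    by (simp only: distrib_left distrib_right parity_add *[OF hpart_G hpart_G])
  then show ?thesis by (simp only: hpart_sum)
qed

text \<open>The parity automorphism absorbs the signs, so that supercommutation makes sense for
  inhomogeneous elements, too.\<close>

definition supercent :: "'a list \<Rightarrow> 'a set" where
  "supercent es = {a. \<forall>e\<in>set es. e * a = parity a * e}"

fun orthogonal :: "'a list \<Rightarrow> bool" where
  "orthogonal [] = True"
| "orthogonal (e # es) \<longleftrightarrow> e \<in> Od \<and> e * e \<in> Z - {0} \<and> (\<forall>f\<in>set es. e * f = - (f * e)) \<and> orthogonal es"

text \<open>The recursion branches on whether \<open>e\<close> occurs. An element is thus a sum over
  sublists of \<open>es\<close> of the ordered product of the sublist times a coefficient from
  \<open>S\<close> on its right. Both spanning and independence can then be proved one generator at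
  a time.\<close>

fun prod_span :: "'a set \<Rightarrow> 'a list \<Rightarrow> 'a set" where
  "prod_span S [] = S"
| "prod_span S (e # es) = {g + e * h | g h. g \<in> prod_span S es \<and> h \<in> prod_span S es}"

text \<open>The factor \<open>z\<close> clears denominators: the condition says that the ordered
  products span the localization over the field of central fractions, but it is expressed inside the
  algebra.\<close>

definition spanning :: "'a list \<Rightarrow> bool" where
  "spanning es \<longleftrightarrow> orthogonal es \<and> (\<forall>a. \<exists>z\<in>Z - {0}. z * a \<in> prod_span Z es)"

lemma orthogonal_Od: "orthogonal es \<Longrightarrow> e \<in> set es \<Longrightarrow> e \<in> Od"
  by (induction es) auto

lemma orthogonal_append:
  "orthogonal (es @ fs) \<longleftrightarrow> orthogonal es \<and> orthogonal fs \<and> (\<forall>e\<in>set es. \<forall>f\<in>set fs. e * f = - (f * e))"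
  by (induction es) auto

lemma prod_span_append: "prod_span S (es @ fs) = prod_span (prod_span S fs) es"
  by (induction es) auto

lemma prod_span_mono: "S \<subseteq> T \<Longrightarrow> prod_span S es \<subseteq> prod_span T es"
  by (induction es) auto

lemma prod_span_Z_mult:
  assumes "z \<in> Z" "\<And>s. s \<in> S \<Longrightarrow> z * s \<in> T" "x \<in> prod_span S es" shows "z * x \<in> prod_span T es"
  using assms(3)
proof (induction es arbitrary: x)
  case (Cons e es)
  then obtain g h where gh: "x = g + e * h" "g \<in> prod_span S es" "h \<in> prod_span S es" by auto
  have "z * (e * h) = e * (z * h)" using arg_cong[OF Zcomm[OF assms(1), of e], of "\<lambda>t. t * h"] by (simp add: mult.assoc)
  then have "z * x = z * g + e * (z * h)" using gh by (simp add: distrib_left)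
  then show ?case using Cons.IH gh by auto
qed (use assms in simp)

lemma supercent_mult:
  assumes "a \<in> supercent es" "b \<in> supercent es" shows "a * b \<in> supercent es"
  unfolding supercent_def
proof (intro CollectI ballI)
  fix e assume "e \<in> set es"
  then have e: "e * a = parity a * e" "e * b = parity b * e" using assms by (auto simp: supercent_def)
  have "e * (a * b) = e * a * b" by (simp only: mult.assoc)
  also have "\<dots> = parity a * (e * b)" by (simp only: e(1) mult.assoc)
  also have "\<dots> = parity (a * b) * e" by (simp only: e(2) parity_mult mult.assoc)
  finally show "e * (a * b) = parity (a * b) * e" .
qed

lemma Z_supercent: "z \<in> Z \<Longrightarrow> z \<in> supercent es"
  by (simp add: supercent_def ZE Zcomm)

lemma supercent_Z_mult: "z \<in> Z \<Longrightarrow> a \<in> supercent es \<Longrightarrow> z * a \<in> supercent es"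
  by (rule supercent_mult[OF Z_supercent])

lemma supercent_add: "a \<in> supercent es \<Longrightarrow> b \<in> supercent es \<Longrightarrow> a + b \<in> supercent es"
  by (auto simp: supercent_def parity_add distrib_left distrib_right)

lemma supercent_diff: "a \<in> supercent es \<Longrightarrow> b \<in> supercent es \<Longrightarrow> a - b \<in> supercent es"
  by (auto simp: supercent_def parity_diff algebra_simps)

lemma supercent_parity:
  assumes "set es \<subseteq> Od" "a \<in> supercent es" shows "parity a \<in> supercent es"
  unfolding supercent_def
proof (intro CollectI ballI)
  fix e assume e: "e \<in> set es"
  then have "parity (e * a) = parity (parity a * e)" using assms by (simp add: supercent_def)
  then show "e * parity a = parity (parity a) * e" using e assms(1) by (simp add: parity_mult subset_iff)
qed

lemma supercent_hpart:
  assumes es: "set es \<subseteq> Od" and a: "a \<in> supercent es" shows "hpart G i a \<in> supercent es"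
proof -
  have *: "x \<in> supercent es" if "x + x \<in> supercent es" for x
    using that unfolding supercent_def
    by (intro CollectI ballI double_cancel[of "_ * x"]) (simp add: parity_add distrib_left distrib_right)
  have s: "hpart G 0 a + hpart G 1 a = a" by (rule hpart_sum)
  show ?thesis
  proof (cases i rule: bit_cases2)
    case 1
    have "hpart G 0 a + hpart G 0 a = (hpart G 0 a + hpart G 1 a) + parity a" by (simp add: parity_def)
    then have "hpart G 0 a + hpart G 0 a = a + parity a" unfolding s .
    then have "hpart G 0 a + hpart G 0 a \<in> supercent es" using supercent_add[OF a supercent_parity[OF es a]] by simp
    then have "hpart G 0 a \<in> supercent es" by (rule *)
    then show ?thesis unfolding 1 .
  next
    case 2
    have "hpart G 1 a + hpart G 1 a = (hpart G 0 a + hpart G 1 a) - parity a" by (simp add: parity_def)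
    then have "hpart G 1 a + hpart G 1 a = a - parity a" unfolding s .
    then have "hpart G 1 a + hpart G 1 a \<in> supercent es" using supercent_diff[OF a supercent_parity[OF es a]] by simp
    then have "hpart G 1 a \<in> supercent es" by (rule *)
    then show ?thesis unfolding 2 .
  qed
qed

text \<open>If \<open>a = x + e * y\<close> with \<open>x\<close>, \<open>y\<close> supercommuting
  with \<open>e\<close>, then the superbracket \<open>e * a - parity a * e\<close> picks out
  \<open>2 e^2 y\<close>, since \<open>e\<close> supercommutes with \<open>x\<close> and doubles the
  other term. What remains of \<open>2 e^2 a\<close> is \<open>2 e^2 x\<close>. The formulas make
  sense for every \<open>a\<close> and need no division by \<open>2 e^2\<close>.\<close>

lemma decompose:
  assumes e: "e \<in> Od" and ee: "e * e \<in> Z"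
  shows "e * e * a + e * e * a = (e * (e * a) + e * parity a * e) + e * (e * a - parity a * e)"
    and "e * a - parity a * e \<in> supercent [e]" and "e * (e * a) + e * parity a * e \<in> supercent [e]"
proof -
  have c: "x * (e * e) = e * (e * x)" "x * (e * (e * y)) = e * (e * (x * y))" for x y
    using Zcomm[OF ee, of x] by (simp_all flip: mult.assoc)
  have pe: "parity e = - e" using e by simp
  show "e * e * a + e * e * a = (e * (e * a) + e * parity a * e) + e * (e * a - parity a * e)"
    by (simp add: algebra_simps)
  show "e * a - parity a * e \<in> supercent [e]"
    by (simp add: supercent_def parity_diff parity_mult pe algebra_simps c[of a])
  show "e * (e * a) + e * parity a * e \<in> supercent [e]"
    by (simp add: supercent_def parity_add parity_mult pe algebra_simps c[of a] c[of "parity a"])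
qed

text \<open>Guarantees that splitting off \<open>e\<close> does not destroy supercommutation with
  generators \<open>f\<close> split off earlier, so that \<open>decompose\<close> can be iterated
  along an orthogonal list.\<close>

lemma supercent_skew:
  assumes f: "f \<in> Od" "e \<in> Od" "f * e = - (e * f)" and a: "f * a = parity a * f"
  shows "f * (e * a) = parity (e * a) * f" and "f * (e * a - parity a * e) = parity (e * a - parity a * e) * f"
    and "f * (e * (e * a) + e * parity a * e) = parity (e * (e * a) + e * parity a * e) * f"
proof -
  have fe: "f * (e * x) = - (e * (f * x))" for x
    using arg_cong[OF f(3), of "\<lambda>t. t * x"] by (simp add: mult.assoc)
  have fa: "f * (a * x) = parity a * (f * x)" for x using arg_cong[OF a, of "\<lambda>t. t * x"] by (simp add: mult.assoc)
  have "parity (f * a) = parity (parity a * f)" using a by simp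
  then have b: "f * parity a = a * f" using f by (simp add: parity_mult)
  then have fb: "f * (parity a * x) = a * (f * x)" for x by (simp only: mult.assoc[symmetric] b)
  show "f * (e * a) = parity (e * a) * f" "f * (e * a - parity a * e) = parity (e * a - parity a * e) * f"
    "f * (e * (e * a) + e * parity a * e) = parity (e * (e * a) + e * parity a * e) * f"
    using f by (simp_all add: parity_mult parity_diff parity_add algebra_simps fe fa fb a f(3))
qed

end

context half_prime_superalgebra begin

lemma double_nonzero: "z \<noteq> 0 \<Longrightarrow> z + z \<noteq> (0::'a)" using double_zero[of z] by auto

lemma Z_mult_nonzero: "z \<in> Z \<Longrightarrow> z \<noteq> 0 \<Longrightarrow> w \<noteq> 0 \<Longrightarrow> z * w \<noteq> 0" using Z_regular[of z w] by auto

text \<open>The list \<open>fs\<close> collects the generators already split off. Both components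
  given by \<open>decompose\<close> supercommute with \<open>fs @ [e]\<close> and remain in the
  ideal \<open>J\<close>, so the induction goes on with them. The version with \<open>J\<close> is
  needed to find elements of \<open>I\<close> inside the supercentralizer.\<close>

lemma prod_span_decompose:
  assumes J: "graded_ideal scale G J"
    and "orthogonal es" "orthogonal fs" "\<forall>f\<in>set fs. \<forall>e\<in>set es. f * e = - (e * f)" "a \<in> supercent fs" "a \<in> J"
    and Z: "Z \<noteq> {0}"
  shows "\<exists>z\<in>Z - {0}. z * a \<in> prod_span (supercent (fs @ es) \<inter> J) es"
  using assms(2-6)
proof (induction es arbitrary: fs a)
  case Nil
  obtain z where z: "z \<in> Z" "z \<noteq> 0" using Z by auto
  have "z * a \<in> J" using J Nil by (simp add: graded_ideal_def)
  then show ?case using supercent_Z_mult z Nil by auto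
next
  case (Cons e es)
  have J': "y * x \<in> J" "x * y \<in> J" if "x \<in> J" for x y using J that by (simp_all add: graded_ideal_def)
  have Js: "graded_submodule scale G J" using J by (simp add: graded_ideal_def)
  have e: "e \<in> Od" "e * e \<in> Z" "e * e \<noteq> 0" using Cons.prems by auto
  define h where "h = e * a - parity a * e"
  define g where "g = e * (e * a) + e * parity a * e"
  have pJ: "parity a \<in> J" unfolding parity_def by (intro gsub_diff[OF Js] gsub_hpart[OF Js] Cons.prems)
  have hJ: "h \<in> J" unfolding h_def by (intro gsub_diff[OF Js] J' pJ Cons.prems)
  have gJ: "g \<in> J" unfolding g_def by (intro gsub_add[OF Js] J' pJ Cons.prems)
  have hC: "h \<in> supercent (fs @ [e])" and gC: "g \<in> supercent (fs @ [e])"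
    using decompose(2,3)[OF e(1,2), of a] supercent_skew(2,3)[OF orthogonal_Od[OF Cons.prems(2)] e(1)] Cons.prems(3,4)
    unfolding h_def g_def supercent_def by simp_all
  have o: "orthogonal es" "orthogonal (fs @ [e])" "\<forall>f\<in>set (fs @ [e]). \<forall>e\<in>set es. f * e = - (e * f)"
    using Cons.prems by (auto simp: orthogonal_append)
  obtain z w where z: "z \<in> Z" "z \<noteq> 0" "z * g \<in> prod_span (supercent (fs @ e # es) \<inter> J) es"
    and w: "w \<in> Z" "w \<noteq> 0" "w * h \<in> prod_span (supercent (fs @ e # es) \<inter> J) es"
    using Cons.IH[OF o gC gJ] Cons.IH[OF o hC hJ] by auto
  let ?S = "supercent (fs @ e # es) \<inter> J"
  have wz: "w * (z * g) \<in> prod_span ?S es" "z * (w * h) \<in> prod_span ?S es"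
    using prod_span_Z_mult[OF w(1) _ z(3), of ?S] prod_span_Z_mult[OF z(1) _ w(3), of ?S] supercent_Z_mult z(1) w(1) J' by auto
  \<comment> \<open>Common denominator: \<open>z\<close> and \<open>w\<close> belong to the two
    components, and \<open>2 e^2\<close> is the factor lost in \<open>decompose\<close>.\<close>
  define q where "q = z * (w * (e * e + e * e))"
  have eq: "q * a = w * (z * g) + e * (z * (w * h))"
  proof -
    have comm: "t * (x * y) = x * (t * y)" if "t \<in> Z" for t x y
      using Zcomm[OF that, of x] by (simp flip: mult.assoc)
    have "q * a = z * (w * (g + e * h))"
      unfolding q_def g_def h_def decompose(1)[OF e(1,2), of a, symmetric] by (simp add: algebra_simps)
    also have "\<dots> = w * (z * g) + e * (z * (w * h))"
      using comm[OF z(1), of w g] comm[OF z(1), of e "w * h"] comm[OF w(1), of e h]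
      by (simp add: distrib_left)
    finally show ?thesis .
  qed
  have "q \<in> Z" unfolding q_def by (intro Z_mult Z_add z w e)
  moreover have "q \<noteq> 0" unfolding q_def
    by (intro Z_mult_nonzero double_nonzero z w e)
  moreover have "q * a \<in> prod_span ?S (e # es)" unfolding eq using wz by auto
  ultimately show ?case by blast
qed

lemma Z_comm_left: "z \<in> Z \<Longrightarrow> x * (z * y) = z * (x * y)"
  using Zcomm[of z x] by (simp flip: mult.assoc)

text \<open>A common supercentralizer of orthogonal odd elements is again semiprime: modulo central
  denominators the algebra is spanned by the products of the elements of the centralizer with these
  odd elements, and the latter can be moved past a homogeneous \<open>j\<close>.\<close>

lemma supercent_semiprime:
  assumes es: "orthogonal es" and Z: "Z \<noteq> {0}" and j: "j \<in> supercent es" "j \<in> G k" "j \<noteq> 0"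
  shows "\<exists>c m. c \<in> supercent es \<and> c \<in> G m \<and> j * c * j \<noteq> 0"
proof (rule ccontr)
  assume "\<not> ?thesis"
  then have n: "j * c * j = 0" if "c \<in> supercent es" "c \<in> G m" for c m using that by blast
  have Od: "set es \<subseteq> Od" using orthogonal_Od[OF es] by blast
  have n': "j * c * j = 0" if c: "c \<in> supercent es" for c
    using n[OF supercent_hpart[OF Od c] hpart_G, of 0] n[OF supercent_hpart[OF Od c] hpart_G, of 1] hpart_sum[of c]
    by (metis add.right_neutral distrib_left distrib_right)
  have span: "j * x * j = 0" if "set fs \<subseteq> set es" "x \<in> prod_span (supercent es) fs" for fs x
    using that
  proof (induction fs arbitrary: x)
    case (Cons e fs)
    then obtain g h where gh: "x = g + e * h" "g \<in> prod_span (supercent es) fs" "h \<in> prod_span (supercent es) fs" by auto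
    have "e * j = parity j * e" using Cons.prems j(1) by (simp add: supercent_def)
    \<comment> \<open>Homogeneity of \<open>j\<close> makes \<open>parity j\<close> a sign, so
      \<open>e\<close> can be pulled out of \<open>j * e * h * j\<close>.\<close>
    moreover have "parity j = j \<or> parity j = - j" using j(2) by (cases k rule: bit_cases2) auto
    ultimately have ej: "j * e = e * j \<or> j * e = - (e * j)" by auto
    have "j * h * j = 0" "j * g * j = 0" using Cons gh by auto
    moreover have "j * (e * h) * j = j * e * h * j" by (simp only: mult.assoc)
    moreover have "j * e * h * j = e * (j * h * j) \<or> j * e * h * j = - (e * (j * h * j))"
      using ej by (auto simp flip: mult.assoc)
    ultimately have "j * (e * h) * j = 0" by auto
    then show ?case using \<open>j * g * j = 0\<close> gh(1) by (simp add: distrib_left distrib_right)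
  qed (use n' in simp)
  have "j * a * j = 0" for a
  proof -
    obtain z where z: "z \<in> Z" "z \<noteq> 0" "z * a \<in> prod_span (supercent ([] @ es) \<inter> UNIV) es"
      using prod_span_decompose[OF UNIV_ideal es, of "[]" a] Z by (auto simp: supercent_def)
    then have "j * (z * a) * j = 0" using span[of es] by simp
    then have "z * (j * a * j) = 0" by (simp add: Z_comm_left[OF z(1)] mult.assoc)
    then show ?thesis using Z_regular z by blast
  qed
  then show False using prime_elements[OF j(2), of j] j(3) by blast
qed

end

section \<open>From central products in a supercentralizer to a spanning list\<close>

context lie_pair begin

text \<open>One factor is restricted to \<open>I\<close> because only brackets with \<open>I\<close>
  are under control. Products of two elements of equal degree are even, so membership in
  \<open>Z\<close> is a sensible demand. A nonempty orthogonal list also guarantees that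
  \<open>Z\<close> contains nonzero denominators.\<close>

definition good :: "'a list \<Rightarrow> bool" where
  "good es \<longleftrightarrow> orthogonal es \<and> es \<noteq> [] \<and>
    (\<forall>k. \<forall>i\<in>I \<inter> supercent es \<inter> G k. \<forall>s\<in>supercent es \<inter> G k. i * s \<in> Z)"

lemma orthogonal_Z_nonzero: "orthogonal es \<Longrightarrow> es \<noteq> [] \<Longrightarrow> Z \<noteq> {0}"
  by (cases es) auto

text \<open>A nonzero element of \<open>I\<close>, multiplied by a denominator, is a combination of
  ordered products with coefficients in \<open>I \<inter> supercent es\<close>; these coefficients
  cannot all vanish.\<close>

lemma good_I_nonzero:
  assumes "good es" obtains j k where "j \<in> I" "j \<in> supercent es" "j \<in> G k" "j \<noteq> 0"
proof -
  have es: "orthogonal es" "es \<noteq> []" using assms by (auto simp: good_def)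
  have Od: "set es \<subseteq> Od" using orthogonal_Od[OF es(1)] by blast
  obtain i m where i: "i \<in> I" "i \<in> G m" "i \<noteq> 0" by (rule I_nonzero_homog)
  obtain z where z: "z \<in> Z" "z \<noteq> 0" "z * i \<in> prod_span (supercent es \<inter> I) es"
    using prod_span_decompose[OF I_ideal es(1), of "[]" i] orthogonal_Z_nonzero[OF es] i(1) by (auto simp: supercent_def)
  have "prod_span {0} es = {0}" by (induction es) auto
  then have "\<not> supercent es \<inter> I \<subseteq> {0}" using z Z_mult_nonzero[OF z(1,2) i(3)] prod_span_mono[of "supercent es \<inter> I" "{0}" es] by auto
  then obtain x where x: "x \<in> supercent es" "x \<in> I" "x \<noteq> 0" by blast
  then have "hpart G 0 x \<noteq> 0 \<or> hpart G 1 x \<noteq> 0" using hpart_sum[of x] by (metis add_0)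
  then show ?thesis using that[OF I_hpart[OF x(2)] supercent_hpart[OF Od x(1)] hpart_G] by blast
qed

text \<open>It suffices to find a nonzero product of two elements of equal degree in the
  supercentralizer whose first factor lies in \<open>I\<close>. Semiprimeness gives
  \<open>j c j \<noteq> 0\<close>. If the degrees of \<open>j\<close> and \<open>c\<close> differ
  and \<open>j\<close> is odd, the factors \<open>j c\<close> and \<open>j\<close> will do. If
  \<open>j\<close> is even, then \<open>t = j c\<close> is odd, and semiprimeness at
  \<open>t\<close> gives \<open>t d t \<noteq> 0\<close>; the factors are \<open>t\<close>,
  \<open>d\<close> or \<open>t d\<close>, \<open>t\<close> according to the degree of
  \<open>d\<close>.\<close>

lemma good_center:
  assumes "good es" obtains z where "z \<in> Z" "z \<in> I" "z \<noteq> 0"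
proof -
  have es: "orthogonal es" "es \<noteq> []" using assms by (auto simp: good_def)
  note sp = supercent_semiprime[OF es(1) orthogonal_Z_nonzero[OF es]]
  have gd: "i * s \<in> Z" if "i \<in> I" "i \<in> supercent es" "i \<in> G k" "s \<in> supercent es" "s \<in> G k" for i s k
    using assms that by (auto simp: good_def)
  have fin: "\<exists>z. z \<in> Z \<and> z \<in> I \<and> z \<noteq> 0" if "i \<in> I" "i \<in> supercent es" "i \<in> G k" "s \<in> supercent es" "s \<in> G k" "i * s \<noteq> 0" for i s k
    using gd[of i k s] that I_right by blast
  have nz: "x * y \<noteq> 0" "y * x \<noteq> 0" if "x * y * x \<noteq> 0" for x y :: 'a
  proof -
    show "x * y \<noteq> 0" using that by auto
    show "y * x \<noteq> 0" using that by (auto simp: mult.assoc)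
  qed
  obtain j k where j: "j \<in> I" "j \<in> supercent es" "j \<in> G k" "j \<noteq> 0" by (rule good_I_nonzero[OF assms])
  obtain c m where c: "c \<in> supercent es" "c \<in> G m" "j * c * j \<noteq> 0" using sp[OF j(2-4)] by blast
  have "\<exists>z. z \<in> Z \<and> z \<in> I \<and> z \<noteq> 0"
  proof (cases "m = k")
    case True
    then show ?thesis using fin[OF j(1-3) c(1)] c(2) nz(1)[OF c(3)] by simp
  next
    case False
    have t: "j * c \<in> I" "j * c \<in> supercent es" using j c supercent_mult by blast+
    show ?thesis
    proof (cases k rule: bit_cases2)
      case 2
      then have "m = 0" using False by (cases m rule: bit_cases2) auto
      then have "j * c \<in> Od" using j(3) c(2) 2 by blast
      then show ?thesis using fin[OF t _ j(2)] j(3) c(3) 2 by simp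
    next
      case 1
      then have "m = 1" using False by (cases m rule: bit_cases2) auto
      then have tO: "j * c \<in> Od" using j(3) c(2) 1 by blast
      obtain d n where d: "d \<in> supercent es" "d \<in> G n" "j * c * d * (j * c) \<noteq> 0"
        using sp[OF t(2) tO nz(1)[OF c(3)]] by blast
      show ?thesis
      proof (cases n rule: bit_cases2)
        case 2
        then show ?thesis using fin[OF t tO d(1)] d(2) nz(1)[OF d(3)] by simp
      next
        case 1
        have "j * c * d \<in> I" "j * c * d \<in> supercent es" "j * c * d \<in> Od"
          using t tO d(1) d(2)[unfolded 1] supercent_mult by blast+
        then show ?thesis using fin[OF _ _ _ t(2) tO d(3)] by blast
      qed
    qed
  qed
  then show ?thesis using that by blast
qed

text \<open>A nonzero central \<open>z\<close> in \<open>I\<close> removes the restriction to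
  \<open>I\<close>: for even \<open>c\<close> in the supercentralizer \<open>z c\<close> is central,
  hence so is \<open>c\<close>. Products of two odd elements are then central as well, so the odd
  part is either zero or of rank one, generated up to denominators by any nonzero
  \<open>c\<close>.\<close>

lemma good_spanning:
  assumes g: "good es"
  shows "spanning es \<or> (\<exists>c. spanning (es @ [c]))"
proof -
  have es: "orthogonal es" "es \<noteq> []" using g by (auto simp: good_def)
  have Z0: "Z \<noteq> {0}" by (rule orthogonal_Z_nonzero[OF es])
  have Od: "set es \<subseteq> Od" using orthogonal_Od[OF es(1)] by blast
  have gd: "i * s \<in> Z" if "i \<in> I" "i \<in> supercent es" "i \<in> G k" "s \<in> supercent es" "s \<in> G k" for i s k
    using g that by (auto simp: good_def)
  obtain z where z: "z \<in> Z" "z \<in> I" "z \<noteq> 0" by (rule good_center[OF g])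
  have ev: "c \<in> Z" if "c \<in> supercent es" "c \<in> Ev" for c
    using gd[OF z(2) Z_supercent[OF z(1)] ZE[OF z(1)] that] by (rule Z_div[OF z(1,3)])
  have od: "c * d \<in> Z" if "c \<in> supercent es" "c \<in> Od" "d \<in> supercent es" "d \<in> Od" for c d
    using ev[OF supercent_mult[OF that(1,3)] mult_OO[OF that(2,4)]] .
  have dec: "\<exists>w\<in>Z - {0}. w * a \<in> prod_span (supercent es) es" for a
    using prod_span_decompose[OF UNIV_ideal es(1), of "[]" a] Z0 by (auto simp: supercent_def)
  show ?thesis
  proof (cases "supercent es \<inter> Od \<subseteq> {0}")
    case True
    have "supercent es \<subseteq> Z"
    proof
      fix x assume x: "x \<in> supercent es"
      have "hpart G 1 x = 0" using supercent_hpart[OF Od x, of 1] True by auto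
      then have "hpart G 0 x = x" using hpart_sum[of x] by simp
      then show "x \<in> Z" using ev[OF supercent_hpart[OF Od x, of 0] hpart_G] by simp
    qed
    then have "spanning es" unfolding spanning_def using dec prod_span_mono[of "supercent es" Z es] es(1) by blast
    then show ?thesis ..
  next
    case False
    then obtain c where c: "c \<in> supercent es" "c \<in> Od" "c \<noteq> 0" by blast
    define q where "q = c * c"
    have q: "q \<in> Z" unfolding q_def by (rule od[OF c(1,2) c(1,2)])
    \<comment> \<open>For every homogeneous \<open>d\<close> in the supercentralizer,
      \<open>c * d * c\<close> is \<open>d * q\<close> or \<open>q * d\<close>, because
      \<open>d\<close> itself or \<open>c * d\<close> is central. Semiprimeness excludes
      \<open>q = 0\<close>.\<close>
    have q0: "q \<noteq> 0"
    proof
      assume "q = 0"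
      obtain d m where d: "d \<in> supercent es" "d \<in> G m" "c * d * c \<noteq> 0" using supercent_semiprime[OF es(1) Z0 c] by blast
      show False
      proof (cases m rule: bit_cases2)
        case 1
        then have "d \<in> Z" using ev d by blast
        then have "c * d * c = d * q" using Zcomm[of d c] by (simp add: q_def flip: mult.assoc)
        then show False using d(3) \<open>q = 0\<close> by simp
      next
        case 2
        then have "d \<in> Od" using d(2) by simp
        then have "c * d * c = c * (c * d)" using Zcomm[OF od[OF c(1,2) d(1)]] by simp
        also have "\<dots> = q * d" by (simp add: q_def mult.assoc)
        finally show False using d(3) \<open>q = 0\<close> by simp
      qed
    qed
    have "e * c = - (c * e)" if "e \<in> set es" for e using c that by (simp add: supercent_def)
    then have o: "orthogonal (es @ [c])" using es(1) c q q0 by (simp add: orthogonal_append q_def)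
    \<comment> \<open>The odd part \<open>y\<close> of \<open>x\<close> satisfies
      \<open>q * y = c * (c * y)\<close> with \<open>c * y\<close> central.\<close>
    have C: "q * x \<in> prod_span Z [c]" if x: "x \<in> supercent es" for x
    proof -
      have "q * x = q * hpart G 0 x + c * (c * hpart G 1 x)"
        using arg_cong[OF hpart_sum[of x], of "\<lambda>t. q * t"] by (simp add: distrib_left q_def mult.assoc)
      moreover have "q * hpart G 0 x \<in> Z" using ev[OF supercent_hpart[OF Od x] hpart_G] q by blast
      moreover have "c * hpart G 1 x \<in> Z" using od[OF c(1,2) supercent_hpart[OF Od x] hpart_G] .
      ultimately show ?thesis by auto
    qed
    have "spanning (es @ [c])"
      unfolding spanning_def
    proof (intro conjI allI o)
      fix a
      obtain w where w: "w \<in> Z" "w \<noteq> 0" "w * a \<in> prod_span (supercent es) es" using dec by blast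
      have "q * (w * a) \<in> prod_span (prod_span Z [c]) es" by (rule prod_span_Z_mult[OF q C w(3)])
      then have "q * w * a \<in> prod_span Z (es @ [c])" unfolding prod_span_append by (simp add: mult.assoc)
      then show "\<exists>z\<in>Z - {0}. z * a \<in> prod_span Z (es @ [c])"
        using Z_mult[OF q w(1)] Z_mult_nonzero[OF q q0 w(2)] by blast
    qed
    then show ?thesis by blast
  qed
qed

end

section \<open>The odd part of \<open>V\<close>\<close>

context lie_pair begin

lemma V1_Lie1_Z: assumes "v \<in> V" "v \<in> Od" "l \<in> Lie 1" shows "v * l + l * v \<in> Z"
proof -
  have "v * l + l * v \<in> Ev" using mult_OO[OF assms(2) Lie_G[OF assms(3)]] mult_OO[OF Lie_G[OF assms(3)] assms(2)] by (rule add_G)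
  then show ?thesis by (rule V0_central[OF V1_Lie1[OF assms]])
qed

lemma V1_square: "v \<in> V \<Longrightarrow> v \<in> Od \<Longrightarrow> v * v \<in> Z"
  by (rule Z_half[OF V11])

text \<open>Here \<open>v * l * v = 0\<close> for all odd brackets \<open>l\<close>; the brackets \<open>[i, v b]\<close> and \<open>[i, v b v]\<close>
  make \<open>v i v\<close> generate a nilpotent ideal.\<close>

lemma V1_nilpotent_bracket:
  assumes v: "v \<in> V" "v \<in> Od" "v * v = 0" and l: "\<And>l. l \<in> Lie 1 \<Longrightarrow> v * l + l * v = 0"
  shows "v = 0"
proof -
  have vv: "v * (v * x) = 0" for x using v(3) by (simp flip: mult.assoc)
  have vlv: "v * l * v = 0" if "l \<in> Lie 1" for l
    using arg_cong[OF l[OF that], of "\<lambda>t. v * t"] by (simp add: distrib_left vv mult.assoc)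
  have vb: "v * b \<in> Od" "b * v \<in> Od" if "b \<in> Ev" for b using v(2) that by (simp_all add: mult_OE mult_EO)
  have vb': "v * b \<in> Ev" "b * v \<in> Ev" if "b \<in> Od" for b using v(2) that by (simp_all add: mult_OO)
  have L: "i * (v * b) - v * b * i \<in> Lie 1" if "i \<in> I" "i \<in> G k" "b \<in> G k" for i b k
    using that by (cases k rule: bit_cases2) (auto intro: Lie_I_01 Lie_I_10 vb vb')
  have same: "v * i * v * b * v = 0" if "i \<in> I" "i \<in> G k" "b \<in> G k" for i b k
    using vlv[OF L[OF that]] by (simp add: algebra_simps vv)
  have opp: "v * i * v * b * v = v * b * v * i * v" if "i \<in> I" "i \<in> Od" "b \<in> Ev" for i b
  proof -
    have "v * b * v \<in> Ev" using vb(1)[OF that(3)] v(2) by (rule mult_OO)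
    then have "i * (v * b * v) - v * b * v * i \<in> Lie 1" by (rule Lie_I_10[OF that(1,2)])
    from l[OF this] show ?thesis by (simp add: algebra_simps vv v(3))
  qed
  have "v * i * v = 0" if i: "i \<in> I" "i \<in> G k" for i k
  proof -
    have "v * i * v * b * (v * i * v) = 0" if b: "b \<in> G m" for b m
    proof (cases "k = m")
      case True
      have "v * i * v * b * (v * i * v) = v * i * v * b * v * i * v" by (simp only: mult.assoc)
      then show ?thesis using same[OF i, of b] b True by simp
    next
      case False
      show ?thesis
      proof (cases k rule: bit_cases2)
        case 1
        then have "b \<in> Od" using False b by (cases m rule: bit_cases2) auto
        then have "b * v * i \<in> Ev" using i(2) unfolding 1 by (intro mult_EE vb')
        moreover have "v * i * v * b * (v * i * v) = v * i * v * (b * v * i) * v" by (simp only: mult.assoc)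
        ultimately show ?thesis using same[OF i, of "b * v * i"] 1 by simp
      next
        case 2
        then have "b \<in> Ev" using False b by (cases m rule: bit_cases2) auto
        \<comment> \<open>Reordering brings the two occurrences of \<open>i\<close> together: the
          product then contains \<open>v * i * v * i * v\<close>, which is zero by
          \<open>same\<close> with \<open>b = i\<close>.\<close>
        then have "v * i * v * b * v = v * b * v * i * v" using opp[OF i(1)] i(2) unfolding 2 by blast
        moreover have "v * i * v * b * (v * i * v) = v * i * v * b * v * i * v" by (simp only: mult.assoc)
        moreover have "v * b * v * i * v * i * v = v * b * (v * i * v * i * v)" by (simp only: mult.assoc)
        ultimately show ?thesis using same[OF i i(2)] by simp
      qed
    qed
    then have *: "v * i * v * b * (v * i * v) = 0" for b by (rule split_mult_zero_left)
    have "v * i * v \<in> G (1 + k + 1)" by (intro grade_mult v i)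
    from prime_elements[OF this *] show ?thesis by simp
  qed
  then show ?thesis by (rule semiprime_I[OF v(2)])
qed

text \<open>An isotropic \<open>v\<close> is completed to a hyperbolic pair \<open>v\<close>,
  \<open>u\<close>; the two vectors \<open>v + u\<close> and \<open>v - u\<close> have squares
  \<open>q\<close> and \<open>-q\<close> and anticommute. Supercommuting with both of them is the
  same as supercommuting with \<open>v\<close> and \<open>u\<close>, as 2 is invertible.\<close>

lemma good_of_nilpotent:
  assumes v: "v \<in> V" "v \<in> Od" "v * v = 0" "v \<noteq> 0"
  shows "\<exists>x y. good [x, y]"
proof -
  obtain l where l: "l \<in> Lie 1" "v * l + l * v \<noteq> 0" using V1_nilpotent_bracket[OF v(1-3)] v(4) by blast
  have lO: "l \<in> Od" by (rule Lie_G[OF l(1)])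
  have vv: "v * (v * x) = 0" for x using v(3) by (simp flip: mult.assoc)
  define z where "z = v * l + l * v"
  have z: "z \<in> Z" "z \<noteq> 0" unfolding z_def using V1_Lie1_Z[OF v(1,2) l(1)] l(2) by simp_all
  have vl: "v * l = z - l * v" by (simp add: z_def)
  have vl': "v * (l * x) = z * x - l * (v * x)" for x
    using arg_cong[OF vl, of "\<lambda>t. t * x"] by (simp add: left_diff_distrib mult.assoc)
  have zc: "v * z = z * v" "v * (z * x) = z * (v * x)" "l * z = z * l" "l * (z * x) = z * (l * x)" for x
    using Zcomm[OF z(1), of v] Zcomm[OF z(1), of l] by (simp_all add: Z_comm_left[OF z(1)])
  \<comment> \<open>The square of \<open>l\<close> is not controlled, but
    \<open>v * l * v = z * v\<close> and \<open>v * l * l * v = 0\<close> give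
    \<open>u * u = 0\<close> and \<open>v * u + u * v = z * z\<close>, so \<open>u\<close> is an
    isotropic partner of \<open>v\<close>.\<close>
  define u where "u = l * v * l"
  define q where "q = z * z"
  have q: "q \<in> Z" "q \<noteq> 0" unfolding q_def by (intro Z_mult Z_mult_nonzero z)+
  have uO: "u \<in> Od" unfolding u_def by (intro mult_EO mult_OO lO v)
  have uu: "u * u = 0" by (simp add: u_def algebra_simps vl vl' vv v(3) zc)
  have uu': "u * (u * x) = 0" for x using uu by (simp flip: mult.assoc)
  have vu: "v * u = q - u * v" by (simp add: u_def q_def algebra_simps vl vl' vv v(3) zc)
  have vu': "v * (u * x) = q * x - u * (v * x)" for x
    using arg_cong[OF vu, of "\<lambda>t. t * x"] by (simp add: left_diff_distrib mult.assoc)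
  have qc: "v * (q * x) = q * (v * x)" "u * (q * x) = q * (u * x)" "v * q = q * v" "u * q = q * u" for x
    using Zcomm[OF q(1), of v] Zcomm[OF q(1), of u] by (simp_all add: Z_comm_left[OF q(1)])
  let ?x = "v + u" and ?y = "v - u"
  have "?x \<in> Od" "?y \<in> Od" by (rule add_G[OF v(2) uO], rule diff_G[OF v(2) uO])
  moreover have "?x * ?x = q" "?y * ?y = - q" "?x * ?y = - (?y * ?x)"
    by (simp_all add: algebra_simps v(3) uu vu)
  ultimately have "orthogonal [?x, ?y]" using q by (simp add: Z_uminus)
  moreover have "i * s \<in> Z" if i: "i \<in> I" "i \<in> supercent [?x, ?y]" "i \<in> G k" and s: "s \<in> supercent [?x, ?y]" "s \<in> G k" for i s k
  proof -
    have C: "v * a = parity a * v" "u * a = parity a * u" if "a \<in> supercent [?x, ?y]" for a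
    proof -
      have "?x * a = parity a * ?x" "?y * a = parity a * ?y" using that by (simp_all add: supercent_def)
      then have "v * a + u * a = parity a * v + parity a * u" "v * a - u * a = parity a * v - parity a * u"
        by (simp_all add: distrib_left distrib_right left_diff_distrib right_diff_distrib)
      then have "(v * a + u * a) + (v * a - u * a) = (parity a * v + parity a * u) + (parity a * v - parity a * u)"
        "(v * a + u * a) - (v * a - u * a) = (parity a * v + parity a * u) - (parity a * v - parity a * u)"
        by simp_all
      then have d: "v * a + v * a = parity a * v + parity a * v" "u * a + u * a = parity a * u + parity a * u"
        by simp_all
      show "v * a = parity a * v" by (rule double_cancel[OF d(1)])
      show "u * a = parity a * u" by (rule double_cancel[OF d(2)])
    qed
    \<comment> \<open>Since \<open>u * u = 0\<close>, the second product vanishes and the first is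
      \<open>q * u * i * s\<close> up to sign. The superbracket of \<open>v\<close> with this odd
      bracket is \<open>q^2 * i * s\<close> up to sign, which isolates the single product
      \<open>i * s\<close>.\<close>
    define X where "X = u * v * i * (u * s) - u * s * (u * v * i)"
    have uvi: "u * v * i \<in> I" "u * v * i \<in> G k"
      using i(1) mult_E_G[OF mult_OO[OF uO v(2)] i(3)] by (auto intro: I_left)
    have X: "X \<in> Lie 1"
    proof (cases k rule: bit_cases2)
      case 1
      show ?thesis unfolding X_def using uvi s(2) uO unfolding 1 by (intro Lie_I_01 mult_OE)
    next
      case 2
      show ?thesis unfolding X_def using uvi s(2) uO unfolding 2 by (intro Lie_I_10 mult_OO)
    qed
    have isE: "i * s \<in> Ev" using i(3) s(2) by (cases k rule: bit_cases2) (auto intro: mult_EE mult_OO)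
    have "v * X + X * v \<in> Z" by (rule V1_Lie1_Z[OF v(1,2) X])
    then have "v * X + X * v \<in> Z" "- (v * X + X * v) \<in> Z" by (simp_all only: Z_uminus)
    moreover have "v * X + X * v = q * (q * (i * s)) \<or> v * X + X * v = - (q * (q * (i * s)))"
    proof -
      have comm: "i * (s * v) = v * (i * s)"
        using C(1)[OF supercent_mult[OF i(2) s(1)]] isE by (simp add: mult.assoc)
      have *: "v * Y + Y * v = q * (q * (i * s))" if "Y = q * (u * (i * s))" for Y
        using that by (simp add: mult.assoc qc vu' right_diff_distrib comm)
      consider "u * i = i * u" "u * s = s * u" | "u * i = - (i * u)" "u * s = - (s * u)"
        using C(2)[OF i(2)] C(2)[OF s(1)] i(3) s(2) by (cases k rule: bit_cases2) auto
      then show ?thesis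
      proof cases
        case 1
        have mv: "i * (u * x) = u * (i * x)" "s * (u * x) = u * (s * x)" for x
          using 1 by (simp_all flip: mult.assoc)
        have "X = q * (u * (i * s))"
          by (simp add: X_def mult.assoc mv uu' vu' right_diff_distrib qc uu)
        then show ?thesis using * by blast
      next
        case 2
        have mv: "i * (u * x) = - (u * (i * x))" "s * (u * x) = - (u * (s * x))" for x
          using 2 by (simp_all flip: mult.assoc)
        have "- X = q * (u * (i * s))"
          by (simp add: X_def mult.assoc mv uu' vu' right_diff_distrib qc uu)
        then have "v * (- X) + (- X) * v = q * (q * (i * s))" by (rule *)
        then have "- (q * (q * (i * s))) = - (v * (- X) + (- X) * v)" by simp
        then have "v * X + X * v = - (q * (q * (i * s)))" by simp
        then show ?thesis ..
      qed
    qed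
    ultimately have "q * (q * (i * s)) \<in> Z" by (metis minus_minus)
    then show ?thesis by (rule Z_div[OF q Z_div[OF q]])
  qed
  ultimately have "good [?x, ?y]" unfolding good_def by auto
  then show ?thesis by blast
qed

text \<open>For \<open>v\<close> with nonzero square, a commutator in the supercentralizer of
  \<open>v\<close> between an element of \<open>I\<close> and an element of the other degree gives,
  if nonzero, a second odd element \<open>w\<close> of \<open>V\<close> that anticommutes with
  \<open>v\<close>. If all these commutators vanish, the list \<open>[v]\<close> is already
  good.\<close>

lemma good_exists:
  assumes v: "v \<in> V" "v \<in> Od" "v \<noteq> 0"
  shows "\<exists>es. good es \<and> length es \<in> {1, 2}"
proof (cases "v * v = 0")
  case True
  then obtain x y where "good [x, y]" using good_of_nilpotent[OF v(1,2) _ v(3)] by blast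
  then show ?thesis by (intro exI[of _ "[x, y]"]) simp
next
  case False
  define q where "q = v * v"
  have q: "q \<in> Z" "q \<noteq> 0" using V1_square[OF v(1,2)] False by (simp_all add: q_def)
  have qc: "a * (q * x) = q * (a * x)" for a x by (rule Z_comm_left[OF q(1)])
  have vvx: "v * (v * x) = q * x" for x by (simp add: q_def mult.assoc)
  have C0: "v * a = a * v" if "a \<in> supercent [v]" "a \<in> Ev" for a using that by (simp add: supercent_def)
  have C1: "v * a = - (a * v)" if "a \<in> supercent [v]" "a \<in> Od" for a using that by (simp add: supercent_def)
  have C0': "a * (v * x) = v * (a * x)" if "a \<in> supercent [v]" "a \<in> Ev" for a x using C0[OF that] by (simp flip: mult.assoc)
  have C1': "a * (v * x) = - (v * (a * x))" if "a \<in> supercent [v]" "a \<in> Od" for a x using C1[OF that] by (simp flip: mult.assoc)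
  have twice: "t \<in> Z" if "q * t + q * t \<in> Z" for t
    by (rule Z_div[OF q Z_half[OF that]])
  \<comment> \<open>The factor \<open>v\<close> makes the bracket odd:
    \<open>[i, v s] = v [i, s]\<close>, and its superbracket with \<open>v\<close> is
    \<open>2 q [i, s]\<close>. The odd case \<open>od\<close> uses the same device, where a sign
    turns the commutator into an anticommutator.\<close>
  have ev: "i * s - s * i \<in> Z" if i: "i \<in> I" "i \<in> supercent [v]" "i \<in> Ev" and s: "s \<in> supercent [v]" "s \<in> Ev" for i s
  proof -
    define t where "t = i * s - s * i"
    have "t \<in> supercent [v]" "t \<in> Ev" unfolding t_def using i s by (auto intro: supercent_diff supercent_mult diff_G mult_EE)
    note tv = C0[OF this]
    have l: "i * (v * s) - v * s * i \<in> Lie 1" by (rule Lie_I_01[OF i(1,3) mult_OE[OF v(2) s(2)]])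
    have "i * (v * s) - v * s * i = v * t" by (simp add: t_def right_diff_distrib C0'[OF i(2,3)] mult.assoc)
    moreover have "v * (v * t) + v * t * v = q * t + q * t" by (simp add: vvx mult.assoc flip: tv)
    ultimately have "q * t + q * t \<in> Z" using V1_Lie1_Z[OF v(1,2) l] by simp
    then show ?thesis using twice unfolding t_def by blast
  qed
  have od: "i * s + s * i \<in> Z" if i: "i \<in> I" "i \<in> supercent [v]" "i \<in> Od" and s: "s \<in> supercent [v]" "s \<in> Od" for i s
  proof -
    define t where "t = i * s + s * i"
    have "t \<in> supercent [v]" "t \<in> Ev" unfolding t_def using i s by (auto intro: supercent_add supercent_mult add_G mult_OO)
    note tv = C0[OF this]
    have l: "i * (v * s) - v * s * i \<in> Lie 1" by (rule Lie_I_10[OF i(1,3) mult_OO[OF v(2) s(2)]])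
    have "i * (v * s) - v * s * i = - (v * t)" by (simp add: t_def distrib_left C1'[OF i(2,3)] mult.assoc)
    then have "v * (v * t) + v * t * v = - (v * (i * (v * s) - v * s * i) + (i * (v * s) - v * s * i) * v)" by simp
    moreover have "v * (v * t) + v * t * v = q * t + q * t" by (simp add: vvx mult.assoc flip: tv)
    ultimately have "q * t + q * t \<in> Z" using Z_uminus[OF V1_Lie1_Z[OF v(1,2) l]] by simp
    then show ?thesis using twice unfolding t_def by blast
  qed
  \<comment> \<open>For different degrees \<open>v * t\<close> is, up to sign, an even bracket from
    \<open>[I, A]\<close>. As \<open>t\<close> anticommutes with \<open>v\<close>, the commutator of
    \<open>v\<close> with \<open>v * t\<close> is \<open>2 q t\<close>, which therefore lies in
    \<open>V\<close>.\<close>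
  have mix: "q * t + q * t \<in> V" "t \<in> supercent [v]" "t \<in> Od"
    if t: "t = i * s - s * i" and i: "i \<in> I" "i \<in> supercent [v]" "i \<in> G k" and s: "s \<in> supercent [v]" "s \<in> G (k + 1)" for t i s k
  proof -
    show tC: "t \<in> supercent [v]" unfolding t using i s by (auto intro: supercent_diff supercent_mult)
    show tO: "t \<in> Od" unfolding t using i(3) s(2) by (cases k rule: bit_cases2) (auto intro: diff_G mult_EO mult_OE)
    have "t * v = - (v * t)" using C1[OF tC tO] by simp
    then have e: "v * (v * t) - v * t * v = q * t + q * t" by (simp add: vvx mult.assoc)
    show "q * t + q * t \<in> V"
    proof (cases k rule: bit_cases2)
      case 1
      have "i * (v * s) - v * s * i \<in> Lie 0" using i(3) s(2) 1 by (intro Lie_I_00 mult_OO i(1) v(2)) simp_all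
      moreover have "i * (v * s) - v * s * i = v * t" using C0'[OF i(2)] i(3) 1 by (simp add: t right_diff_distrib mult.assoc)
      ultimately have "v * t \<in> Lie 0" by simp
      then show ?thesis using V_Lie0[OF v(1,2), of "v * t"] e by simp
    next
      case 2
      have "i * (v * s) + v * s * i \<in> Lie 0" using i(3) s(2) 2 by (intro Lie_I_11 mult_OE i(1) v(2)) simp_all
      moreover have "i * (v * s) + v * s * i = - (v * t)" using C1'[OF i(2)] i(3) 2 by (simp add: t right_diff_distrib mult.assoc)
      ultimately have "- (v * t) \<in> Lie 0" by simp
      then have "v * (- (v * t)) - (- (v * t)) * v \<in> V" by (rule V_Lie0[OF v(1,2)])
      then have "- (q * t + q * t) \<in> V" using e by (simp add: algebra_simps)
      then show ?thesis using V_neg by fastforce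
    qed
  qed
  show ?thesis
  proof (cases "\<exists>k i s. i \<in> I \<and> i \<in> supercent [v] \<and> i \<in> G k \<and> s \<in> supercent [v] \<and> s \<in> G (k + 1) \<and> i * s \<noteq> s * i")
    case True
    then obtain k i s where js: "i \<in> I" "i \<in> supercent [v]" "i \<in> G k" "s \<in> supercent [v]" "s \<in> G (k + 1)" "i * s \<noteq> s * i" by blast
    define t where "t = i * s - s * i"
    note tt = mix[OF t_def js(1-5)]
    define w where "w = q * t + q * t"
    have w: "w \<in> V" "w \<in> Od" "w \<noteq> 0" "w \<in> supercent [v]"
    proof -
      show "w \<in> V" unfolding w_def by (rule tt)
      show "w \<in> Od" unfolding w_def using mult_EO[OF ZE[OF q(1)] tt(3)] by (intro add_G)
      show "w \<in> supercent [v]" unfolding w_def by (intro supercent_add supercent_Z_mult q tt)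
      have "t \<noteq> 0" using js(6) by (simp add: t_def)
      then show "w \<noteq> 0" unfolding w_def by (intro double_nonzero Z_mult_nonzero q)
    qed
    show ?thesis
    proof (cases "w * w = 0")
      case True
      then obtain x y where "good [x, y]" using good_of_nilpotent[OF w(1,2) _ w(3)] by blast
      then show ?thesis by (intro exI[of _ "[x, y]"]) simp
    next
      case False
      define r where "r = w * w"
      have r: "r \<in> Z" "r \<noteq> 0" using V1_square[OF w(1,2)] False by (simp_all add: r_def)
      have wwx: "w * (w * x) = r * x" for x by (simp add: r_def mult.assoc)
      have vw: "v * w = - (w * v)" by (rule C1[OF w(4,2)])
      have vw': "v * (w * x) = - (w * (v * x))" for x using arg_cong[OF vw, of "\<lambda>t. t * x"] by (simp add: mult.assoc)
      have o: "orthogonal [v, w]" using v(2) w(2) q r vw by (simp add: q_def r_def)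
      have "i * s \<in> Z" if i: "i \<in> I" "i \<in> supercent [v, w]" "i \<in> G k" and s: "s \<in> supercent [v, w]" "s \<in> G k" for i s k
      proof -
        have C: "a \<in> supercent [v]" "a \<in> Ev \<Longrightarrow> w * a = a * w" "a \<in> Od \<Longrightarrow> w * a = - (a * w)" if "a \<in> supercent [v, w]" for a
          using that by (simp_all add: supercent_def)
        \<comment> \<open>Moving the generators to the left turns \<open>X\<close> into
          \<open>-q w (i s + s i)\<close> for even and \<open>q w (i s - s i)\<close> for odd
          \<open>i\<close>, \<open>s\<close>. The superbracket with \<open>w\<close> shows that this
          symmetric or skew combination is central; \<open>ev\<close> and \<open>od\<close> supply
          the complementary one, and their sum is \<open>2 i s\<close>.\<close>
        define X where "X = v * w * i * (v * s) - v * s * (v * w * i)"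
        have vwi: "v * w * i \<in> I" "v * w * i \<in> G k"
          using i(1) mult_E_G[OF mult_OO[OF v(2) w(2)] i(3)] by (auto intro: I_left)
        have fin: "t \<in> Z" if "t \<in> supercent [v, w]" "t \<in> Ev" "X = q * (w * t) \<or> X = - (q * (w * t))" "X \<in> Lie 1" for t
        proof -
          have wt: "w * t = t * w" using C[OF that(1)] that(2) by blast
          have e: "w * (q * (w * t)) + q * (w * t) * w = q * (r * t + r * t)"
            by (simp add: qc wwx mult.assoc distrib_left flip: wt)
          have "w * X + X * w \<in> Z" by (rule V1_Lie1_Z[OF w(1,2) that(4)])
          then have "w * X + X * w \<in> Z" "- (w * X + X * w) \<in> Z" by (simp_all only: Z_uminus)
          then have "w * (q * (w * t)) + q * (w * t) * w \<in> Z" using that(3) by auto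
          then have "q * (r * t + r * t) \<in> Z" unfolding e .
          then have "r * t + r * t \<in> Z" by (rule Z_div[OF q])
          then have "r * t \<in> Z" by (rule Z_half)
          then show ?thesis by (rule Z_div[OF r])
        qed
        have "i * s + i * s \<in> Z"
        proof (cases k rule: bit_cases2)
          case 1
          note i0 = i(3)[unfolded 1] and s0 = s(2)[unfolded 1]
          have "i * s + s * i \<in> Z"
          proof (rule fin)
            show "i * s + s * i \<in> supercent [v, w]" using i s by (intro supercent_add supercent_mult)
            show "i * s + s * i \<in> Ev" using i0 s0 by (intro add_G mult_EE)
            show "X \<in> Lie 1" unfolding X_def using vwi s0 v(2) unfolding 1 by (intro Lie_I_01 mult_OE)
            have sw: "s * (w * x) = w * (s * x)" for x using C(2)[OF s(1) s0] by (simp flip: mult.assoc)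
            have "X = - (q * (w * (i * s + s * i)))"
              by (simp add: X_def mult.assoc C0'[OF C(1)[OF i(2)] i0] C0'[OF C(1)[OF s(1)] s0] sw vw' vvx qc distrib_left)
            then show "X = q * (w * (i * s + s * i)) \<or> X = - (q * (w * (i * s + s * i)))" ..
          qed
          moreover have "i * s - s * i \<in> Z" by (rule ev[OF i(1) C(1)[OF i(2)] i0 C(1)[OF s(1)] s0])
          ultimately have "(i * s + s * i) + (i * s - s * i) \<in> Z" by (rule Z_add)
          then show ?thesis by simp
        next
          case 2
          note i0 = i(3)[unfolded 2] and s0 = s(2)[unfolded 2]
          have "i * s - s * i \<in> Z"
          proof (rule fin)
            show "i * s - s * i \<in> supercent [v, w]" using i s by (intro supercent_diff supercent_mult)
            show "i * s - s * i \<in> Ev" using i0 s0 by (intro diff_G mult_OO)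
            show "X \<in> Lie 1" unfolding X_def using vwi s0 v(2) unfolding 2 by (intro Lie_I_10 mult_OO)
            have sw: "s * (w * x) = - (w * (s * x))" for x using C(3)[OF s(1) s0] by (simp flip: mult.assoc)
            have "X = q * (w * (i * s - s * i))"
              by (simp add: X_def mult.assoc C1'[OF C(1)[OF i(2)] i0] C1'[OF C(1)[OF s(1)] s0] sw vw' vvx qc right_diff_distrib)
            then show "X = q * (w * (i * s - s * i)) \<or> X = - (q * (w * (i * s - s * i)))" ..
          qed
          moreover have "i * s + s * i \<in> Z" by (rule od[OF i(1) C(1)[OF i(2)] i0 C(1)[OF s(1)] s0])
          ultimately have "(i * s - s * i) + (i * s + s * i) \<in> Z" by (rule Z_add)
          then show ?thesis by simp
        qed
        then show ?thesis by (rule Z_half)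
      qed
      then have "good [v, w]" using o by (auto simp: good_def)
      then show ?thesis by (intro exI[of _ "[v, w]"]) simp
    qed
  next
    case False
    then have cm: "i * s = s * i" if "i \<in> I" "i \<in> supercent [v]" "i \<in> G k" "s \<in> supercent [v]" "s \<in> G (k + 1)" for i s k
      using that by blast
    \<comment> \<open>Replacing \<open>s\<close> by \<open>i * s\<close> multiplies the central
      commutator \<open>t\<close> by \<open>i\<close>; so \<open>i * t\<close> is central, and a
      nonzero \<open>t\<close> would make \<open>i\<close> central.\<close>
    have ee: "i * s = s * i" if i: "i \<in> I" "i \<in> supercent [v]" "i \<in> Ev" and s: "s \<in> supercent [v]" "s \<in> Ev" for i s
    proof (rule ccontr)
      assume n: "i * s \<noteq> s * i"
      define t where "t = i * s - s * i"
      have t: "t \<in> Z" "t \<noteq> 0" using ev[OF i s] n by (simp_all add: t_def)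
      have "i * (i * s) - i * s * i \<in> Z" by (rule ev[OF i supercent_mult[OF i(2) s(1)] mult_EE[OF i(3) s(2)]])
      then have "i * t \<in> Z" by (simp add: t_def right_diff_distrib mult.assoc)
      then have "t * i \<in> Z" by (simp only: Zcomm[OF t(1)])
      then have "i \<in> Z" by (rule Z_div[OF t])
      then show False using n Zcomm by blast
    qed
    \<comment> \<open>By \<open>decompose\<close>, \<open>2 q a\<close> is built from
      \<open>v\<close> and elements of its supercentralizer, with all of which \<open>i\<close>
      commutes.\<close>
    have iZ: "i \<in> Z" if i: "i \<in> I" "i \<in> supercent [v]" "i \<in> Ev" for i
    proof (rule ZI[OF i(3)])
      fix a
      have Od: "set [v] \<subseteq> Od" using v(2) by simp
      have C: "i * c = c * i" if c: "c \<in> supercent [v]" for c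
      proof -
        have "i * (hpart G 0 c + hpart G 1 c) = (hpart G 0 c + hpart G 1 c) * i"
          using ee[OF i supercent_hpart[OF Od c] hpart_G] cm[OF i supercent_hpart[OF Od c], of 1] by (simp add: distrib_left distrib_right)
        then show ?thesis by (simp add: hpart_sum)
      qed
      note d = decompose[OF v(2) q(1)[unfolded q_def], of a]
      have iv: "i * (v * x) = v * (i * x)" for x by (rule C0'[OF i(2,3)])
      have "i * (v * v * a + v * v * a) = (v * v * a + v * v * a) * i"
        unfolding d(1) using C[OF d(2)] C[OF d(3)] by (simp add: distrib_left distrib_right mult.assoc iv)
      then have "q * (i * a - a * i) + q * (i * a - a * i) = 0"
        by (simp add: algebra_simps q_def iv)
      then have "q * (i * a - a * i) = 0" by (rule double_zero)
      then show "i * a = a * i" using Z_regular[OF q(1), of "i * a - a * i"] q(2) by simp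
    qed
    have "i * s \<in> Z" if "i \<in> I" "i \<in> supercent [v]" "i \<in> G k" "s \<in> supercent [v]" "s \<in> G k" for i s k
    proof (rule iZ)
      show "i * s \<in> I" using that(1) by (rule I_right)
      show "i * s \<in> supercent [v]" using that by (intro supercent_mult)
      show "i * s \<in> Ev" using that by (cases k rule: bit_cases2) (auto intro: mult_EE mult_OO)
    qed
    moreover have "orthogonal [v]" using v(2) q by (simp add: q_def)
    ultimately have "good [v]" by (auto simp: good_def)
    then show ?thesis by (intro exI[of _ "[v]"]) simp
  qed
qed

theorem spanning_exists:
  assumes "\<not> V \<subseteq> Z"
  shows "\<exists>es. spanning es \<and> length es \<in> {1, 2, 3}"
proof -
  obtain x where x: "x \<in> V" "x \<notin> Z" using assms by blast
  have "hpart G 0 x \<in> Z" by (rule V0_central[OF V_hpart[OF x(1)] hpart_G])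
  then have "hpart G 1 x \<noteq> 0" using x(2) hpart_sum[of x] by auto
  then obtain es where es: "good es" "length es \<in> {1, 2}"
    using good_exists[OF V_hpart[OF x(1)] hpart_G] by blast
  then consider "spanning es" | c where "spanning (es @ [c])" using good_spanning by blast
  then show ?thesis
  proof cases
    case 1 then show ?thesis using es by (intro exI[of _ es]) auto
  next
    case 2 then show ?thesis using es by (intro exI[of _ "es @ [c]"]) auto
  qed
qed

end

section \<open>Ideals inside Lie ideals\<close>

context half_prime_superalgebra begin

lemma hbracket_add_left: "hbracket i j (x + y) a = hbracket i j x a + hbracket i j y a"
  and hbracket_zero_left: "hbracket i j 0 (a::'a) = 0"
  and hbracket_minus_left: "hbracket i j (- x) a = - hbracket i j x a"
  and hbracket_scale_left: "hbracket i j (scale c z) b = scale c (hbracket i j z b)"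
  by (simp_all add: hbracket_def algebra_simps scale_mult_left scale_mult_right scale_right_diff_distrib scale_right_distrib)

lemma span_bracket:
  assumes "superbracket_span scale G M N \<subseteq> P" "m \<in> M" "m \<in> G i" "n \<in> N" "n \<in> G j"
  shows "hbracket i j m n \<in> P"
proof -
  have "superbracket G m n \<in> span {superbracket G m n | m n. m \<in> M \<and> n \<in> N}"
    using assms by (intro span_base) blast
  then show ?thesis using assms(1) superbracket_homog[OF assms(3,5)] unfolding superbracket_span_def by auto
qed

text \<open>Cyclic form of the Leibniz rule, with \<open>s\<close> moved behind \<open>a\<close> in
  the second term. Only closure under addition and subtraction matters later, so the sign, which
  depends on the degrees, is left open.\<close>

lemma hbracket_mult_left:
  "hbracket (i + j) k (s * t) (a::'a) = hbracket i (j + k) s (t * a) + hbracket j (k + i) t (a * s) \<or>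
   hbracket (i + j) k (s * t) a = hbracket i (j + k) s (t * a) - hbracket j (k + i) t (a * s)"
  by (cases i rule: bit_cases2; cases j rule: bit_cases2; cases k rule: bit_cases2)
    (simp_all add: hbracket_def algebra_simps)

lemma hbracket_mult_right:
  "hbracket i (j + k) x (y * (a::'a)) = hbracket i j x y * a + y * hbracket i k x a \<or>
   hbracket i (j + k) x (y * a) = hbracket i j x y * a - y * hbracket i k x a"
  by (cases i rule: bit_cases2; cases j rule: bit_cases2; cases k rule: bit_cases2)
    (simp_all add: hbracket_def algebra_simps)

lemma hbracket_swap: "b * d = d * b + - hbracket i j d (b::'a) \<or> b * d = hbracket i j d b + - (d * b)"
  by (simp add: hbracket_def)

text \<open>Herstein's construction: \<open>{t. [t, A] \<subseteq> L}\<close> is closed under multiplication,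
  hence contains the ideal generated by any bracket of two elements of \<open>L\<close>.\<close>

lemma lie_ideal_contains:
  assumes L: "lie_ideal scale G L" and x: "x \<in> L" "x \<in> G i" and y: "y \<in> L" "y \<in> G j"
    and c: "hbracket i j x y \<noteq> 0"
  shows "\<exists>J. graded_ideal scale G J \<and> J \<noteq> {0} \<and>
    (\<forall>t k a j. t \<in> J \<longrightarrow> t \<in> G k \<longrightarrow> a \<in> G j \<longrightarrow> hbracket k j t a \<in> L)"
proof -
  have Ls: "graded_submodule scale G L" and LU: "superbracket_span scale G L UNIV \<subseteq> L"
    using L by (simp_all add: lie_ideal_def)
  note L_add = gsub_add[OF Ls] and L_diff = gsub_diff[OF Ls] and L_neg = gsub_neg[OF Ls]
    and L_0 = gsub_0[OF Ls] and L_scale = gsub_scale[OF Ls]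
  have LB: "hbracket m n t a \<in> L" if "t \<in> L" "t \<in> G m" "a \<in> G n" for t m a n
    using span_bracket[OF LU that(1,2) UNIV_I that(3)] .
  \<comment> \<open>Testing the homogeneous components instead of the element itself makes
    \<open>N\<close> graded by construction.\<close>
  define N where "N = {t. \<forall>k j. \<forall>a\<in>G j. hbracket k j (hpart G k t) a \<in> L}"
  have N_add: "s + t \<in> N" if "s \<in> N" "t \<in> N" for s t
    using that by (auto simp: N_def hpart_add hbracket_add_left intro: L_add)
  have N_scale: "scale r t \<in> N" if "t \<in> N" for r t
    using that by (auto simp: N_def hpart_scale hbracket_scale_left intro: L_scale)
  have N_neg: "- t \<in> N" if "t \<in> N" for t using N_scale[OF that, of "- 1"] by simp
  have N_0: "0 \<in> N" by (simp add: N_def hbracket_zero_left L_0)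
  have N_homog: "t \<in> N \<longleftrightarrow> (\<forall>n. \<forall>a\<in>G n. hbracket k n t a \<in> L)" if t: "t \<in> G k" for t k
  proof
    show "\<forall>n. \<forall>a\<in>G n. hbracket k n t a \<in> L" if "t \<in> N"
    proof (intro allI ballI)
      fix n a assume "a \<in> G n"
      then have "hbracket k n (hpart G k t) a \<in> L" using that unfolding N_def by blast
      then show "hbracket k n t a \<in> L" by (simp only: hpart_same[OF t])
    qed
    assume *: "\<forall>n. \<forall>a\<in>G n. hbracket k n t a \<in> L"
    have "hbracket m n (hpart G m t) a \<in> L" if "a \<in> G n" for m n a
    proof (cases "m = k")
      case True
      then show ?thesis using * that hpart_same[OF t] by simp
    next
      case False
      then have "m + 1 = k" by (cases m rule: bit_cases2; cases k rule: bit_cases2) auto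
      then have "hpart G m t = 0" using hpart_other t by blast
      then show ?thesis by (simp add: hbracket_zero_left L_0)
    qed
    then show "t \<in> N" by (simp add: N_def)
  qed
  have N_hpart: "hpart G m t \<in> N" if "t \<in> N" for m t
    using that unfolding N_homog[OF hpart_G] by (simp add: N_def)
  have NL: "t \<in> N" if "t \<in> L" "t \<in> G m" for t m
    unfolding N_homog[OF that(2)] using LB that by blast
  have N_mult: "s * t \<in> N" if s: "s \<in> N" "s \<in> G m" and t: "t \<in> N" "t \<in> G n" for s t m n
    unfolding N_homog[OF grade_mult[OF s(2) t(2)]]
  proof (intro allI ballI)
    fix k a assume a: "a \<in> G k"
    have "hbracket m (n + k) s (t * a) \<in> L" "hbracket n (k + m) t (a * s) \<in> L"
      using s(1)[unfolded N_homog[OF s(2)]] t(1)[unfolded N_homog[OF t(2)]]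
        grade_mult[OF t(2) a] grade_mult[OF a s(2)] by blast+
    then show "hbracket (m + n) k (s * t) a \<in> L"
      using hbracket_mult_left[of m n k s t a] L_add L_diff by fastforce
  qed
  let ?c = "hbracket i j x y"
  have cG: "?c \<in> G (i + j)" by (rule hbracket_G[OF x(2) y(2)])
  have cN: "?c \<in> N" by (rule NL[OF LB[OF x y(2)] cG])
  have N_split: "h b \<in> N" if "\<And>m b. b \<in> G m \<Longrightarrow> h b \<in> N" "\<And>u v. h (u + v) = h u + h v" for h b
    using N_add[OF that(1)[OF hpart_G[of 0 b]] that(1)[OF hpart_G[of 1 b]]] that(2)[of "hpart G 0 b" "hpart G 1 b"]
    by (simp add: hpart_sum)
  \<comment> \<open>The Leibniz rule expresses \<open>[x, y] a\<close> through
    \<open>[x, y a]\<close> and \<open>y [x, a]\<close>. Brackets with \<open>x\<close> lie in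
    \<open>L\<close>, which is contained in \<open>N\<close>, and \<open>N\<close> is closed under
    products.\<close>
  have ca': "?c * a \<in> N" if a: "a \<in> G k" for a k
  proof -
    have 1: "hbracket i (j + k) x (y * a) \<in> N"
      using NL[OF LB[OF x grade_mult[OF y(2) a]] hbracket_G[OF x(2) grade_mult[OF y(2) a]]] .
    have 2: "y * hbracket i k x a \<in> N"
      by (rule N_mult[OF NL[OF y] y(2) NL[OF LB[OF x a] hbracket_G[OF x(2) a]] hbracket_G[OF x(2) a]])
    have "?c * a = hbracket i (j + k) x (y * a) + - (y * hbracket i k x a) \<or>
      ?c * a = hbracket i (j + k) x (y * a) + y * hbracket i k x a"
      using hbracket_mult_right[of i j k x y a] by auto
    then show ?thesis using N_add[OF 1 2] N_add[OF 1 N_neg[OF 2]] by auto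
  qed
  have ca: "?c * a \<in> N" for a by (rule N_split[of "\<lambda>a. ?c * a"]) (simp_all add: ca' distrib_left)
  \<comment> \<open>Up to sign \<open>b * d\<close> differs from \<open>d * b\<close> by the bracket
    of \<open>d\<close> with \<open>b\<close>, which lies in \<open>L\<close> and hence in
    \<open>N\<close>. So right multiples yield left multiples.\<close>
  have left: "b * d \<in> N" if d: "d \<in> N" "d \<in> G n" and db: "d * b \<in> N" and b: "b \<in> G m" for b d m n
  proof -
    have 1: "hbracket n m d b \<in> N"
      using NL[OF _ hbracket_G[OF d(2) b]] d(1)[unfolded N_homog[OF d(2)]] b by blast
    show ?thesis using hbracket_swap[of b d n m] N_add[OF db N_neg[OF 1]] N_add[OF 1 N_neg[OF db]] by auto
  qed
  have bc: "b * ?c \<in> N" for b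
    by (rule N_split[of "\<lambda>b. b * ?c"]) (simp_all add: left[OF cN cG ca] distrib_right)
  have bca: "b * ?c * a \<in> N" for a b
  proof (rule N_split[of "\<lambda>a. b * ?c * a"])
    fix m a assume a: "a \<in> G m"
    show "b * ?c * a \<in> N"
    proof (rule N_split[of "\<lambda>b. b * ?c * a"])
      fix n b assume b: "b \<in> G n"
      have "?c * a * b \<in> N" using ca[of "a * b"] by (simp add: mult.assoc)
      from left[OF ca grade_mult[OF cG a] this b] show "b * ?c * a \<in> N" by (simp add: mult.assoc)
    qed (simp add: distrib_right)
  qed (simp add: distrib_left)
  \<comment> \<open>The largest two-sided ideal inside \<open>N\<close>; without a unit, the four
    kinds of multiples have to be listed separately.\<close>
  define J where "J = {t \<in> N. (\<forall>b. b * t \<in> N) \<and> (\<forall>a. t * a \<in> N) \<and> (\<forall>b a. b * t * a \<in> N)}"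
  show ?thesis
  proof (intro exI[of _ J] conjI allI impI)
    show "graded_ideal scale G J"
    proof (rule graded_idealI)
      show "0 \<in> J" by (simp add: J_def N_0)
      show "s + t \<in> J" if "s \<in> J" "t \<in> J" for s t
        using that by (simp add: J_def N_add distrib_left distrib_right)
      show "scale r t \<in> J" if "t \<in> J" for r t
        using that by (simp add: J_def N_scale scale_mult_left scale_mult_right)
      show "a * t \<in> J" "t * a \<in> J" if "t \<in> J" for a t
      proof -
        have t: "t \<in> N" "b * t \<in> N" "t * b \<in> N" "b * t * d \<in> N" for b d using that by (auto simp: J_def)
        show "a * t \<in> J" unfolding J_def using t(2)[of "_ * a"] t(4)[of "_ * a"] t(2,4) by (simp add: mult.assoc)
        show "t * a \<in> J" unfolding J_def using t(3)[of "a * _"] t(4)[of _ "a * _"] t(3,4) by (simp add: mult.assoc)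
      qed
      show "hpart G m t \<in> J" if "t \<in> J" for m t
      proof -
        have t: "t \<in> N" "b * t \<in> N" "t * b \<in> N" "b * t * d \<in> N" for b d using that by (auto simp: J_def)
        have h1: "b * hpart G m t \<in> N" for b
        proof (rule N_split[of "\<lambda>b. b * hpart G m t"])
          fix n b assume "b \<in> G n"
          then show "b * hpart G m t \<in> N" using N_hpart[OF t(2)] hpart_mult_left by metis
        qed (simp add: distrib_right)
        have h2: "hpart G m t * a \<in> N" for a
        proof (rule N_split[of "\<lambda>a. hpart G m t * a"])
          fix n a assume "a \<in> G n"
          then show "hpart G m t * a \<in> N" using N_hpart[OF t(3)] hpart_mult_right by metis
        qed (simp add: distrib_left)
        have h3: "b * hpart G m t * a \<in> N" for b a
        proof (rule N_split[of "\<lambda>b. b * hpart G m t * a"])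
          fix n b assume b: "b \<in> G n"
          show "b * hpart G m t * a \<in> N"
          proof (rule N_split[of "\<lambda>a. b * hpart G m t * a"])
            fix k a assume "a \<in> G k"
            then show "b * hpart G m t * a \<in> N" using N_hpart[OF t(4)] hpart_mult_right hpart_mult_left[OF b] by metis
          qed (simp add: distrib_left)
        qed (simp add: distrib_right)
        show ?thesis unfolding J_def using N_hpart[OF t(1)] h1 h2 h3 by simp
      qed
    qed
    have "?c \<in> J" unfolding J_def using cN ca bc bca by blast
    then show "J \<noteq> {0}" using c by blast
    show "hbracket k n t a \<in> L" if "t \<in> J" "t \<in> G k" "a \<in> G n" for t k a n
      using that N_homog[OF that(2)] by (simp add: J_def)
  qed
qed

theorem lie_ideal_alternatives:
  assumes L: "lie_ideal scale G L" and V: "graded_submodule scale G V"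
    and VL: "superbracket_span scale G V L \<subseteq> V" and VV: "superbracket_span scale G V V \<subseteq> Z"
  shows "L \<subseteq> Z \<or> V \<subseteq> Z \<or> (\<exists>es. spanning es \<and> length es \<in> {1, 2, 3})"
proof (cases "\<exists>i j x y. x \<in> L \<and> x \<in> G i \<and> y \<in> L \<and> y \<in> G j \<and> hbracket i j x y \<noteq> 0")
  case True
  then obtain i j x y where xy: "x \<in> L" "x \<in> G i" "y \<in> L" "y \<in> G j" "hbracket i j x y \<noteq> 0" by blast
  obtain J where J: "graded_ideal scale G J" "J \<noteq> {0}"
    "\<And>t k a j. t \<in> J \<Longrightarrow> t \<in> G k \<Longrightarrow> a \<in> G j \<Longrightarrow> hbracket k j t a \<in> L"
    using lie_ideal_contains[OF L xy] by metis
  interpret lie_pair scale G J V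
  proof unfold_locales
    show "graded_ideal scale G J" "J \<noteq> {0}" "graded_submodule scale G V" by fact+
    show "hbracket m (k + j) v (hbracket k j i a) \<in> V"
      if "v \<in> V" "v \<in> G m" "i \<in> J" "i \<in> G k" "a \<in> G j" for m k j v i a
      using span_bracket[OF VL that(1,2) J(3)[OF that(3-5)] hbracket_G[OF that(4,5)]] .
    show "hbracket m k v w \<in> Z" if "v \<in> V" "v \<in> G m" "w \<in> V" "w \<in> G k" for m k v w
      using span_bracket[OF VV that] .
  qed
  show ?thesis using spanning_exists by blast
next
  case False
  then have LL: "hbracket i j x y = 0" if "x \<in> L" "x \<in> G i" "y \<in> L" "y \<in> G j" for i j x y using that by blast
  have Ls: "graded_submodule scale G L" and LU: "superbracket_span scale G L UNIV \<subseteq> L"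
    using L by (simp_all add: lie_ideal_def)
  interpret lie_pair scale G UNIV L
  proof unfold_locales
    show "graded_ideal scale G UNIV" by (rule UNIV_ideal)
    show "(UNIV :: 'a set) \<noteq> {0}" using O_nonzero by auto
    show "graded_submodule scale G L" by fact
    show "hbracket m (k + j) v (hbracket k j i a) \<in> L"
      if "v \<in> L" "v \<in> G m" "i \<in> UNIV" "i \<in> G k" "a \<in> G j" for m k j v i a
      using span_bracket[OF LU that(1,2) UNIV_I hbracket_G[OF that(4,5)]] .
    show "hbracket m k v w \<in> Z" if "v \<in> L" "v \<in> G m" "w \<in> L" "w \<in> G k" for m k v w
      using LL[OF that] by simp
  qed
  show ?thesis using spanning_exists by blast
qed

end

section \<open>The free algebra\<close>

locale free_algebra_over = cring K for K :: "('k, 'm) ring_scheme" (structure) +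
  fixes V :: "('k, 'v, 'n) module_scheme"
begin

abbreviation F where "F \<equiv> free_algebra K V"

text \<open>The identities for convolution hold pointwise for arbitrary functions into
  \<open>K\<close>. This condition is preserved by the shift \<open>\<lambda>u. f (a # u)\<close>,
  and inductions over words carry nothing else.\<close>

definition K_valued :: "('v list \<Rightarrow> 'k) \<Rightarrow> bool" where "K_valued f \<longleftrightarrow> (\<forall>w. f w \<in> carrier K)"

lemma K_valued_D [simp]: "K_valued f \<Longrightarrow> f w \<in> carrier K" by (simp add: K_valued_def)
lemma K_valued_Cons [simp]: "K_valued f \<Longrightarrow> K_valued (\<lambda>u. f (a # u))" by (simp add: K_valued_def)
lemma K_valued_add [simp]: "K_valued f \<Longrightarrow> K_valued g \<Longrightarrow> K_valued (\<lambda>w. f w \<oplus> g w)" by (simp add: K_valued_def)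
lemma K_valued_smult [simp]: "c \<in> carrier K \<Longrightarrow> K_valued f \<Longrightarrow> K_valued (\<lambda>w. c \<otimes> f w)" by (simp add: K_valued_def)
lemma K_valued_zero [simp]: "K_valued (\<lambda>w. \<zero>)" by (simp add: K_valued_def)

definition conv :: "('v list \<Rightarrow> 'k) \<Rightarrow> ('v list \<Rightarrow> 'k) \<Rightarrow> 'v list \<Rightarrow> 'k" where
  "conv f g w = (\<Oplus>i\<in>{..length w}. f (take i w) \<otimes> g (drop i w))"

lemma conv_Nil [simp]: "K_valued f \<Longrightarrow> K_valued g \<Longrightarrow> conv f g [] = f [] \<otimes> g []"
  by (simp add: conv_def)

text \<open>Separating the cut before the first letter turns the sum over all cuts of a word into a
  recursion, from which distributivity and associativity follow by induction on the word.\<close>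

lemma conv_Cons:
  assumes "K_valued f" "K_valued g"
  shows "conv f g (a # w) = f [] \<otimes> g (a # w) \<oplus> conv (\<lambda>u. f (a # u)) g w"
proof -
  have "(\<Oplus>i\<in>{..Suc (length w)}. f (take i (a # w)) \<otimes> g (drop i (a # w))) =
      (\<Oplus>i\<in>{..length w}. f (take (Suc i) (a # w)) \<otimes> g (drop (Suc i) (a # w))) \<oplus> f (take 0 (a # w)) \<otimes> g (drop 0 (a # w))"
    using assms by (intro add.finprod_Suc2[simplified]) auto
  then show ?thesis using assms by (simp add: conv_def add.m_comm)
qed

lemma conv_closed [simp]: "K_valued f \<Longrightarrow> K_valued g \<Longrightarrow> conv f g w \<in> carrier K"
  by (simp add: conv_def)

lemma K_valued_conv [simp]: "K_valued f \<Longrightarrow> K_valued g \<Longrightarrow> K_valued (conv f g)"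
  by (simp add: K_valued_def)

lemma conv_zero_left [simp]: "K_valued g \<Longrightarrow> conv (\<lambda>w. \<zero>) g w = \<zero>"
  by (simp add: conv_def)

lemma conv_add_left:
  "K_valued f \<Longrightarrow> K_valued f' \<Longrightarrow> K_valued g \<Longrightarrow> conv (\<lambda>w. f w \<oplus> f' w) g w = conv f g w \<oplus> conv f' g w"
  by (induction w arbitrary: f f') (simp_all add: conv_Cons l_distr a_ac)

lemma conv_add_right:
  "K_valued f \<Longrightarrow> K_valued g \<Longrightarrow> K_valued g' \<Longrightarrow> conv f (\<lambda>w. g w \<oplus> g' w) w = conv f g w \<oplus> conv f g' w"
  by (induction w arbitrary: f) (simp_all add: conv_Cons r_distr a_ac)

lemma conv_smult_left:
  "c \<in> carrier K \<Longrightarrow> K_valued f \<Longrightarrow> K_valued g \<Longrightarrow> conv (\<lambda>w. c \<otimes> f w) g w = c \<otimes> conv f g w"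
  by (induction w arbitrary: f) (simp_all add: conv_Cons r_distr m_assoc)

lemma conv_assoc:
  "K_valued f \<Longrightarrow> K_valued g \<Longrightarrow> K_valued h \<Longrightarrow> conv (conv f g) h w = conv f (conv g h) w"
proof (induction w arbitrary: f g)
  case (Cons a w)
  have "(\<lambda>u. conv f g (a # u)) = (\<lambda>u. f [] \<otimes> g (a # u) \<oplus> conv (\<lambda>u. f (a # u)) g u)"
    using Cons.prems by (simp add: conv_Cons)
  then have "conv (\<lambda>u. conv f g (a # u)) h w =
      f [] \<otimes> conv (\<lambda>u. g (a # u)) h w \<oplus> conv (conv (\<lambda>u. f (a # u)) g) h w"
    using Cons.prems by (simp add: conv_add_left conv_smult_left)
  then show ?case using Cons by (simp add: conv_Cons m_assoc r_distr a_assoc)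
qed (simp add: m_assoc)

lemma conv_nonzero:
  "K_valued f \<Longrightarrow> K_valued g \<Longrightarrow> conv f g w \<noteq> \<zero> \<Longrightarrow> \<exists>u v. w = u @ v \<and> f u \<noteq> \<zero> \<and> g v \<noteq> \<zero>"
proof (induction w arbitrary: f)
  case Nil
  then show ?case by (metis append_Nil conv_Nil K_valued_D l_null r_null)
next
  case (Cons a w)
  show ?case
  proof (cases "f [] \<otimes> g (a # w) = \<zero>")
    case True
    then have "conv (\<lambda>u. f (a # u)) g w \<noteq> \<zero>" using Cons.prems by (auto simp: conv_Cons)
    then obtain u v where "w = u @ v" "f (a # u) \<noteq> \<zero>" "g v \<noteq> \<zero>"
      using Cons.IH[of "\<lambda>u. f (a # u)"] Cons.prems by auto
    then show ?thesis by (intro exI[of _ "a # u"] exI[of _ v]) simp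
  next
    case False
    then have "f [] \<noteq> \<zero> \<and> g (a # w) \<noteq> \<zero>" using Cons.prems by auto
    then show ?thesis by (intro exI[of _ "[]"] exI[of _ "a # w"]) simp
  qed
qed

definition delta :: "'k \<Rightarrow> 'v list \<Rightarrow> 'v list \<Rightarrow> 'k" where
  "delta c w = (\<lambda>u. if u = w then c else \<zero>)"

lemma K_valued_delta [simp]: "c \<in> carrier K \<Longrightarrow> K_valued (delta c w)" by (simp add: K_valued_def delta_def)

lemma conv_delta_Nil: "c \<in> carrier K \<Longrightarrow> K_valued f \<Longrightarrow> conv (delta c []) f w = c \<otimes> f w"
  by (cases w) (simp_all add: conv_Cons, simp_all add: delta_def)

lemma conv_one_right: "K_valued f \<Longrightarrow> conv f (delta \<one> []) w = f w"
  by (induction w arbitrary: f) (simp_all add: conv_Cons, simp_all add: delta_def)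

lemma conv_delta:
  "c \<in> carrier K \<Longrightarrow> d \<in> carrier K \<Longrightarrow> conv (delta c u) (delta d w) x = delta (c \<otimes> d) (u @ w) x"
proof (induction u arbitrary: x)
  case Nil
  then show ?case by (simp add: conv_delta_Nil) (simp add: delta_def)
next
  case (Cons b u)
  show ?case
  proof (cases x)
    case Nil
    then show ?thesis using Cons.prems by simp (simp add: delta_def)
  next
    case (Cons a y)
    have "(\<lambda>z. delta c (b # u) (a # z)) = (if a = b then delta c u else (\<lambda>z. \<zero>))"
      by (auto simp: delta_def)
    then show ?thesis using Cons Cons.IH[of y] \<open>c \<in> carrier K\<close> \<open>d \<in> carrier K\<close>
      by (auto simp: conv_Cons) (auto simp: delta_def)
  qed
qed

lemma F_carrier: "f \<in> carrier F \<longleftrightarrow> K_valued f \<and> finite {w. f w \<noteq> \<zero>} \<and> (\<forall>w. f w \<noteq> \<zero> \<longrightarrow> set w \<subseteq> carrier V)"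
  by (simp add: free_algebra_def K_valued_def)

lemma F_ops: "f \<otimes>\<^bsub>F\<^esub> g = conv f g" "\<one>\<^bsub>F\<^esub> = delta \<one> []" "\<zero>\<^bsub>F\<^esub> = (\<lambda>w. \<zero>)"
  "f \<oplus>\<^bsub>F\<^esub> g = (\<lambda>w. f w \<oplus> g w)" "c \<odot>\<^bsub>F\<^esub> f = (\<lambda>w. c \<otimes> f w)"
  by (auto simp: free_algebra_def conv_def delta_def)

lemma F_K_valued: "f \<in> carrier F \<Longrightarrow> K_valued f" by (simp add: F_carrier)

lemma F_restrict:
  assumes "f \<in> carrier F" shows "(\<lambda>w. if P w then f w else \<zero>) \<in> carrier F"
proof -
  have "{w. (if P w then f w else \<zero>) \<noteq> \<zero>} \<subseteq> {w. f w \<noteq> \<zero>}" by auto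
  then show ?thesis using assms by (auto simp: F_carrier K_valued_def intro: finite_subset)
qed

lemma F_add: assumes "f \<in> carrier F" "g \<in> carrier F" shows "(\<lambda>w. f w \<oplus> g w) \<in> carrier F"
proof -
  have "{w. f w \<oplus> g w \<noteq> \<zero>} \<subseteq> {w. f w \<noteq> \<zero>} \<union> {w. g w \<noteq> \<zero>}" by auto
  then have "finite {w. f w \<oplus> g w \<noteq> \<zero>}" using assms by (auto simp: F_carrier intro: finite_subset)
  moreover have "set w \<subseteq> carrier V" if "f w \<oplus> g w \<noteq> \<zero>" for w
  proof -
    have "f w \<noteq> \<zero> \<or> g w \<noteq> \<zero>" using that by auto
    then show ?thesis using assms by (auto simp: F_carrier)
  qed
  ultimately show ?thesis using assms by (auto simp: F_carrier)
qed

lemma F_smult: assumes "c \<in> carrier K" "f \<in> carrier F" shows "(\<lambda>w. c \<otimes> f w) \<in> carrier F"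
proof -
  have "{w. c \<otimes> f w \<noteq> \<zero>} \<subseteq> {w. f w \<noteq> \<zero>}" using assms by auto
  then have "finite {w. c \<otimes> f w \<noteq> \<zero>}" using assms by (auto simp: F_carrier intro: finite_subset)
  moreover have "set w \<subseteq> carrier V" if "c \<otimes> f w \<noteq> \<zero>" for w
  proof -
    have "f w \<noteq> \<zero>" using that assms by auto
    then show ?thesis using assms by (auto simp: F_carrier)
  qed
  ultimately show ?thesis using assms by (auto simp: F_carrier)
qed

lemma F_conv: assumes "f \<in> carrier F" "g \<in> carrier F" shows "conv f g \<in> carrier F"
proof -
  have k: "K_valued f" "K_valued g" using assms F_K_valued by auto
  have "{w. conv f g w \<noteq> \<zero>} \<subseteq> (\<lambda>(u, v). u @ v) ` ({w. f w \<noteq> \<zero>} \<times> {w. g w \<noteq> \<zero>})"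
    using conv_nonzero[OF k] by force
  then have "finite {w. conv f g w \<noteq> \<zero>}" using assms by (auto simp: F_carrier intro: finite_subset)
  moreover have "set w \<subseteq> carrier V" if "conv f g w \<noteq> \<zero>" for w
  proof -
    obtain u v where uv: "w = u @ v" "f u \<noteq> \<zero>" "g v \<noteq> \<zero>" using conv_nonzero[OF k \<open>conv f g w \<noteq> \<zero>\<close>] by blast
    then have "set u \<subseteq> carrier V" "set v \<subseteq> carrier V" using assms unfolding F_carrier by blast+
    then show ?thesis using uv by simp
  qed
  ultimately show ?thesis using k by (auto simp: F_carrier)
qed

lemma F_delta: "c \<in> carrier K \<Longrightarrow> set w \<subseteq> carrier V \<Longrightarrow> delta c w \<in> carrier F"
  unfolding F_carrier delta_def by (auto simp: K_valued_def split: if_splits)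

lemma free_ring: "ring F"
proof (rule ringI)
  show "abelian_group F"
  proof (rule abelian_groupI)
    fix f assume f: "f \<in> carrier F"
    have "(\<lambda>w. (\<ominus> \<one>) \<otimes> f w) \<in> carrier F" using f by (intro F_smult) simp_all
    moreover have "(\<lambda>w. (\<ominus> \<one>) \<otimes> f w) \<oplus>\<^bsub>F\<^esub> f = \<zero>\<^bsub>F\<^esub>"
      using F_K_valued[OF f] by (simp add: F_ops l_minus l_neg)
    ultimately show "\<exists>g\<in>carrier F. g \<oplus>\<^bsub>F\<^esub> f = \<zero>\<^bsub>F\<^esub>" by blast
  next
    show "\<zero>\<^bsub>F\<^esub> \<in> carrier F" by (simp add: F_ops F_carrier)
  qed (auto simp: F_ops F_K_valued a_ac intro: F_add)
  show "monoid F"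
  proof (rule monoidI)
    show "\<one>\<^bsub>F\<^esub> \<in> carrier F" by (simp add: F_ops F_delta)
    show "\<one>\<^bsub>F\<^esub> \<otimes>\<^bsub>F\<^esub> f = f" if "f \<in> carrier F" for f
      using that by (auto simp: F_ops F_K_valued conv_delta_Nil)
  qed (auto simp: F_ops F_K_valued conv_assoc conv_one_right F_conv)
qed (auto simp: F_ops F_K_valued conv_add_left conv_add_right)

lemma F_induct [consumes 1, case_names zero delta add]:
  assumes "f \<in> carrier F"
    and z: "P (\<lambda>w. \<zero>)"
    and d: "\<And>c w. c \<in> carrier K \<Longrightarrow> set w \<subseteq> carrier V \<Longrightarrow> P (delta c w)"
    and a: "\<And>f g. f \<in> carrier F \<Longrightarrow> g \<in> carrier F \<Longrightarrow> P f \<Longrightarrow> P g \<Longrightarrow> P (\<lambda>w. f w \<oplus> g w)"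
  shows "P f"
  using assms(1)
proof (induction "card {w. f w \<noteq> \<zero>}" arbitrary: f)
  case 0
  then have "{w. f w \<noteq> \<zero>} = {}" using F_carrier by auto
  then have "f = (\<lambda>w. \<zero>)" by auto
  then show ?case using z by simp
next
  case (Suc n)
  then have "{w. f w \<noteq> \<zero>} \<noteq> {}" by (metis card.empty nat.distinct(1))
  then obtain w where w: "f w \<noteq> \<zero>" by blast
  let ?g = "\<lambda>u. if u \<noteq> w then f u else \<zero>"
  have g: "?g \<in> carrier F" by (rule F_restrict[OF Suc.prems])
  have fin: "finite {w. f w \<noteq> \<zero>}" using Suc.prems by (simp add: F_carrier)
  have "{u. ?g u \<noteq> \<zero>} = {u. f u \<noteq> \<zero>} - {w}" by auto
  then have "card {u. ?g u \<noteq> \<zero>} = n" using Suc.hyps(2) w fin by simp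
  then have Pg: "P ?g" by (intro Suc.hyps(1)[OF _ g]) simp
  have c: "f w \<in> carrier K" "set w \<subseteq> carrier V" using Suc.prems w by (auto simp: F_carrier)
  have "f = (\<lambda>u. ?g u \<oplus> delta (f w) w u)" using F_K_valued[OF Suc.prems] by (auto simp: delta_def)
  then show ?case using a[OF g F_delta[OF c] Pg d[OF c]] by simp
qed

end

text \<open>Evaluation of the free algebra in \<open>B\<close>. Scalars and elements of
  \<open>B\<close> have one type and \<open>K\<close> is a central subset of \<open>B\<close>, as
  for the central fractions inside the localization; coefficients are therefore multiplied without
  an embedding. The map \<open>pi\<close> is the value of a word.\<close>

locale free_hom = free_algebra_over K V + B: ring B
  for K :: "('k, 'm) ring_scheme" and V :: "('k, 'v, 'n) module_scheme" and B :: "('k, 'b) ring_scheme" +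
  fixes pi :: "'v list \<Rightarrow> 'k"
  assumes K_sub: "carrier K \<subseteq> carrier B" and K_mult: "mult K = mult B" and K_add: "add K = add B"
    and K_one: "\<one>\<^bsub>K\<^esub> = \<one>\<^bsub>B\<^esub>" and K_zero: "\<zero>\<^bsub>K\<^esub> = \<zero>\<^bsub>B\<^esub>"
    and K_central: "\<And>c b. c \<in> carrier K \<Longrightarrow> b \<in> carrier B \<Longrightarrow> c \<otimes>\<^bsub>B\<^esub> b = b \<otimes>\<^bsub>B\<^esub> c"
    and pi_closed: "\<And>w. set w \<subseteq> carrier V \<Longrightarrow> pi w \<in> carrier B"
    and pi_Nil: "pi [] = \<one>\<^bsub>B\<^esub>"
    and pi_append: "\<And>u w. set u \<subseteq> carrier V \<Longrightarrow> set w \<subseteq> carrier V \<Longrightarrow> pi (u @ w) = pi u \<otimes>\<^bsub>B\<^esub> pi w"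
begin

definition Phi :: "('v list \<Rightarrow> 'k) \<Rightarrow> 'k" where
  "Phi f = (\<Oplus>\<^bsub>B\<^esub>w\<in>{w. f w \<noteq> \<zero>\<^bsub>B\<^esub>}. f w \<otimes>\<^bsub>B\<^esub> pi w)"

lemma K_in_B [simp]: "c \<in> carrier K \<Longrightarrow> c \<in> carrier B" using K_sub by blast

lemma F_in_B [simp]: "f \<in> carrier F \<Longrightarrow> f w \<in> carrier B"
  using F_K_valued K_valued_D K_sub by blast

lemma Phi_eq:
  assumes f: "f \<in> carrier F" and S: "finite S" "\<And>w. w \<in> S \<Longrightarrow> set w \<subseteq> carrier V" "{w. f w \<noteq> \<zero>\<^bsub>B\<^esub>} \<subseteq> S"
  shows "Phi f = (\<Oplus>\<^bsub>B\<^esub>w\<in>S. f w \<otimes>\<^bsub>B\<^esub> pi w)"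
  unfolding Phi_def using S f pi_closed by (intro B.add.finprod_mono_neutral_cong_left) auto

lemma supp:
  assumes "f \<in> carrier F" shows "finite {w. f w \<noteq> \<zero>\<^bsub>B\<^esub>}" "f w \<noteq> \<zero>\<^bsub>B\<^esub> \<Longrightarrow> set w \<subseteq> carrier V"
  using assms unfolding F_carrier K_zero by auto

lemma Phi_closed: "f \<in> carrier F \<Longrightarrow> Phi f \<in> carrier B"
  unfolding Phi_def using supp pi_closed by (intro B.finsum_closed) auto

lemma Phi_add:
  assumes "f \<in> carrier F" "g \<in> carrier F" shows "Phi (f \<oplus>\<^bsub>F\<^esub> g) = Phi f \<oplus>\<^bsub>B\<^esub> Phi g"
proof -
  let ?S = "{w. f w \<noteq> \<zero>\<^bsub>B\<^esub>} \<union> {w. g w \<noteq> \<zero>\<^bsub>B\<^esub>}"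
  have S: "finite ?S" "\<And>w. w \<in> ?S \<Longrightarrow> set w \<subseteq> carrier V" using supp assms by auto
  have f: "Phi f = (\<Oplus>\<^bsub>B\<^esub>w\<in>?S. f w \<otimes>\<^bsub>B\<^esub> pi w)" by (rule Phi_eq) (use S assms in auto)
  have g: "Phi g = (\<Oplus>\<^bsub>B\<^esub>w\<in>?S. g w \<otimes>\<^bsub>B\<^esub> pi w)" by (rule Phi_eq) (use S assms in auto)
  have "{w. (f \<oplus>\<^bsub>F\<^esub> g) w \<noteq> \<zero>\<^bsub>B\<^esub>} \<subseteq> ?S" unfolding F_ops K_add by auto
  then have "Phi (f \<oplus>\<^bsub>F\<^esub> g) = (\<Oplus>\<^bsub>B\<^esub>w\<in>?S. (f \<oplus>\<^bsub>F\<^esub> g) w \<otimes>\<^bsub>B\<^esub> pi w)"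
    using S F_add[OF assms] by (intro Phi_eq) (simp_all add: F_ops)
  also have "\<dots> = (\<Oplus>\<^bsub>B\<^esub>w\<in>?S. f w \<otimes>\<^bsub>B\<^esub> pi w \<oplus>\<^bsub>B\<^esub> g w \<otimes>\<^bsub>B\<^esub> pi w)"
    using S(2) assms pi_closed by (intro B.add.finprod_cong') (auto simp: F_ops K_add B.l_distr)
  also have "\<dots> = Phi f \<oplus>\<^bsub>B\<^esub> Phi g"
    unfolding f g using S(2) assms pi_closed by (intro B.finsum_addf) auto
  finally show ?thesis .
qed

lemma Phi_delta:
  assumes "c \<in> carrier K" "set w \<subseteq> carrier V" shows "Phi (delta c w) = c \<otimes>\<^bsub>B\<^esub> pi w"
proof -
  have "Phi (delta c w) = (\<Oplus>\<^bsub>B\<^esub>u\<in>{w}. delta c w u \<otimes>\<^bsub>B\<^esub> pi u)"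
    using assms F_delta by (intro Phi_eq) (auto simp: delta_def K_zero)
  then show ?thesis using assms pi_closed by (simp add: delta_def)
qed

lemma Phi_zero: "Phi (\<lambda>w. \<zero>\<^bsub>K\<^esub>) = \<zero>\<^bsub>B\<^esub>"
  by (simp add: Phi_def K_zero)

lemma Phi_one: "Phi \<one>\<^bsub>F\<^esub> = \<one>\<^bsub>B\<^esub>"
  using Phi_delta[OF one_closed, of "[]"] by (simp add: F_ops pi_Nil K_one)

text \<open>Both sides are additive in each argument, so \<open>F_induct\<close>, used twice,
  reduces the claim to single words; there the coefficient \<open>d\<close> is moved past
  \<open>pi u\<close> by centrality.\<close>

lemma Phi_mult:
  assumes f: "f \<in> carrier F" and g: "g \<in> carrier F" shows "Phi (f \<otimes>\<^bsub>F\<^esub> g) = Phi f \<otimes>\<^bsub>B\<^esub> Phi g"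
proof -
  interpret F: ring F by (rule free_ring)
  have delta: "Phi (delta c u \<otimes>\<^bsub>F\<^esub> g) = Phi (delta c u) \<otimes>\<^bsub>B\<^esub> Phi g"
    if c: "c \<in> carrier K" and u: "set u \<subseteq> carrier V" for c u
    using g
  proof (induction rule: F_induct)
    case zero
    have "delta c u \<otimes>\<^bsub>F\<^esub> \<zero>\<^bsub>F\<^esub> = \<zero>\<^bsub>F\<^esub>" using F_delta[OF c u] by simp
    then show ?case using Phi_closed[OF F_delta[OF c u]] by (simp add: F_ops(3) Phi_zero)
  next
    case (delta d w)
    have pu: "pi u \<in> carrier B" "pi w \<in> carrier B" using u delta pi_closed by auto
    have "delta c u \<otimes>\<^bsub>F\<^esub> delta d w = delta (c \<otimes>\<^bsub>K\<^esub> d) (u @ w)"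
      using c delta by (auto simp: F_ops conv_delta)
    then have "Phi (delta c u \<otimes>\<^bsub>F\<^esub> delta d w) = c \<otimes>\<^bsub>K\<^esub> d \<otimes>\<^bsub>B\<^esub> (pi u \<otimes>\<^bsub>B\<^esub> pi w)"
      using c u delta by (simp add: Phi_delta pi_append)
    also have "\<dots> = c \<otimes>\<^bsub>B\<^esub> (d \<otimes>\<^bsub>B\<^esub> pi u) \<otimes>\<^bsub>B\<^esub> pi w" using c delta pu by (simp add: K_mult B.m_assoc)
    also have "\<dots> = c \<otimes>\<^bsub>B\<^esub> pi u \<otimes>\<^bsub>B\<^esub> (d \<otimes>\<^bsub>B\<^esub> pi w)"
      using c delta pu by (simp add: K_central[OF delta(1) pu(1)] B.m_assoc)
    finally show ?case using c u delta by (simp add: Phi_delta)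
  next
    case (add f g)
    then have "Phi (delta c u \<otimes>\<^bsub>F\<^esub> (f \<oplus>\<^bsub>F\<^esub> g)) = Phi (delta c u) \<otimes>\<^bsub>B\<^esub> Phi (f \<oplus>\<^bsub>F\<^esub> g)"
      using F_delta[OF c u] Phi_closed by (simp add: F.r_distr Phi_add B.r_distr)
    then show ?case by (simp add: F_ops(4))
  qed
  show ?thesis using f
  proof (induction rule: F_induct)
    case zero
    have "\<zero>\<^bsub>F\<^esub> \<otimes>\<^bsub>F\<^esub> g = \<zero>\<^bsub>F\<^esub>" using g by simp
    then show ?case using Phi_closed[OF g] by (simp add: F_ops(3) Phi_zero)
  next
    case (delta c w)
    then show ?case by (rule \<open>\<And>c u. c \<in> carrier K \<Longrightarrow> set u \<subseteq> carrier V \<Longrightarrow> Phi (delta c u \<otimes>\<^bsub>F\<^esub> g) = Phi (delta c u) \<otimes>\<^bsub>B\<^esub> Phi g\<close>)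
  next
    case (add f h)
    then have "Phi ((f \<oplus>\<^bsub>F\<^esub> h) \<otimes>\<^bsub>F\<^esub> g) = Phi (f \<oplus>\<^bsub>F\<^esub> h) \<otimes>\<^bsub>B\<^esub> Phi g"
      using g Phi_closed by (simp add: F.l_distr Phi_add B.l_distr)
    then show ?case by (simp add: F_ops(4))
  qed
qed

lemma Phi_hom: "ring_hom_ring F B Phi"
  by (intro ring_hom_ringI free_ring B.ring_axioms Phi_closed Phi_mult Phi_add Phi_one)

end

section \<open>Ordered products of anticommuting elements\<close>

fun prod_span_in :: "('r, 'z) ring_scheme \<Rightarrow> 'r set \<Rightarrow> 'r list \<Rightarrow> 'r set" where
  "prod_span_in R S [] = S"
| "prod_span_in R S (e # es) = {g \<oplus>\<^bsub>R\<^esub> e \<otimes>\<^bsub>R\<^esub> h | g h. g \<in> prod_span_in R S es \<and> h \<in> prod_span_in R S es}"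

text \<open>Stage by stage uniqueness of the decomposition \<open>g + e h\<close>; this is linear
  independence of the ordered products in the form that matches \<open>prod_span_in\<close>.\<close>

fun prod_indep :: "('r, 'z) ring_scheme \<Rightarrow> 'r set \<Rightarrow> 'r list \<Rightarrow> bool" where
  "prod_indep R S [] = True"
| "prod_indep R S (e # es) \<longleftrightarrow> prod_indep R S es \<and>
    (\<forall>g\<in>prod_span_in R S es. \<forall>h\<in>prod_span_in R S es. g \<oplus>\<^bsub>R\<^esub> e \<otimes>\<^bsub>R\<^esub> h = \<zero>\<^bsub>R\<^esub> \<longrightarrow> g = \<zero>\<^bsub>R\<^esub> \<and> h = \<zero>\<^bsub>R\<^esub>)"

text \<open>Squares are only required to lie in \<open>S\<close>, which suffices to rewrite
  products; the same notion thus serves for the images in the localization and for the generators of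
  the Clifford quotient.\<close>

fun orthogonal_in :: "('r, 'z) ring_scheme \<Rightarrow> 'r set \<Rightarrow> 'r list \<Rightarrow> bool" where
  "orthogonal_in R S [] = True"
| "orthogonal_in R S (e # es) \<longleftrightarrow> e \<in> carrier R \<and> e \<otimes>\<^bsub>R\<^esub> e \<in> S \<and>
    (\<forall>f\<in>set es. f \<otimes>\<^bsub>R\<^esub> e = \<ominus>\<^bsub>R\<^esub> (e \<otimes>\<^bsub>R\<^esub> f)) \<and> orthogonal_in R S es"

locale central_subring = ring R for R (structure) +
  fixes S
  assumes S_sub: "S \<subseteq> carrier R" and S_zero: "\<zero> \<in> S" and S_one: "\<one> \<in> S"
    and S_add: "\<And>a b. a \<in> S \<Longrightarrow> b \<in> S \<Longrightarrow> a \<oplus> b \<in> S"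
    and S_mult: "\<And>a b. a \<in> S \<Longrightarrow> b \<in> S \<Longrightarrow> a \<otimes> b \<in> S"
    and S_neg: "\<And>a. a \<in> S \<Longrightarrow> \<ominus> a \<in> S"
    and S_central: "\<And>a b. a \<in> S \<Longrightarrow> b \<in> carrier R \<Longrightarrow> a \<otimes> b = b \<otimes> a"
begin

lemma S_carrier [simp]: "a \<in> S \<Longrightarrow> a \<in> carrier R" using S_sub by blast

lemma orthogonal_in_carrier: "orthogonal_in R S es \<Longrightarrow> set es \<subseteq> carrier R"
  by (induction es) auto

lemma prod_span_in_carrier: "set es \<subseteq> carrier R \<Longrightarrow> x \<in> prod_span_in R S es \<Longrightarrow> x \<in> carrier R"
  by (induction es arbitrary: x) auto

lemma prod_span_in_zero: "set es \<subseteq> carrier R \<Longrightarrow> \<zero> \<in> prod_span_in R S es"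
  by (induction es) (auto simp: S_zero intro!: exI[of _ \<zero>])

lemma prod_span_in_S: "set es \<subseteq> carrier R \<Longrightarrow> c \<in> S \<Longrightarrow> c \<in> prod_span_in R S es"
proof (induction es)
  case (Cons e es)
  then have "c = c \<oplus> e \<otimes> \<zero>" "c \<in> prod_span_in R S es" "\<zero> \<in> prod_span_in R S es" by (simp_all add: prod_span_in_zero)
  then show ?case by (simp only: prod_span_in.simps) blast
qed simp

lemma prod_span_in_add: "set es \<subseteq> carrier R \<Longrightarrow> x \<in> prod_span_in R S es \<Longrightarrow> y \<in> prod_span_in R S es \<Longrightarrow> x \<oplus> y \<in> prod_span_in R S es"
proof (induction es arbitrary: x y)
  case (Cons e es)
  then obtain g h g' h' where x: "x = g \<oplus> e \<otimes> h" "y = g' \<oplus> e \<otimes> h'"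
    and m: "g \<in> prod_span_in R S es" "h \<in> prod_span_in R S es" "g' \<in> prod_span_in R S es" "h' \<in> prod_span_in R S es" by auto
  have c: "e \<in> carrier R" "g \<in> carrier R" "h \<in> carrier R" "g' \<in> carrier R" "h' \<in> carrier R"
    using m prod_span_in_carrier[of es] Cons.prems(1) by auto
  have "x \<oplus> y = (g \<oplus> g') \<oplus> e \<otimes> (h \<oplus> h')" using c by (simp add: x r_distr a_ac)
  moreover have "g \<oplus> g' \<in> prod_span_in R S es" "h \<oplus> h' \<in> prod_span_in R S es" using Cons.IH m Cons.prems(1) by auto
  ultimately show ?case by auto
qed (simp add: S_add)

lemma prod_span_in_scalar: "set es \<subseteq> carrier R \<Longrightarrow> c \<in> S \<Longrightarrow> x \<in> prod_span_in R S es \<Longrightarrow> c \<otimes> x \<in> prod_span_in R S es"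
proof (induction es arbitrary: x)
  case (Cons e es)
  then obtain g h where x: "x = g \<oplus> e \<otimes> h" and m: "g \<in> prod_span_in R S es" "h \<in> prod_span_in R S es" by auto
  have c: "e \<in> carrier R" "g \<in> carrier R" "h \<in> carrier R" "c \<in> carrier R"
    using m prod_span_in_carrier[of es] Cons.prems by auto
  have "c \<otimes> (e \<otimes> h) = e \<otimes> (c \<otimes> h)"
    using c S_central[OF Cons.prems(2) c(1)] by (simp flip: m_assoc)
  then have "c \<otimes> x = c \<otimes> g \<oplus> e \<otimes> (c \<otimes> h)" using c by (simp add: x r_distr)
  moreover have "c \<otimes> g \<in> prod_span_in R S es" "c \<otimes> h \<in> prod_span_in R S es" using Cons m by auto
  ultimately show ?case by auto
qed (simp add: S_mult)

lemma prod_span_in_neg: "set es \<subseteq> carrier R \<Longrightarrow> x \<in> prod_span_in R S es \<Longrightarrow> \<ominus> x \<in> prod_span_in R S es"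
  using prod_span_in_scalar[of es "\<ominus> \<one>" x] prod_span_in_carrier[of es x] S_neg[OF S_one] by (simp add: l_minus)

text \<open>A generator moves past the preceding ones at the cost of signs until it meets its own
  copy or its place; in the first case the square is absorbed as a scalar.\<close>

lemma prod_span_in_left:
  "orthogonal_in R S es \<Longrightarrow> f \<in> set es \<Longrightarrow> x \<in> prod_span_in R S es \<Longrightarrow> f \<otimes> x \<in> prod_span_in R S es"
proof (induction es arbitrary: x)
  case (Cons e es)
  then obtain g h where x: "x = g \<oplus> e \<otimes> h" and m: "g \<in> prod_span_in R S es" "h \<in> prod_span_in R S es" by auto
  have es: "set es \<subseteq> carrier R" "orthogonal_in R S es" using Cons.prems orthogonal_in_carrier by auto
  have c: "e \<in> carrier R" "g \<in> carrier R" "h \<in> carrier R" "e \<otimes> e \<in> S"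
    using m prod_span_in_carrier[of es] Cons.prems es by auto
  show ?case
  proof (cases "f = e")
    case True
    have "f \<otimes> x = e \<otimes> e \<otimes> h \<oplus> e \<otimes> g" using c by (simp add: x True r_distr m_assoc a_comm)
    then show ?thesis using prod_span_in_scalar[OF es(1) c(4) m(2)] m(1) by auto
  next
    case False
    then have f: "f \<in> set es" "f \<in> carrier R" "f \<otimes> e = \<ominus> (e \<otimes> f)" using Cons.prems es by auto
    have "f \<otimes> (e \<otimes> h) = e \<otimes> (\<ominus> (f \<otimes> h))"
      using c f by (simp add: r_minus l_minus flip: m_assoc)
    then have "f \<otimes> x = f \<otimes> g \<oplus> e \<otimes> (\<ominus> (f \<otimes> h))" using c f by (simp add: x r_distr)
    moreover have "f \<otimes> g \<in> prod_span_in R S es" "\<ominus> (f \<otimes> h) \<in> prod_span_in R S es"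
      using Cons.IH[OF es(2) f(1)] m prod_span_in_neg[OF es(1)] by auto
    ultimately show ?thesis by auto
  qed
qed simp

text \<open>The counter \<open>k\<close> is the coordinate that belongs to the head of the list; it
  lets the coordinate function stay fixed while the list is consumed.\<close>

fun vec_comb :: "'a list \<Rightarrow> nat \<Rightarrow> (nat \<Rightarrow> 'a) \<Rightarrow> 'a" where
  "vec_comb [] k v = \<zero>"
| "vec_comb (e # es) k v = v k \<otimes> e \<oplus> vec_comb es (Suc k) v"

fun bilin :: "'a list \<Rightarrow> nat \<Rightarrow> (nat \<Rightarrow> 'a) \<Rightarrow> (nat \<Rightarrow> 'a) \<Rightarrow> 'a" where
  "bilin [] k u v = \<zero>"
| "bilin (e # es) k u v = u k \<otimes> v k \<otimes> (e \<otimes> e) \<oplus> bilin es (Suc k) u v"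

definition vec :: "(nat \<Rightarrow> 'a) \<Rightarrow> bool" where "vec v \<longleftrightarrow> (\<forall>i. v i \<in> S)"

lemma vec_D [simp]: "vec v \<Longrightarrow> v i \<in> S" by (simp add: vec_def)

lemma vec_comb_closed [simp]: "set es \<subseteq> carrier R \<Longrightarrow> vec v \<Longrightarrow> vec_comb es k v \<in> carrier R"
  by (induction es arbitrary: k) auto

lemma bilin_S [simp]: "orthogonal_in R S es \<Longrightarrow> vec u \<Longrightarrow> vec v \<Longrightarrow> bilin es k u v \<in> S"
  by (induction es arbitrary: k) (auto simp: S_zero S_add S_mult)

lemma vec_comb_add:
  "set es \<subseteq> carrier R \<Longrightarrow> vec u \<Longrightarrow> vec v \<Longrightarrow> vec_comb es k (\<lambda>i. u i \<oplus> v i) = vec_comb es k u \<oplus> vec_comb es k v"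
  by (induction es arbitrary: k) (auto simp: l_distr a_ac)

lemma vec_comb_smult:
  "set es \<subseteq> carrier R \<Longrightarrow> c \<in> S \<Longrightarrow> vec v \<Longrightarrow> vec_comb es k (\<lambda>i. c \<otimes> v i) = c \<otimes> vec_comb es k v"
  by (induction es arbitrary: k) (auto simp: r_distr m_assoc)

lemma bilin_add:
  "orthogonal_in R S es \<Longrightarrow> vec u \<Longrightarrow> vec v \<Longrightarrow> vec w \<Longrightarrow>
    bilin es k (\<lambda>i. u i \<oplus> v i) w = bilin es k u w \<oplus> bilin es k v w"
  by (induction es arbitrary: k) (auto simp: l_distr a_ac)

lemma bilin_smult:
  "orthogonal_in R S es \<Longrightarrow> c \<in> S \<Longrightarrow> vec u \<Longrightarrow> vec w \<Longrightarrow> bilin es k (\<lambda>i. c \<otimes> u i) w = c \<otimes> bilin es k u w"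
  by (induction es arbitrary: k) (auto simp: r_distr m_assoc)

lemma bilin_sym: "vec u \<Longrightarrow> vec v \<Longrightarrow> bilin es k u v = bilin es k v u"
  by (induction es arbitrary: k) (simp_all add: S_central)

lemma vec_add: "vec u \<Longrightarrow> vec v \<Longrightarrow> vec (\<lambda>i. u i \<oplus> v i)" by (simp add: vec_def S_add)
lemma vec_smult: "c \<in> S \<Longrightarrow> vec v \<Longrightarrow> vec (\<lambda>i. c \<otimes> v i)" by (simp add: vec_def S_mult)

lemma vec_comb_skew:
  assumes "set es \<subseteq> carrier R" "vec v" "e \<in> carrier R" "\<forall>f\<in>set es. f \<otimes> e = \<ominus> (e \<otimes> f)"
  shows "vec_comb es k v \<otimes> e = \<ominus> (e \<otimes> vec_comb es k v)"
  using assms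
proof (induction es arbitrary: k)
  case (Cons f es)
  have "v k \<otimes> f \<otimes> e = \<ominus> (e \<otimes> (v k \<otimes> f))"
    using Cons.prems S_central[of "v k" e] by (simp add: m_assoc r_minus) (simp flip: m_assoc)
  then show ?case using Cons by (simp add: l_distr r_distr minus_add a_comm)
qed simp

text \<open>The mixed terms cancel in pairs by anticommutation, leaving the diagonal form with
  entries \<open>e \<otimes> e\<close>. This is the Clifford relation for the form \<open>q\<close>
  below.\<close>

lemma vec_comb_square:
  "orthogonal_in R S es \<Longrightarrow> vec v \<Longrightarrow> vec_comb es k v \<otimes> vec_comb es k v = bilin es k v v"
proof (induction es arbitrary: k)
  case (Cons e es)
  let ?P = "vec_comb es (Suc k) v"
  have es: "set es \<subseteq> carrier R" "orthogonal_in R S es" "e \<in> carrier R" using Cons.prems orthogonal_in_carrier by auto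
  have P: "?P \<in> carrier R" "v k \<in> carrier R" using es Cons.prems by auto
  have skew: "?P \<otimes> e = \<ominus> (e \<otimes> ?P)" using vec_comb_skew[OF es(1) Cons.prems(2) es(3)] Cons.prems(1) by simp
  have vk: "x \<otimes> v k = v k \<otimes> x" if "x \<in> carrier R" for x using S_central[of "v k" x] that Cons.prems by simp
  have 1: "?P \<otimes> (v k \<otimes> e) = \<ominus> (v k \<otimes> e \<otimes> ?P)"
  proof -
    have "?P \<otimes> (v k \<otimes> e) = v k \<otimes> (?P \<otimes> e)" using P es vk[OF P(1)] by (simp flip: m_assoc)
    then show ?thesis using P es by (simp add: skew r_minus m_assoc)
  qed
  have 2: "v k \<otimes> e \<otimes> (v k \<otimes> e) = v k \<otimes> v k \<otimes> (e \<otimes> e)"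
  proof -
    have "v k \<otimes> e \<otimes> (v k \<otimes> e) = v k \<otimes> (e \<otimes> v k) \<otimes> e" using P es by (simp add: m_assoc)
    then show ?thesis using P es by (simp add: vk[OF es(3)] m_assoc)
  qed
  have "(v k \<otimes> e \<oplus> ?P) \<otimes> (v k \<otimes> e \<oplus> ?P) =
      v k \<otimes> e \<otimes> (v k \<otimes> e) \<oplus> (v k \<otimes> e \<otimes> ?P \<oplus> ?P \<otimes> (v k \<otimes> e)) \<oplus> ?P \<otimes> ?P"
    using P es by (simp add: l_distr r_distr a_ac)
  then show ?case using P es Cons.IH[OF es(2) Cons.prems(2)] by (simp add: 1 2 r_neg)
qed simp

definition unit_vec :: "nat \<Rightarrow> nat \<Rightarrow> 'a" where "unit_vec j = (\<lambda>i. if i = j then \<one> else \<zero>)"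

lemma vec_unit [simp]: "vec (unit_vec j)" by (simp add: vec_def unit_vec_def S_one S_zero)

lemma vec_comb_unit:
  "set es \<subseteq> carrier R \<Longrightarrow>
    vec_comb es k (unit_vec j) = (if k \<le> j \<and> j < k + length es then es ! (j - k) else \<zero>)"
proof (induction es arbitrary: k)
  case (Cons e es)
  have "es ! (j - Suc k) \<in> carrier R" if "k < j" "j < Suc (k + length es)"
    using Cons.prems subsetD[OF _ nth_mem[of "j - Suc k" es]] that by auto
  then show ?case using Cons by (auto simp: unit_vec_def nth_Cons' Suc_le_eq)
qed auto

lemma bilin_unit:
  assumes "orthogonal_in R S es" "vec u"
  shows "bilin es k u (unit_vec j) = (if k \<le> j \<and> j < k + length es then u j \<otimes> (es ! (j - k) \<otimes> es ! (j - k)) else \<zero>)"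
  using assms
proof (induction es arbitrary: k)
  case (Cons e es)
  have "es ! (j - Suc k) \<in> carrier R" if "k < j" "j < Suc (k + length es)"
    using Cons.prems orthogonal_in_carrier[of es] subsetD[OF _ nth_mem[of "j - Suc k" es]] that by auto
  then show ?case using Cons by (auto simp: unit_vec_def nth_Cons' Suc_le_eq)
qed auto

end

section \<open>The quadratic space spanned by anticommuting elements\<close>

text \<open>Abstract recognition of a Clifford superalgebra: \<open>B\<close> has the ordered
  products of anticommuting odd elements with nonzero squares in \<open>K\<close> as a basis over
  the central subfield \<open>K\<close>. The condition \<open>two\<close> enters through the polar
  form, whose diagonal entries are twice those squares.\<close>

locale clifford_model = central_subring B "carrier K"
  for K :: "'k ring" and B :: "('k, 'k) superalg" (structure) +
  fixes es :: "'k list"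
  assumes K_field: "field K"
    and K_mult: "mult K = mult B" and K_add: "add K = add B"
    and K_one: "\<one>\<^bsub>K\<^esub> = \<one>" and K_zero: "\<zero>\<^bsub>K\<^esub> = \<zero>"
    and smult_B: "smult B = mult B"
    and two: "\<one> \<oplus> \<one> \<noteq> \<zero>"
    and orthogonal_es: "orthogonal_in B (carrier K) es" and nz_es: "\<And>e. e \<in> set es \<Longrightarrow> e \<otimes> e \<noteq> \<zero>"
    and span_es: "prod_span_in B (carrier K) es = carrier B" and indep_es: "prod_indep B (carrier K) es"
    and gr_sub: "grade B i \<subseteq> carrier B" and gr_disj: "grade B 0 \<inter> grade B 1 = {\<zero>}"
    and gr_add: "\<And>x y. x \<in> grade B i \<Longrightarrow> y \<in> grade B i \<Longrightarrow> x \<oplus> y \<in> grade B i"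
    and gr_neg: "\<And>x. x \<in> grade B i \<Longrightarrow> \<ominus> x \<in> grade B i"
    and gr_mult: "\<And>x y. x \<in> grade B i \<Longrightarrow> y \<in> grade B j \<Longrightarrow> x \<otimes> y \<in> grade B (i + j)"
    and gr_K: "carrier K \<subseteq> grade B 0" and gr_es: "set es \<subseteq> grade B 1"
begin

interpretation K: field K by (rule K_field)

lemmas K_ops = K_mult K_add K_one K_zero

lemma es_carrier: "set es \<subseteq> carrier B" by (rule orthogonal_in_carrier[OF orthogonal_es])

definition V :: "('k, nat \<Rightarrow> 'k) module" where
  "V = \<lparr>carrier = {v. vec v \<and> (\<forall>i\<ge>length es. v i = \<zero>)}, mult = undefined, one = undefined,
     zero = (\<lambda>i. \<zero>), add = (\<lambda>u v i. u i \<oplus> v i), smult = (\<lambda>c v i. c \<otimes> v i)\<rparr>"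

definition q :: "(nat \<Rightarrow> 'k) \<Rightarrow> 'k" where "q v = bilin es 0 v v"

lemma V_carrier: "v \<in> carrier V \<longleftrightarrow> vec v \<and> (\<forall>i\<ge>length es. v i = \<zero>)" by (simp add: V_def)
lemma V_ops: "\<zero>\<^bsub>V\<^esub> = (\<lambda>i. \<zero>)" "u \<oplus>\<^bsub>V\<^esub> v = (\<lambda>i. u i \<oplus> v i)" "c \<odot>\<^bsub>V\<^esub> v = (\<lambda>i. c \<otimes> v i)"
  by (simp_all add: V_def)

lemma V_unit: "j < length es \<Longrightarrow> unit_vec j \<in> carrier V"
  by (auto simp: V_carrier) (simp add: unit_vec_def)

lemma V_vec [simp]: "v \<in> carrier V \<Longrightarrow> vec v" by (simp add: V_carrier)

lemma V_add: "u \<in> carrier V \<Longrightarrow> v \<in> carrier V \<Longrightarrow> (\<lambda>i. u i \<oplus> v i) \<in> carrier V"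
  by (simp add: V_carrier vec_add)
lemma V_smult: "c \<in> carrier K \<Longrightarrow> v \<in> carrier V \<Longrightarrow> (\<lambda>i. c \<otimes> v i) \<in> carrier V"
  by (simp add: V_carrier vec_smult)

lemma V_abelian: "abelian_group V"
proof (rule abelian_groupI)
  show "\<zero>\<^bsub>V\<^esub> \<in> carrier V" by (simp add: V_carrier V_ops vec_def S_zero)
  show "\<exists>u\<in>carrier V. u \<oplus>\<^bsub>V\<^esub> v = \<zero>\<^bsub>V\<^esub>" if v: "v \<in> carrier V" for v
  proof (rule bexI[of _ "\<lambda>i. (\<ominus> \<one>) \<otimes> v i"])
    show "(\<lambda>i. (\<ominus> \<one>) \<otimes> v i) \<in> carrier V" using v by (intro V_smult S_neg S_one)
    show "(\<lambda>i. (\<ominus> \<one>) \<otimes> v i) \<oplus>\<^bsub>V\<^esub> v = \<zero>\<^bsub>V\<^esub>" using v by (simp add: V_ops l_minus l_neg)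
  qed
qed (auto simp: V_ops a_ac intro: V_add)

lemma V_vectorspace: "vectorspace K V"
proof (intro vectorspace.intro K_field moduleI V_abelian)
  show "cring K" by (rule K.is_cring)
qed (auto simp: V_ops K_ops l_distr r_distr m_assoc S_one intro: V_smult)

lemma V_finsum:
  assumes "finite A" "f \<in> A \<rightarrow> carrier V"
  shows "finsum V f A j = finsum K (\<lambda>a. f a j) A"
proof -
  interpret V: abelian_group V by (rule V_abelian)
  show ?thesis using assms
  proof (induction A rule: finite_induct)
    case empty
    then show ?case by (simp add: V_ops K_zero)
  next
    case (insert a A)
    have c: "(\<lambda>a. f a j) \<in> A \<rightarrow> carrier K" "f a j \<in> carrier K"
      using insert.prems by (auto simp: Pi_def)
    have "finsum V f (insert a A) = f a \<oplus>\<^bsub>V\<^esub> finsum V f A" using insert by (intro V.finsum_insert) auto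
    then show ?case using insert c by (simp add: V_ops K_add)
  qed
qed

lemma unit_vec_inj: "unit_vec i = unit_vec j \<Longrightarrow> i = j"
proof -
  assume "unit_vec i = unit_vec j"
  then have "(unit_vec i :: nat \<Rightarrow> 'k) i = unit_vec j i" by simp
  moreover have "\<one> \<noteq> \<zero>" using K.one_not_zero by (simp add: K_ops)
  ultimately show "i = j" by (auto simp: unit_vec_def split: if_splits)
qed

lemma V_lincomb_coord:
  assumes a: "a \<in> unit_vec ` {..<length es} \<rightarrow> carrier K" and j: "j < length es"
  shows "module.lincomb V a (unit_vec ` {..<length es}) j = a (unit_vec j)"
proof -
  interpret V: vectorspace K V by (rule V_vectorspace)
  let ?A = "unit_vec ` {..<length es} :: (nat \<Rightarrow> 'k) set"
  have "V.lincomb a ?A j = finsum K (\<lambda>v. (a v \<odot>\<^bsub>V\<^esub> v) j) ?A"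
    unfolding V.lincomb_def using a V_unit by (intro V_finsum) (auto intro!: V.smult_closed)
  also have "\<dots> = finsum K (\<lambda>v. if unit_vec j = v then a v else \<zero>\<^bsub>K\<^esub>) ?A"
  proof (intro K.add.finprod_cong' refl)
    show "(\<lambda>v. if unit_vec j = v then a v else \<zero>\<^bsub>K\<^esub>) \<in> ?A \<rightarrow> carrier K" using a by auto
    fix v assume v: "v \<in> ?A"
    then obtain i where i: "v = unit_vec i" "i < length es" by auto
    have av: "a v \<in> carrier K" using a v by auto
    show "(a v \<odot>\<^bsub>V\<^esub> v) j = (if unit_vec j = v then a v else \<zero>\<^bsub>K\<^esub>)"
    proof (cases "i = j")
      case True
      then show ?thesis using i av by (simp add: V_ops) (simp add: unit_vec_def)
    next
      case False
      then have "unit_vec j \<noteq> v" using i unit_vec_inj by blast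
      then show ?thesis using False i av by (simp add: V_ops K_zero) (simp add: unit_vec_def)
    qed
  qed
  also have "\<dots> = a (unit_vec j)"
    using a j by (intro K.add.finprod_singleton[simplified]) auto
  finally show ?thesis .
qed

lemma V_dim: "vectorspace.fin_dim K V \<and> vectorspace.dim K V = length es"
proof -
  interpret V: vectorspace K V by (rule V_vectorspace)
  let ?A = "unit_vec ` {..<length es} :: (nat \<Rightarrow> 'k) set"
  have fin: "finite ?A" and sub: "?A \<subseteq> carrier V" using V_unit by auto
  have card: "card ?A = length es" using unit_vec_inj by (simp add: card_image inj_on_def)
  have "v \<in> V.span ?A" if v: "v \<in> carrier V" for v
  proof -
    \<comment> \<open>Coefficients of a linear combination are indexed by the vectors themselves, so
      the index has to be recovered from the unit vector.\<close>
    define a where "a w = v (THE i. w = unit_vec i)" for w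
    have a: "a (unit_vec i) = v i" for i
      unfolding a_def by (rule arg_cong[where f = v], rule the_equality) (auto dest: unit_vec_inj)
    have aK: "a \<in> ?A \<rightarrow> carrier K" using v by (auto simp: a)
    have "V.lincomb a ?A = v"
    proof
      fix j
      show "V.lincomb a ?A j = v j"
      proof (cases "j < length es")
        case True
        then show ?thesis using V_lincomb_coord[OF aK True] a by simp
      next
        case False
        have "V.lincomb a ?A \<in> carrier V" by (rule V.lincomb_closed[OF sub aK])
        then show ?thesis using v False by (simp add: V_carrier)
      qed
    qed
    then show ?thesis unfolding V.span_def using fin aK by blast
  qed
  then have gen: "V.span ?A = carrier V" using V.span_is_subset2[OF sub] by blast
  have "V.lin_indpt ?A"
  proof (rule V.finite_lin_indpt2[OF fin sub])
    fix a assume a: "a \<in> ?A \<rightarrow> carrier K" and z: "V.lincomb a ?A = \<zero>\<^bsub>V\<^esub>"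
    show "\<forall>v\<in>?A. a v = \<zero>\<^bsub>K\<^esub>" using V_lincomb_coord[OF a] z by (auto simp: V_ops K_zero)
  qed
  then have "V.basis ?A" using gen sub by (simp add: V.basis_def)
  then have "V.dim = length es" using V.dim_basis[OF fin] card by simp
  moreover have "V.fin_dim" unfolding V.fin_dim_def using fin sub gen by blast
  ultimately show ?thesis by blast
qed

lemma K_minus: "a \<in> carrier K \<Longrightarrow> b \<in> carrier K \<Longrightarrow> a \<ominus>\<^bsub>K\<^esub> b = a \<ominus> b"
proof -
  assume ab: "a \<in> carrier K" "b \<in> carrier K"
  have "(\<ominus>\<^bsub>K\<^esub> b) \<oplus> b = \<zero>" using K.l_neg[OF ab(2)] by (simp add: K_ops)
  then have "\<ominus>\<^bsub>K\<^esub> b = \<ominus> b" using minus_equality[of "\<ominus>\<^bsub>K\<^esub> b" b] ab K.a_inv_closed by simp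
  then show ?thesis by (simp add: a_minus_def K_add)
qed

lemma q_add:
  assumes "vec u" "vec v" shows "q (\<lambda>i. u i \<oplus> v i) = q u \<oplus> q v \<oplus> (bilin es 0 u v \<oplus> bilin es 0 u v)"
proof -
  have uv: "vec (\<lambda>i. u i \<oplus> v i)" using assms by (rule vec_add)
  have *: "bilin es 0 w (\<lambda>i. u i \<oplus> v i) = bilin es 0 w u \<oplus> bilin es 0 w v" if "vec w" for w
    using that uv assms bilin_add[OF orthogonal_es assms that, of 0] by (simp add: bilin_sym[of w])
  show ?thesis unfolding q_def using assms uv orthogonal_es
    by (simp add: bilin_add * bilin_sym[of v u] a_ac)
qed

lemma polar_q:
  assumes "u \<in> carrier V" "v \<in> carrier V" shows "polar K V q u v = bilin es 0 u v \<oplus> bilin es 0 u v"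
proof -
  have c: "q u \<in> carrier K" "q v \<in> carrier K" "bilin es 0 u v \<in> carrier K"
    using assms orthogonal_es by (simp_all add: q_def)
  have cb: "q u \<in> carrier B" "q v \<in> carrier B" "bilin es 0 u v \<in> carrier B" using c by simp_all
  have "q (\<lambda>i. u i \<oplus> v i) = q u \<oplus> q v \<oplus> (bilin es 0 u v \<oplus> bilin es 0 u v)" using assms by (simp add: q_add)
  moreover have "q u \<oplus> q v \<oplus> (bilin es 0 u v \<oplus> bilin es 0 u v) \<ominus> q u \<ominus> q v = bilin es 0 u v \<oplus> bilin es 0 u v"
    using cb by algebra
  moreover have "x \<in> carrier K \<Longrightarrow> x \<ominus>\<^bsub>K\<^esub> q u \<ominus>\<^bsub>K\<^esub> q v = x \<ominus> q u \<ominus> q v" for x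
    using c K_minus[OF _ c(1)] K_minus[of "x \<ominus> q u" "q v"] K.minus_closed[of x "q u"] by simp
  moreover have "q u \<oplus> q v \<oplus> (bilin es 0 u v \<oplus> bilin es 0 u v) \<in> carrier K" using c by (simp add: S_add)
  ultimately show ?thesis unfolding polar_def by (simp add: V_ops)
qed

lemma V_quadratic: "quadratic_space K V q (length es)"
  unfolding quadratic_space_def quadratic_form_def
proof (intro conjI ballI)
  show "vectorspace K V" by (rule V_vectorspace)
  show "vectorspace.fin_dim K V" "vectorspace.dim K V = length es" using V_dim by blast+
  show "q v \<in> carrier K" if "v \<in> carrier V" for v using that orthogonal_es by (simp add: q_def)
  show "q (c \<odot>\<^bsub>V\<^esub> v) = c \<otimes>\<^bsub>K\<^esub> c \<otimes>\<^bsub>K\<^esub> q v" if "c \<in> carrier K" "v \<in> carrier V" for c v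
    using that orthogonal_es bilin_smult[OF orthogonal_es that(1) V_vec[OF that(2)] vec_smult[OF that(1) V_vec[OF that(2)]]]
      bilin_sym[OF V_vec[OF that(2)] vec_smult[OF that(1) V_vec[OF that(2)]]]
      bilin_smult[OF orthogonal_es that(1) V_vec[OF that(2)] V_vec[OF that(2)]]
    by (simp add: q_def V_ops K_ops m_assoc)
  show "polar K V q (u \<oplus>\<^bsub>V\<^esub> v) w = polar K V q u w \<oplus>\<^bsub>K\<^esub> polar K V q v w"
    if "u \<in> carrier V" "v \<in> carrier V" "w \<in> carrier V" for u v w
    using that orthogonal_es V_add[OF that(1,2)] by (simp add: polar_q V_ops K_ops bilin_add a_ac)
  show "polar K V q (c \<odot>\<^bsub>V\<^esub> u) w = c \<otimes>\<^bsub>K\<^esub> polar K V q u w"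
    if "c \<in> carrier K" "u \<in> carrier V" "w \<in> carrier V" for c u w
    using that orthogonal_es V_smult[OF that(1,2)] by (simp add: polar_q V_ops K_ops bilin_smult r_distr)
qed

lemma V_nondegenerate: "nondegenerate K V q"
  unfolding nondegenerate_def
proof (intro ballI impI)
  fix u assume u: "u \<in> carrier V" and z: "\<forall>v\<in>carrier V. polar K V q u v = \<zero>\<^bsub>K\<^esub>"
  show "u = \<zero>\<^bsub>V\<^esub>"
  proof
    fix j
    show "u j = \<zero>\<^bsub>V\<^esub> j"
    proof (cases "j < length es")
      case True
      define e where "e = es ! j \<otimes> es ! j"
      have ej: "es ! j \<in> set es" using True by simp
      have "orthogonal_in B (carrier K) xs \<Longrightarrow> x \<in> set xs \<Longrightarrow> x \<otimes> x \<in> carrier K" for x xs by (induction xs) auto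
      then have e: "e \<in> carrier K" "e \<noteq> \<zero>" unfolding e_def using orthogonal_es nz_es ej by blast+
      have uj: "u j \<in> carrier K" using u by simp
      have "polar K V q u (unit_vec j) = \<zero>" using z V_unit[OF True] by (simp add: K_zero)
      then have "u j \<otimes> e \<oplus> u j \<otimes> e = \<zero>"
        using u True V_unit[OF True] bilin_unit[OF orthogonal_es V_vec[OF u], of 0 j] by (simp add: polar_q e_def)
      then have "u j \<otimes> ((\<one> \<oplus> \<one>) \<otimes> e) = \<zero>" using uj e by (simp add: l_distr r_distr)
      moreover have "\<one> \<oplus> \<one> \<in> carrier K" by (intro S_add S_one)
      moreover from this have "(\<one> \<oplus> \<one>) \<otimes> e \<noteq> \<zero>" using K.integral[of "\<one> \<oplus> \<one>" e] two e by (auto simp: K_ops)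
      ultimately show ?thesis using K.integral[of "u j" "(\<one> \<oplus> \<one>) \<otimes> e"] uj e S_mult by (auto simp: K_ops V_ops)
    next
      case False
      then show ?thesis using u by (simp add: V_carrier V_ops)
    qed
  qed
qed

end

section \<open>The Clifford algebra of the quadratic space\<close>

context clifford_model begin

interpretation K: field K by (rule K_field)

definition phi :: "(nat \<Rightarrow> 'k) \<Rightarrow> 'k" where "phi v = vec_comb es 0 v"

definition word :: "(nat \<Rightarrow> 'k) list \<Rightarrow> 'k" where "word w = foldr (\<lambda>v x. phi v \<otimes> x) w \<one>"

lemma phi_closed [simp]: "v \<in> carrier V \<Longrightarrow> phi v \<in> carrier B"
  using es_carrier by (simp add: phi_def)

lemma word_closed [simp]: "set w \<subseteq> carrier V \<Longrightarrow> word w \<in> carrier B"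
  by (induction w) (auto simp: word_def)

lemma word_simps [simp]: "word [] = \<one>" "word (v # w) = phi v \<otimes> word w"
  by (simp_all add: word_def)

lemma word_append: "set u \<subseteq> carrier V \<Longrightarrow> set w \<subseteq> carrier V \<Longrightarrow> word (u @ w) = word u \<otimes> word w"
  by (induction u) (auto simp: m_assoc)

sublocale FH: free_hom K V B word
proof (intro free_hom.intro free_algebra_over.intro free_hom_axioms.intro)
  show "cring K" by (rule K.is_cring)
  show "ring B" by (rule ring_axioms)
  show "c \<otimes> b = b \<otimes> c" if "c \<in> carrier K" "b \<in> carrier B" for c b by (rule S_central[OF that])
qed (simp_all add: S_sub K_ops word_append)

abbreviation F where "F \<equiv> free_algebra K V"
abbreviation delta where "delta \<equiv> FH.delta"
abbreviation Phi where "Phi \<equiv> FH.Phi"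
lemmas delta_def = FH.delta_def and conv_delta = FH.conv_delta and conv_delta_Nil = FH.conv_delta_Nil
  and F_delta = FH.F_delta and F_ops = FH.F_ops and F_smult = FH.F_smult
  and F_K_valued = FH.F_K_valued and Phi_delta = FH.Phi_delta and Phi_mult = FH.Phi_mult and Phi_add = FH.Phi_add

lemma gen_delta: "free_gen K v = delta \<one>\<^bsub>K\<^esub> [v]"
  by (simp add: free_gen_def delta_def)

lemma gen_closed: "v \<in> carrier V \<Longrightarrow> free_gen K v \<in> carrier F"
  unfolding gen_delta by (intro F_delta) (simp_all add: K_one S_one)

lemma Phi_gen: "v \<in> carrier V \<Longrightarrow> Phi (free_gen K v) = phi v"
  unfolding gen_delta using Phi_delta[of "\<one>\<^bsub>K\<^esub>" "[v]"] K.one_closed by (simp add: K_one)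

text \<open>Scalars as multiples of the empty word: with them the scalar action is a product, and
  ring homomorphisms take care of it.\<close>

definition scal :: "'k \<Rightarrow> (nat \<Rightarrow> 'k) list \<Rightarrow> 'k" where "scal c = delta c []"

lemma scal_closed: "c \<in> carrier K \<Longrightarrow> scal c \<in> carrier F"
  unfolding scal_def by (intro F_delta) simp_all

lemma Phi_scal: "c \<in> carrier K \<Longrightarrow> Phi (scal c) = c"
  unfolding scal_def by (subst Phi_delta) simp_all

lemma smult_scal: "c \<in> carrier K \<Longrightarrow> f \<in> carrier F \<Longrightarrow> c \<odot>\<^bsub>F\<^esub> f = scal c \<otimes>\<^bsub>F\<^esub> f"
  using conv_delta_Nil[of c f] F_K_valued[of f] by (auto simp: F_ops scal_def)

lemma smult_closed_F: "c \<in> carrier K \<Longrightarrow> f \<in> carrier F \<Longrightarrow> c \<odot>\<^bsub>F\<^esub> f \<in> carrier F"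
  unfolding F_ops by (rule F_smult)

lemma Phi_smult: "c \<in> carrier K \<Longrightarrow> f \<in> carrier F \<Longrightarrow> Phi (c \<odot>\<^bsub>F\<^esub> f) = c \<otimes> Phi f"
  by (simp add: smult_scal Phi_mult scal_closed Phi_scal)

sublocale F: ring F by (rule FH.free_ring)
sublocale Phi: ring_hom_ring F B Phi by (rule FH.Phi_hom)

abbreviation I where "I \<equiv> clifford_ideal K V q"

lemma relations_sub: "clifford_relations K V q \<subseteq> carrier F"
proof -
  have "q v \<in> carrier K" if "v \<in> carrier V" for v using that orthogonal_es by (simp add: q_def)
  then show ?thesis
    unfolding clifford_relations_def Let_def
    by (auto intro!: F.minus_closed F.a_closed gen_closed smult_closed_F simp: V_ops V_add V_smult)
qed

sublocale I: ideal I F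
  unfolding clifford_ideal_def by (rule F.genideal_ideal[OF relations_sub])

lemma Phi_minus: "f \<in> carrier F \<Longrightarrow> g \<in> carrier F \<Longrightarrow> Phi (f \<ominus>\<^bsub>F\<^esub> g) = Phi f \<ominus> Phi g"
  by (simp add: F.minus_eq minus_eq)

lemma I_sub_kernel: "I \<subseteq> a_kernel F B Phi"
  unfolding clifford_ideal_def
proof (rule F.genideal_minimal[OF Phi.kernel_is_ideal])
  have qc: "q v \<in> carrier K" if "v \<in> carrier V" for v using that orthogonal_es by (simp add: q_def)
  have z: "Phi x = \<zero>" if "x \<in> clifford_relations K V q" for x
    using that unfolding clifford_relations_def Let_def
  proof (elim UnE CollectE exE conjE)
    fix u v assume x: "x = free_gen K (u \<oplus>\<^bsub>V\<^esub> v) \<ominus>\<^bsub>F\<^esub> (free_gen K u \<oplus>\<^bsub>F\<^esub> free_gen K v)" and uv: "u \<in> carrier V" "v \<in> carrier V"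
    have s: "u \<oplus>\<^bsub>V\<^esub> v \<in> carrier V" using uv by (simp add: V_ops V_add)
    have "phi (u \<oplus>\<^bsub>V\<^esub> v) = phi u \<oplus> phi v" using uv es_carrier by (simp add: phi_def V_ops vec_comb_add)
    then show ?thesis using uv s by (simp add: x Phi_minus gen_closed Phi_gen Phi_add r_neg minus_eq)
  next
    fix c v assume x: "x = free_gen K (c \<odot>\<^bsub>V\<^esub> v) \<ominus>\<^bsub>F\<^esub> c \<odot>\<^bsub>F\<^esub> free_gen K v" and cv: "c \<in> carrier K" "v \<in> carrier V"
    have s: "c \<odot>\<^bsub>V\<^esub> v \<in> carrier V" using cv by (simp add: V_ops V_smult)
    have "phi (c \<odot>\<^bsub>V\<^esub> v) = c \<otimes> phi v" using cv es_carrier by (simp add: phi_def V_ops vec_comb_smult)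
    then show ?thesis using cv s by (simp add: x Phi_minus gen_closed Phi_gen Phi_smult smult_closed_F r_neg minus_eq)
  next
    fix v assume x: "x = free_gen K v \<otimes>\<^bsub>F\<^esub> free_gen K v \<ominus>\<^bsub>F\<^esub> q v \<odot>\<^bsub>F\<^esub> \<one>\<^bsub>F\<^esub>" and v: "v \<in> carrier V"
    have "phi v \<otimes> phi v = q v" using v orthogonal_es by (simp add: phi_def q_def vec_comb_square)
    then show ?thesis using v qc[OF v]
      by (simp add: x Phi_minus gen_closed Phi_gen Phi_smult smult_closed_F r_neg minus_eq)
  qed
  show "clifford_relations K V q \<subseteq> a_kernel F B Phi"
    unfolding a_kernel_def' using z relations_sub by blast
qed

section \<open>The Clifford quotient is spanned by ordered products of generators\<close>

abbreviation Q where "Q \<equiv> F Quot I"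
definition bar :: "((nat \<Rightarrow> 'k) list \<Rightarrow> 'k) \<Rightarrow> ((nat \<Rightarrow> 'k) list \<Rightarrow> 'k) set" where
  "bar f = I +>\<^bsub>F\<^esub> f"

lemma bar_hom: "ring_hom_ring F Q bar"
  using I.rcos_ring_hom_ring unfolding bar_def[abs_def] .

sublocale Q: ring Q by (rule I.quotient_is_ring)
sublocale bar: ring_hom_ring F Q bar by (rule bar_hom)

lemma bar_eq: "f \<in> carrier F \<Longrightarrow> g \<in> carrier F \<Longrightarrow> bar f = bar g \<longleftrightarrow> f \<ominus>\<^bsub>F\<^esub> g \<in> I"
  unfolding bar_def using F.quotient_eq_iff_same_a_r_cos[OF I.is_ideal] by blast

lemma bar_relation:
  assumes "x \<in> carrier F" "y \<in> carrier F" "x \<ominus>\<^bsub>F\<^esub> y \<in> clifford_relations K V q" shows "bar x = bar y"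
  unfolding bar_eq[OF assms(1,2)] clifford_ideal_def using F.genideal_self[OF relations_sub] assms(3) by blast

lemma bar_add: assumes "u \<in> carrier V" "v \<in> carrier V"
  shows "bar (free_gen K (u \<oplus>\<^bsub>V\<^esub> v)) = bar (free_gen K u) \<oplus>\<^bsub>Q\<^esub> bar (free_gen K v)"
proof -
  have "bar (free_gen K (u \<oplus>\<^bsub>V\<^esub> v)) = bar (free_gen K u \<oplus>\<^bsub>F\<^esub> free_gen K v)"
    using assms by (intro bar_relation gen_closed F.a_closed)
      (auto simp: V_ops V_add clifford_relations_def Let_def)
  then show ?thesis using assms gen_closed by simp
qed

lemma bar_smult: assumes "c \<in> carrier K" "v \<in> carrier V"
  shows "bar (free_gen K (c \<odot>\<^bsub>V\<^esub> v)) = bar (scal c) \<otimes>\<^bsub>Q\<^esub> bar (free_gen K v)"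
proof -
  have "bar (free_gen K (c \<odot>\<^bsub>V\<^esub> v)) = bar (c \<odot>\<^bsub>F\<^esub> free_gen K v)"
    using assms by (intro bar_relation gen_closed smult_closed_F)
      (auto simp: V_ops V_smult clifford_relations_def Let_def)
  then show ?thesis using assms by (simp add: smult_scal gen_closed scal_closed)
qed

lemma bar_square: assumes "v \<in> carrier V"
  shows "bar (free_gen K v) \<otimes>\<^bsub>Q\<^esub> bar (free_gen K v) = bar (scal (q v))"
proof -
  have qv: "q v \<in> carrier K" using assms orthogonal_es by (simp add: q_def)
  have "bar (free_gen K v \<otimes>\<^bsub>F\<^esub> free_gen K v) = bar (q v \<odot>\<^bsub>F\<^esub> \<one>\<^bsub>F\<^esub>)"
    using assms qv by (intro bar_relation gen_closed F.m_closed smult_closed_F)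
      (auto simp: clifford_relations_def Let_def)
  then show ?thesis using assms qv by (simp add: smult_scal gen_closed scal_closed)
qed

lemma scal_hom: "c \<in> carrier K \<Longrightarrow> d \<in> carrier K \<Longrightarrow> scal (c \<oplus> d) = scal c \<oplus>\<^bsub>F\<^esub> scal d"
  "c \<in> carrier K \<Longrightarrow> d \<in> carrier K \<Longrightarrow> scal (c \<otimes> d) = scal c \<otimes>\<^bsub>F\<^esub> scal d"
  using conv_delta[of c d "[]" "[]"] unfolding F_ops by (auto simp: scal_def delta_def K_ops)

lemma scal_zero_one: "scal \<zero> = \<zero>\<^bsub>F\<^esub>" "scal \<one> = \<one>\<^bsub>F\<^esub>"
  unfolding F_ops by (auto simp: scal_def delta_def K_ops)

lemma scal_central: assumes "c \<in> carrier K" "f \<in> carrier F" shows "scal c \<otimes>\<^bsub>F\<^esub> f = f \<otimes>\<^bsub>F\<^esub> scal c"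
  using assms(2)
proof (induction rule: FH.F_induct)
  case zero
  show ?case using scal_closed[OF assms(1)] F.r_null F.l_null unfolding F_ops(3) by simp
next
  case (delta d w)
  then show ?case using assms(1) S_central[OF assms(1), of d]
    unfolding F_ops scal_def by (auto simp: conv_delta K_ops)
next
  case (add f g)
  then show ?case using F.l_distr[OF add(1,2) scal_closed[OF assms(1)]] F.r_distr[OF add(1,2) scal_closed[OF assms(1)]]
    by (simp add: F_ops(4))
qed

definition S where "S = (\<lambda>c. bar (scal c)) ` carrier K"

sublocale Q: central_subring Q S
proof
  show "S \<subseteq> carrier Q" unfolding S_def using scal_closed by auto
  show "\<zero>\<^bsub>Q\<^esub> \<in> S" unfolding S_def using scal_zero_one(1) bar.hom_zero by (intro image_eqI[of _ _ \<zero>] S_zero) simp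
  show "\<one>\<^bsub>Q\<^esub> \<in> S" unfolding S_def using scal_zero_one(2) bar.hom_one by (intro image_eqI[of _ _ \<one>] S_one) simp
  show "a \<oplus>\<^bsub>Q\<^esub> b \<in> S" if ab: "a \<in> S" "b \<in> S" for a b
  proof -
    obtain c d where c: "a = bar (scal c)" "b = bar (scal d)" "c \<in> carrier K" "d \<in> carrier K" using ab by (auto simp: S_def)
    then have "a \<oplus>\<^bsub>Q\<^esub> b = bar (scal (c \<oplus> d))" by (simp add: scal_hom scal_closed)
    then show ?thesis unfolding S_def using S_add c by blast
  qed
  show "a \<otimes>\<^bsub>Q\<^esub> b \<in> S" if ab: "a \<in> S" "b \<in> S" for a b
  proof -
    obtain c d where c: "a = bar (scal c)" "b = bar (scal d)" "c \<in> carrier K" "d \<in> carrier K" using ab by (auto simp: S_def)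
    then have "a \<otimes>\<^bsub>Q\<^esub> b = bar (scal (c \<otimes> d))" by (simp add: scal_hom scal_closed)
    then show ?thesis unfolding S_def using S_mult c by blast
  qed
  show "\<ominus>\<^bsub>Q\<^esub> a \<in> S" if a: "a \<in> S" for a
  proof -
    obtain c where c: "a = bar (scal c)" "c \<in> carrier K" using a by (auto simp: S_def)
    have n: "\<ominus> c \<in> carrier K" using S_neg c by blast
    have "bar (scal (\<ominus> c)) \<oplus>\<^bsub>Q\<^esub> a = bar (scal (\<ominus> c \<oplus> c))" using c n by (simp add: scal_hom scal_closed)
    also have "\<dots> = \<zero>\<^bsub>Q\<^esub>" using c by (simp add: l_neg scal_zero_one)
    finally have "\<ominus>\<^bsub>Q\<^esub> a = bar (scal (\<ominus> c))" using c n scal_closed by (intro Q.minus_equality) auto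
    then show ?thesis unfolding S_def using n by blast
  qed
  show "a \<otimes>\<^bsub>Q\<^esub> x = x \<otimes>\<^bsub>Q\<^esub> a" if a: "a \<in> S" and x: "x \<in> carrier Q" for a x
  proof -
    obtain c where c: "a = bar (scal c)" "c \<in> carrier K" using a by (auto simp: S_def)
    obtain f where f: "x = bar f" "f \<in> carrier F" using x unfolding FactRing_simps bar_def by auto
    have "a \<otimes>\<^bsub>Q\<^esub> x = bar (scal c \<otimes>\<^bsub>F\<^esub> f)" using c f scal_closed by simp
    also have "\<dots> = bar (f \<otimes>\<^bsub>F\<^esub> scal c)" by (simp only: scal_central[OF c(2) f(2)])
    also have "\<dots> = x \<otimes>\<^bsub>Q\<^esub> a" using c f scal_closed by simp
    finally show ?thesis .
  qed
qed

definition X :: "nat \<Rightarrow> ((nat \<Rightarrow> 'k) list \<Rightarrow> 'k) set" where "X i = bar (free_gen K (unit_vec i))"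

definition Xs where "Xs = map X [0..<length es]"

lemma X_closed: "i < length es \<Longrightarrow> X i \<in> carrier Q"
  unfolding X_def using gen_closed V_unit by simp

text \<open>Polarization: distinct unit vectors are orthogonal, so \<open>q\<close> is additive on
  their sum, and comparing the square of \<open>X i + X j\<close> with the sum of the squares leaves
  the anticommutator equal to zero.\<close>

lemma X_skew:
  assumes ij: "i < length es" "j < length es" "i \<noteq> j"
  shows "X i \<otimes>\<^bsub>Q\<^esub> X j = \<ominus>\<^bsub>Q\<^esub> (X j \<otimes>\<^bsub>Q\<^esub> X i)"
proof -
  let ?u = "unit_vec i :: nat \<Rightarrow> 'k" and ?v = "unit_vec j :: nat \<Rightarrow> 'k"
  have uv: "?u \<in> carrier V" "?v \<in> carrier V" using V_unit ij by auto
  have s: "?u \<oplus>\<^bsub>V\<^esub> ?v \<in> carrier V" using uv by (simp add: V_ops V_add)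
  have "bilin es 0 ?u ?v = ?u j \<otimes> (es ! j \<otimes> es ! j)" using bilin_unit[OF orthogonal_es, of ?u 0 j] ij by simp
  then have "bilin es 0 ?u ?v = \<zero>" using ij es_carrier nth_mem[of j es] by (simp add: unit_vec_def subset_iff)
  then have "q (?u \<oplus>\<^bsub>V\<^esub> ?v) = q ?u \<oplus> q ?v" using q_add[of ?u ?v] orthogonal_es by (simp add: V_ops q_def)
  moreover have qK: "q ?u \<in> carrier K" "q ?v \<in> carrier K" using orthogonal_es by (simp_all add: q_def)
  ultimately have "(X i \<oplus>\<^bsub>Q\<^esub> X j) \<otimes>\<^bsub>Q\<^esub> (X i \<oplus>\<^bsub>Q\<^esub> X j) = X i \<otimes>\<^bsub>Q\<^esub> X i \<oplus>\<^bsub>Q\<^esub> X j \<otimes>\<^bsub>Q\<^esub> X j"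
    using bar_square[OF s] bar_square[OF uv(1)] bar_square[OF uv(2)] bar_add[OF uv]
    by (simp add: X_def scal_hom scal_closed)
  moreover have c: "X i \<in> carrier Q" "X j \<in> carrier Q" using X_closed ij by auto
  ultimately have "X i \<otimes>\<^bsub>Q\<^esub> X i \<oplus>\<^bsub>Q\<^esub> X j \<otimes>\<^bsub>Q\<^esub> X j \<oplus>\<^bsub>Q\<^esub> (X i \<otimes>\<^bsub>Q\<^esub> X j \<oplus>\<^bsub>Q\<^esub> X j \<otimes>\<^bsub>Q\<^esub> X i) =
      X i \<otimes>\<^bsub>Q\<^esub> X i \<oplus>\<^bsub>Q\<^esub> X j \<otimes>\<^bsub>Q\<^esub> X j"
    by (simp add: Q.l_distr Q.r_distr Q.a_ac)
  then have "X i \<otimes>\<^bsub>Q\<^esub> X j \<oplus>\<^bsub>Q\<^esub> X j \<otimes>\<^bsub>Q\<^esub> X i = \<zero>\<^bsub>Q\<^esub>"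
    using c by (subst (asm) Q.add.l_cancel_one) auto
  then show ?thesis using c by (intro Q.minus_equality[symmetric]) auto
qed

lemma orthogonal_Xs: "orthogonal_in Q S Xs"
proof -
  have "orthogonal_in Q S (map X [m..<length es])" if "m \<le> length es" for m
    using that
  proof (induction rule: inc_induct)
    case (step m)
    have "X m \<otimes>\<^bsub>Q\<^esub> X m \<in> S"
      using bar_square[OF V_unit[OF step(2)]] orthogonal_es by (auto simp: X_def S_def q_def)
    moreover have "\<forall>f\<in>set (map X [Suc m..<length es]). f \<otimes>\<^bsub>Q\<^esub> X m = \<ominus>\<^bsub>Q\<^esub> (X m \<otimes>\<^bsub>Q\<^esub> f)"
    proof
      fix f assume "f \<in> set (map X [Suc m..<length es])"
      then obtain i where "f = X i" "i < length es" "i \<noteq> m" by auto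
      then show "f \<otimes>\<^bsub>Q\<^esub> X m = \<ominus>\<^bsub>Q\<^esub> (X m \<otimes>\<^bsub>Q\<^esub> f)" using X_skew step(2) by metis
    qed
    ultimately show ?case using step(2,3) X_closed by (simp add: upt_conv_Cons)
  qed simp
  then show ?thesis unfolding Xs_def by blast
qed

lemma Xs_carrier: "set Xs \<subseteq> carrier Q" by (rule Q.orthogonal_in_carrier[OF orthogonal_Xs])

text \<open>The vector is built up coordinate by coordinate through its truncations
  \<open>tr m\<close>; each step adds a scalar multiple of a generator \<open>X m\<close>, for which
  the claim is \<open>prod_span_in_left\<close>.\<close>

lemma gen_left:
  assumes v: "v \<in> carrier V" and x: "x \<in> prod_span_in Q S Xs"
  shows "bar (free_gen K v) \<otimes>\<^bsub>Q\<^esub> x \<in> prod_span_in Q S Xs"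
proof -
  note xc = Q.prod_span_in_carrier[OF Xs_carrier x]
  have gc: "bar (free_gen K u) \<in> carrier Q" if "u \<in> carrier V" for u using gen_closed that by simp
  define tr where "tr m = (\<lambda>i. if i < m then v i else \<zero>)" for m
  have tr: "tr m \<in> carrier V" for m using v by (auto simp: V_carrier tr_def vec_def S_zero)
  have vm: "v m \<in> carrier K" for m using v by simp
  have "bar (free_gen K (tr m)) \<otimes>\<^bsub>Q\<^esub> x \<in> prod_span_in Q S Xs" if "m \<le> length es" for m
    using that
  proof (induction m)
    case 0
    \<comment> \<open>The generator belonging to the zero vector is a nonzero element of the free
      algebra. It dies only in the quotient, by the relation for the scalar multiple with factor
      zero.\<close>
    have "tr 0 = \<zero> \<odot>\<^bsub>V\<^esub> tr 0" using tr[of 0] by (auto simp: V_ops tr_def)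
    then have "bar (free_gen K (tr 0)) = bar (scal \<zero>) \<otimes>\<^bsub>Q\<^esub> bar (free_gen K (tr 0))"
      using bar_smult[OF S_zero tr[of 0]] by simp
    also have "\<dots> = \<zero>\<^bsub>Q\<^esub>" using gc[OF tr[of 0]] by (simp add: scal_zero_one)
    finally show ?case using xc Q.prod_span_in_zero[OF Xs_carrier] by simp
  next
    case (Suc m)
    then have m: "m < length es" by simp
    have "tr (Suc m) i = (tr m \<oplus>\<^bsub>V\<^esub> (v m \<odot>\<^bsub>V\<^esub> unit_vec m)) i" for i
      using vm[of i] vm[of m] by (auto simp: V_ops tr_def unit_vec_def less_Suc_eq)
    then have e: "tr (Suc m) = tr m \<oplus>\<^bsub>V\<^esub> (v m \<odot>\<^bsub>V\<^esub> unit_vec m)" by blast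
    have vu: "v m \<odot>\<^bsub>V\<^esub> unit_vec m \<in> carrier V" using V_smult[OF vm V_unit[OF m]] by (simp add: V_ops)
    have "bar (free_gen K (tr (Suc m))) = bar (free_gen K (tr m)) \<oplus>\<^bsub>Q\<^esub> bar (scal (v m)) \<otimes>\<^bsub>Q\<^esub> X m"
      unfolding e bar_add[OF tr vu] bar_smult[OF vm V_unit[OF m]] X_def ..
    moreover have sc: "bar (scal (v m)) \<in> S" using vm by (auto simp: S_def)
    ultimately have "bar (free_gen K (tr (Suc m))) \<otimes>\<^bsub>Q\<^esub> x =
        bar (free_gen K (tr m)) \<otimes>\<^bsub>Q\<^esub> x \<oplus>\<^bsub>Q\<^esub> bar (scal (v m)) \<otimes>\<^bsub>Q\<^esub> (X m \<otimes>\<^bsub>Q\<^esub> x)"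
      using xc gc[OF tr] X_closed[OF m] Q.S_carrier[OF sc] by (simp add: Q.l_distr Q.m_assoc)
    moreover have "X m \<otimes>\<^bsub>Q\<^esub> x \<in> prod_span_in Q S Xs" using m by (intro Q.prod_span_in_left[OF orthogonal_Xs _ x]) (simp add: Xs_def)
    ultimately show ?case
      using Suc.IH m Q.prod_span_in_add[OF Xs_carrier] Q.prod_span_in_scalar[OF Xs_carrier sc] by simp
  qed
  from this[OF order_refl] have "bar (free_gen K (tr (length es))) \<otimes>\<^bsub>Q\<^esub> x \<in> prod_span_in Q S Xs" .
  moreover have "tr (length es) = v" using v by (auto simp: tr_def V_carrier)
  ultimately show ?thesis by simp
qed

lemma bar_prod_span_in: assumes "f \<in> carrier F" shows "bar f \<in> prod_span_in Q S Xs"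
  using assms
proof (induction rule: FH.F_induct)
  case zero
  have "bar \<zero>\<^bsub>F\<^esub> \<in> prod_span_in Q S Xs" using Q.prod_span_in_zero[OF Xs_carrier] by simp
  then show ?case by (simp add: F_ops)
next
  case (add f g)
  then have "bar (f \<oplus>\<^bsub>F\<^esub> g) \<in> prod_span_in Q S Xs" using Q.prod_span_in_add[OF Xs_carrier] by simp
  then show ?case by (simp add: F_ops)
next
  case (delta c w)
  then show ?case
  proof (induction w)
    case Nil
    have "bar (scal c) \<in> S" using Nil by (auto simp: S_def)
    then show ?case using Q.prod_span_in_S[OF Xs_carrier] by (simp add: scal_def)
  next
    case (Cons v w)
    have "delta c (v # w) = free_gen K v \<otimes>\<^bsub>F\<^esub> delta c w"
      unfolding gen_delta F_ops using Cons.prems(1) conv_delta[of "\<one>\<^bsub>K\<^esub>" c "[v]" w] K.one_closed by auto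
    then show ?case using Cons gen_left[of v "bar (delta c w)"] gen_closed[of v] F_delta[of c w] by simp
  qed
qed

text \<open>This replaces a dimension count: a combination of ordered products in the quotient is
  lifted so that its value in \<open>B\<close> is the corresponding combination there, and
  independence in \<open>B\<close> forces the original combination to vanish once its value
  does.\<close>

lemma prod_span_in_lift:
  assumes "list_all2 (\<lambda>x e. \<exists>g\<in>carrier F. x = bar g \<and> Phi g = e) xs fs"
    and "prod_indep B (carrier K) fs" and "x \<in> prod_span_in Q S xs"
  shows "\<exists>f\<in>carrier F. x = bar f \<and> Phi f \<in> prod_span_in B (carrier K) fs \<and> (Phi f = \<zero> \<longrightarrow> x = \<zero>\<^bsub>Q\<^esub>)"
  using assms
proof (induction arbitrary: x rule: list_all2_induct)
  case Nil
  then obtain c where c: "x = bar (scal c)" "c \<in> carrier K" by (auto simp: S_def)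
  then show ?case using Phi_scal[OF c(2)] scal_closed[OF c(2)] scal_zero_one(1) by (intro bexI[of _ "scal c"]) auto
next
  case (Cons y ys e fs)
  then obtain g h where gh: "x = g \<oplus>\<^bsub>Q\<^esub> y \<otimes>\<^bsub>Q\<^esub> h" "g \<in> prod_span_in Q S ys" "h \<in> prod_span_in Q S ys" by auto
  obtain a where a: "a \<in> carrier F" "y = bar a" "Phi a = e" using Cons by blast
  have ind: "prod_indep B (carrier K) fs" using Cons.prems by simp
  obtain f1 where f1: "f1 \<in> carrier F" "g = bar f1" "Phi f1 \<in> prod_span_in B (carrier K) fs" "Phi f1 = \<zero> \<longrightarrow> g = \<zero>\<^bsub>Q\<^esub>"
    using Cons.IH[OF ind gh(2)] by blast
  obtain f2 where f2: "f2 \<in> carrier F" "h = bar f2" "Phi f2 \<in> prod_span_in B (carrier K) fs" "Phi f2 = \<zero> \<longrightarrow> h = \<zero>\<^bsub>Q\<^esub>"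
    using Cons.IH[OF ind gh(3)] by blast
  let ?f = "f1 \<oplus>\<^bsub>F\<^esub> a \<otimes>\<^bsub>F\<^esub> f2"
  have P: "Phi ?f = Phi f1 \<oplus> e \<otimes> Phi f2" using a f1 f2 by simp
  show ?case
  proof (intro bexI[of _ ?f] conjI impI)
    show "?f \<in> carrier F" using a f1 f2 by simp
    show "x = bar ?f" using a f1 f2 gh by simp
    show "Phi ?f \<in> prod_span_in B (carrier K) (e # fs)" unfolding P using f1 f2 by auto
    assume "Phi ?f = \<zero>"
    then have "Phi f1 = \<zero> \<and> Phi f2 = \<zero>" using Cons.prems(1) f1(3) f2(3) unfolding P by simp
    then have "g = \<zero>\<^bsub>Q\<^esub>" "h = \<zero>\<^bsub>Q\<^esub>" using f1(4) f2(4) by blast+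
    then show "x = \<zero>\<^bsub>Q\<^esub>" using gh(1) a(1,2) by simp
  qed
qed

lemma Phi_X: "i < length es \<Longrightarrow> Phi (free_gen K (unit_vec i)) = es ! i"
  using vec_comb_unit[OF es_carrier, of 0 i] by (simp add: Phi_gen V_unit phi_def)

text \<open>For \<open>f\<close> in the kernel, the class \<open>bar f\<close> is a combination of
  ordered products. Its lift \<open>g\<close> differs from \<open>f\<close> by an element of the
  ideal, so \<open>Phi g = 0\<close>, and \<open>prod_span_in_lift\<close> gives
  \<open>bar f = 0\<close>.\<close>

lemma kernel_eq: "a_kernel F B Phi = I"
proof
  show "I \<subseteq> a_kernel F B Phi" by (rule I_sub_kernel)
  show "a_kernel F B Phi \<subseteq> I"
  proof
    fix f assume "f \<in> a_kernel F B Phi"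
    then have f: "f \<in> carrier F" "Phi f = \<zero>" unfolding a_kernel_def' by blast+
    have "list_all2 (\<lambda>x e. \<exists>g\<in>carrier F. x = bar g \<and> Phi g = e) Xs es"
      unfolding list_all2_conv_all_nth
    proof (intro conjI allI impI)
      fix i assume "i < length Xs"
      then have i: "i < length es" by (simp add: Xs_def)
      show "\<exists>g\<in>carrier F. Xs ! i = bar g \<and> Phi g = es ! i"
        using i by (intro bexI[OF _ gen_closed[OF V_unit[OF i]]] conjI Phi_X) (simp_all add: Xs_def X_def)
    qed (simp add: Xs_def)
    from prod_span_in_lift[OF this indep_es bar_prod_span_in[OF f(1)]]
    obtain g where g: "g \<in> carrier F" "bar f = bar g" "Phi g = \<zero> \<longrightarrow> bar f = \<zero>\<^bsub>Q\<^esub>" by blast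
    have "f \<ominus>\<^bsub>F\<^esub> g \<in> I" using bar_eq[OF f(1) g(1)] g(2) by simp
    then have "Phi (f \<ominus>\<^bsub>F\<^esub> g) = \<zero>" using I_sub_kernel unfolding a_kernel_def' by blast
    then have "\<ominus> Phi g = \<zero>" using f g by (simp add: Phi_minus minus_eq)
    then have "\<ominus> (\<ominus> Phi g) = \<zero>" by simp
    then have "Phi g = \<zero>" using g(1) by (simp only: minus_minus Phi.hom_closed)
    then have "bar f = bar \<zero>\<^bsub>F\<^esub>" using g(3) by simp
    then have "f \<ominus>\<^bsub>F\<^esub> \<zero>\<^bsub>F\<^esub> \<in> I" using bar_eq[OF f(1) F.zero_closed] by simp
    then show "f \<in> I" using f(1) by (simp add: F.minus_eq)
  qed
qed

lemma Phi_surj: "Phi ` carrier F = carrier B"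
proof
  show "Phi ` carrier F \<subseteq> carrier B" by auto
  have "x \<in> Phi ` carrier F" if "set fs \<subseteq> Phi ` carrier F" "x \<in> prod_span_in B (carrier K) fs" for fs x
    using that
  proof (induction fs arbitrary: x)
    case Nil
    then show ?case using Phi_scal[of x] scal_closed[of x] by (intro image_eqI[of _ _ "scal x"]) simp_all
  next
    case (Cons e fs)
    then obtain g h where x: "x = g \<oplus> e \<otimes> h" "g \<in> Phi ` carrier F" "h \<in> Phi ` carrier F" by auto
    moreover obtain a where "a \<in> carrier F" "e = Phi a" using Cons.prems by auto
    moreover obtain b c where "b \<in> carrier F" "g = Phi b" "c \<in> carrier F" "h = Phi c" using x by blast
    ultimately have "x = Phi (b \<oplus>\<^bsub>F\<^esub> a \<otimes>\<^bsub>F\<^esub> c)" "b \<oplus>\<^bsub>F\<^esub> a \<otimes>\<^bsub>F\<^esub> c \<in> carrier F" by simp_all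
    then show ?case by blast
  qed
  moreover have "set es \<subseteq> Phi ` carrier F"
  proof
    fix e assume "e \<in> set es"
    then obtain i where i: "e = es ! i" "i < length es" by (auto simp: in_set_conv_nth)
    show "e \<in> Phi ` carrier F"
      unfolding i(1) using Phi_X[OF i(2)] gen_closed[OF V_unit[OF i(2)]]
      by (intro image_eqI[of _ Phi "free_gen K (unit_vec i)"]) simp_all
  qed
  ultimately show "carrier B \<subseteq> Phi ` carrier F" using span_es by blast
qed

section \<open>Compatibility with the gradings\<close>

lemma grade_zero: "\<zero> \<in> grade B i"
  using gr_disj by (cases i) auto

lemma gr_disj': "x \<in> grade B i \<Longrightarrow> x \<in> grade B (i + 1) \<Longrightarrow> x = \<zero>"
  using gr_disj by (cases i) auto

lemma phi_grade: assumes "v \<in> carrier V" shows "phi v \<in> grade B 1"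
proof -
  have "vec_comb fs k v \<in> grade B 1" if "set fs \<subseteq> grade B 1" for fs k
    using that
  proof (induction fs arbitrary: k)
    case (Cons e fs)
    have "v k \<in> grade B 0" using gr_K assms by auto
    then have "v k \<otimes> e \<in> grade B 1" using gr_mult[of "v k" 0 e 1] Cons.prems by simp
    then show ?case using Cons by (auto intro: gr_add)
  qed (simp add: grade_zero)
  then show ?thesis using gr_es by (simp add: phi_def)
qed

lemma word_grade: "set w \<subseteq> carrier V \<Longrightarrow> word w \<in> grade B (of_nat (length w))"
proof (induction w)
  case Nil
  show ?case using gr_K S_one by auto
next
  case (Cons v w)
  then have "phi v \<otimes> word w \<in> grade B (1 + of_nat (length w))" by (intro gr_mult phi_grade) auto
  then show ?case by simp
qed

lemma Phi_grade:
  assumes f: "f \<in> carrier F" and h: "\<forall>w. f w \<noteq> \<zero>\<^bsub>K\<^esub> \<longrightarrow> of_nat (length w) = i" shows "Phi f \<in> grade B i"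
proof -
  have t: "f w \<otimes> word w \<in> grade B i" if "f w \<noteq> \<zero>" for w
  proof -
    have w: "set w \<subseteq> carrier V" using FH.supp(2)[OF f] that by blast
    have "f w \<in> grade B 0" using gr_K F_K_valued[OF f] FH.K_valued_D by blast
    then have "f w \<otimes> word w \<in> grade B (0 + of_nat (length w))" by (intro gr_mult word_grade w)
    moreover have "of_nat (length w) = i" using h that by (simp add: K_zero)
    ultimately show ?thesis by (simp only: add_0)
  qed
  have "finite A \<Longrightarrow> A \<subseteq> {w. f w \<noteq> \<zero>} \<Longrightarrow> (\<Oplus>w\<in>A. f w \<otimes> word w) \<in> grade B i" for A
  proof (induction A rule: finite_induct)
    case (insert a A)
    have "(\<lambda>w. f w \<otimes> word w) \<in> A \<rightarrow> carrier B" "f a \<otimes> word a \<in> carrier B"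
      using t insert.prems gr_sub by blast+
    then have "(\<Oplus>w\<in>insert a A. f w \<otimes> word w) = f a \<otimes> word a \<oplus> (\<Oplus>w\<in>A. f w \<otimes> word w)"
      using insert by (intro finsum_insert) auto
    then show ?case using t insert by (auto intro: gr_add)
  qed (simp add: grade_zero)
  then show ?thesis unfolding FH.Phi_def using FH.supp(1)[OF f] by blast
qed

lemma grade_lift:
  assumes b: "b \<in> grade B i"
  shows "\<exists>f\<in>carrier F. Phi f = b \<and> (\<forall>w. f w \<noteq> \<zero>\<^bsub>K\<^esub> \<longrightarrow> of_nat (length w) = i)"
proof -
  have "b \<in> Phi ` carrier F" using subsetD[OF gr_sub b] unfolding Phi_surj .
  then obtain f where f: "f \<in> carrier F" "Phi f = b" by blast
  define g where "g j = (\<lambda>w. if of_nat (length w) = (j :: bit) then f w else \<zero>\<^bsub>K\<^esub>)" for j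
  have g: "g j \<in> carrier F" "\<forall>w. g j w \<noteq> \<zero>\<^bsub>K\<^esub> \<longrightarrow> of_nat (length w) = j" for j
    unfolding g_def by (rule FH.F_restrict[OF f(1)]) simp
  have gB: "Phi (g j) \<in> grade B j" for j by (rule Phi_grade[OF g])
  have "f = g i \<oplus>\<^bsub>F\<^esub> g (i + 1)"
  proof
    fix w
    have "f w \<in> carrier B" using FH.F_in_B[OF f(1)] .
    moreover have "of_nat (length w) = i \<and> of_nat (length w) \<noteq> i + 1 \<or>
        of_nat (length w) \<noteq> i \<and> of_nat (length w) = i + 1"
      by (cases i; cases "of_nat (length w) :: bit") simp_all
    ultimately show "f w = (g i \<oplus>\<^bsub>F\<^esub> g (i + 1)) w"
      unfolding F_ops g_def K_add K_zero by (elim disjE conjE) (simp_all only: if_True if_False l_zero r_zero refl)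
  qed
  then have "Phi f = Phi (g i) \<oplus> Phi (g (i + 1))" using Phi_add[OF g(1)[of i] g(1)[of "i + 1"]] by (simp only:)
  then have s: "b = Phi (g i) \<oplus> Phi (g (i + 1))" by (simp only: f(2))
  have c: "Phi (g j) \<in> carrier B" for j using g(1) by simp
  have "b \<oplus> \<ominus> Phi (g i) = \<ominus> Phi (g i) \<oplus> (Phi (g i) \<oplus> Phi (g (i + 1)))"
    unfolding s by (intro a_comm a_closed a_inv_closed c)
  also have "\<dots> = Phi (g (i + 1))" by (intro r_neg1 c)
  finally have "Phi (g (i + 1)) = b \<oplus> \<ominus> Phi (g i)" by (rule sym)
  then have "Phi (g (i + 1)) \<in> grade B i" using gr_add[OF b gr_neg[OF gB]] by (simp only:)
  then have "Phi (g (i + 1)) = \<zero>" by (rule gr_disj'[OF _ gB])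
  then have "b = Phi (g i)" unfolding s using c by (simp only: r_zero)
  then show ?thesis using g[of i] by blast
qed

theorem clifford_iso: "superalg_iso K B (clifford K V q) \<noteq> {}"
proof -
  define psi where "psi = (\<lambda>x. the_elem (Phi ` x))"
  have psi: "psi \<in> ring_iso Q B" unfolding psi_def using Phi.FactRing_iso_set[OF Phi_surj] unfolding kernel_eq .
  define h where "h = inv_into (carrier Q) psi"
  have h: "h \<in> ring_iso B Q" unfolding h_def by (rule ring_iso_set_sym[OF Q.ring_axioms psi])
  have psi_bar: "psi (bar f) = Phi f" if "f \<in> carrier F" for f
    unfolding psi_def bar_def using Phi.the_elem_simp[OF that] unfolding kernel_eq .
  have h_Phi: "h (Phi f) = bar f" if "f \<in> carrier F" for f
  proof -
    have "inj_on psi (carrier Q)" using psi by (auto simp: ring_iso_def bij_betw_def)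
    then have "h (psi (bar f)) = bar f" unfolding h_def using that by (intro inv_into_f_f) auto
    then show ?thesis using psi_bar that by simp
  qed
  have C: "carrier (clifford K V q) = carrier Q" "mult (clifford K V q) = mult Q" "add (clifford K V q) = add Q"
    "\<one>\<^bsub>clifford K V q\<^esub> = \<one>\<^bsub>Q\<^esub>" "\<zero>\<^bsub>clifford K V q\<^esub> = \<zero>\<^bsub>Q\<^esub>"
    "\<And>c x. c \<odot>\<^bsub>clifford K V q\<^esub> x = (\<Union>f\<in>x. bar (c \<odot>\<^bsub>F\<^esub> f))"
    "\<And>i. grade (clifford K V q) i = {bar f | f. f \<in> carrier F \<and> (\<forall>w. f w \<noteq> \<zero>\<^bsub>K\<^esub> \<longrightarrow> of_nat (length w) = i)}"
    by (simp_all add: clifford_def Let_def bar_def)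
  have iso: "h \<in> ring_iso B (clifford K V q)"
    using h unfolding ring_iso_def ring_hom_def C by simp
  have "h (c \<odot> x) = c \<odot>\<^bsub>clifford K V q\<^esub> h x" if c: "c \<in> carrier K" and x: "x \<in> carrier B" for c x
  proof -
    obtain f where f: "f \<in> carrier F" "x = Phi f" using x unfolding Phi_surj[symmetric] by blast
    have "h (c \<odot> x) = h (Phi (c \<odot>\<^bsub>F\<^esub> f))" using c f by (simp add: Phi_smult smult_B)
    also have "\<dots> = bar (c \<odot>\<^bsub>F\<^esub> f)" using c f smult_closed_F by (intro h_Phi) simp
    \<comment> \<open>The scalar action on the quotient is a union over representatives; all of them
      give the same class, so the union is that class.\<close>
    also have "\<dots> = (\<Union>g\<in>bar f. bar (c \<odot>\<^bsub>F\<^esub> g))"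
    proof -
      have fin: "f \<in> bar f" unfolding bar_def using f(1) by (rule I.a_rcos_self)
      have "bar (c \<odot>\<^bsub>F\<^esub> g) = bar (c \<odot>\<^bsub>F\<^esub> f)" if g: "g \<in> bar f" for g
      proof -
        have gF: "g \<in> carrier F" using g I.a_elemrcos_carrier[OF f(1)] unfolding bar_def by blast
        have "bar g = bar f" using I.a_repr_independence'[OF g[unfolded bar_def] f(1)] unfolding bar_def by simp
        then show ?thesis using c f(1) gF by (simp add: smult_scal scal_closed)
      qed
      then show ?thesis using fin by blast
    qed
    also have "\<dots> = c \<odot>\<^bsub>clifford K V q\<^esub> h x" using f by (simp add: C h_Phi)
    finally show ?thesis .
  qed
  moreover have "h ` grade B i = grade (clifford K V q) i" for i
  proof
    show "h ` grade B i \<subseteq> grade (clifford K V q) i"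
    proof
      fix y assume "y \<in> h ` grade B i"
      then obtain b where b: "b \<in> grade B i" "y = h b" by blast
      obtain f where f: "f \<in> carrier F" "Phi f = b" "\<forall>w. f w \<noteq> \<zero>\<^bsub>K\<^esub> \<longrightarrow> of_nat (length w) = i"
        using grade_lift[OF b(1)] by blast
      have "y = bar f" using b(2) f(1,2) h_Phi by blast
      then show "y \<in> grade (clifford K V q) i" unfolding C using f(1,3) by blast
    qed
    show "grade (clifford K V q) i \<subseteq> h ` grade B i"
    proof
      fix y assume "y \<in> grade (clifford K V q) i"
      then obtain f where f: "y = bar f" "f \<in> carrier F" "\<forall>w. f w \<noteq> \<zero>\<^bsub>K\<^esub> \<longrightarrow> of_nat (length w) = i"
        unfolding C by blast
      show "y \<in> h ` grade B i"
        by (rule image_eqI[OF _ Phi_grade[OF f(2,3)]]) (simp add: f(1) h_Phi[OF f(2)])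
    qed
  qed
  ultimately have "h \<in> superalg_iso K B (clifford K V q)" unfolding superalg_iso_def using iso by simp
  then show ?thesis by blast
qed

end

section \<open>The central localization\<close>

context half_prime_superalgebra begin

abbreviation D where "D \<equiv> denoms G"

lemma D_iff: "z \<in> D \<longleftrightarrow> z \<in> Z \<and> z \<noteq> 0" by (auto simp: denoms_def)

lemma D_Z: "z \<in> D \<Longrightarrow> z \<in> Z" and D_nz: "z \<in> D \<Longrightarrow> z \<noteq> 0" by (simp_all add: D_iff)

lemma D_mult: "z \<in> D \<Longrightarrow> w \<in> D \<Longrightarrow> z * w \<in> D"
  unfolding D_iff using Z_mult Z_mult_nonzero by blast

lemma D_cancel: "z \<in> D \<Longrightarrow> z * a = z * b \<longleftrightarrow> a = b"
  using Z_cancel[OF D_Z D_nz, of z a b] by blast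

lemma D_comm: "z \<in> D \<Longrightarrow> x * (z * y) = z * (x * y)"
  by (rule Z_comm_left[OF D_Z])

lemma loc_rel_iff: "((a, z), (b, w)) \<in> loc_rel G \<longleftrightarrow> z \<in> D \<and> w \<in> D \<and> w * a = z * b"
proof
  assume "((a, z), (b, w)) \<in> loc_rel G"
  then obtain u where u: "z \<in> D" "w \<in> D" "u \<in> D" "u * (w * a - z * b) = 0" by (auto simp: loc_rel_def)
  then have "w * a - z * b = 0" using Z_regular[OF D_Z[OF u(3)]] D_nz[OF u(3)] by blast
  then show "z \<in> D \<and> w \<in> D \<and> w * a = z * b" using u by simp
qed (auto simp: loc_rel_def)

lemma frac_mem: "(b, w) \<in> frac G a z \<longleftrightarrow> z \<in> D \<and> w \<in> D \<and> w * a = z * b"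
  by (simp add: frac_def loc_rel_iff)

lemma frac_trans:
  assumes "z \<in> D" "w \<in> D" "v \<in> D" "w * a = z * b" "v * b = w * c" shows "v * a = z * c"
proof -
  have "w * (v * a) = v * (w * a)" by (rule D_comm[OF assms(3)])
  also have "\<dots> = z * (v * b)" unfolding assms(4) by (rule D_comm[OF assms(1)])
  also have "\<dots> = w * (z * c)" unfolding assms(5) by (rule D_comm[OF assms(2)])
  finally show ?thesis unfolding D_cancel[OF assms(2)] .
qed

lemma frac_eq: assumes "z \<in> D" "w \<in> D" shows "frac G a z = frac G b w \<longleftrightarrow> w * a = z * b"
proof
  assume "frac G a z = frac G b w"
  moreover have "(b, w) \<in> frac G b w" using assms by (simp add: frac_mem)
  ultimately show "w * a = z * b" using frac_mem by blast
next
  assume e: "w * a = z * b"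
  show "frac G a z = frac G b w"
  proof (intro Set.set_eqI iffI)
    fix p assume "p \<in> frac G a z"
    then obtain c v where p: "p = (c, v)" "v \<in> D" "v * a = z * c" by (cases p) (auto simp: frac_mem)
    have "v * b = w * c" using frac_trans[OF assms(2,1) p(2) e[symmetric] p(3)] .
    then show "p \<in> frac G b w" using p assms by (simp add: frac_mem)
  next
    fix p assume "p \<in> frac G b w"
    then obtain c v where p: "p = (c, v)" "v \<in> D" "v * b = w * c" by (cases p) (auto simp: frac_mem)
    have "v * a = z * c" using frac_trans[OF assms p(2) e p(3)] .
    then show "p \<in> frac G a z" using p assms by (simp add: frac_mem)
  qed
qed

lemma frac_expand: "z \<in> D \<Longrightarrow> w \<in> D \<Longrightarrow> frac G a z = frac G (w * a) (w * z)"
  by (subst frac_eq) (simp_all add: D_mult D_comm mult.assoc)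

abbreviation Loc where "Loc \<equiv> localization G"

text \<open>The operations of the localization are unions over representatives; here such a union is
  evaluated once its members are known to coincide.\<close>

lemma frac_union:
  assumes z: "z \<in> D" and h: "\<And>b w. w \<in> D \<Longrightarrow> w * a = z * b \<Longrightarrow> h b w = x"
  shows "(\<Union>(b, w)\<in>frac G a z. h b w) = x"
proof -
  have "(a, z) \<in> frac G a z" using z by (simp add: frac_mem)
  moreover have "(\<lambda>(b, w). h b w) p = x" if "p \<in> frac G a z" for p
    using that h by (cases p) (simp add: frac_mem)
  ultimately show ?thesis by (auto 0 3)
qed

lemma frac_mult_cong:
  assumes "z \<in> D" "w \<in> D" "z' \<in> D" "w' \<in> D" "z' * a = z * a'" "w' * b = w * b'"
  shows "frac G (a' * b') (z' * w') = frac G (a * b) (z * w)"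
proof -
  have "z' * w' * (a * b) = z' * a * (w' * b)" using D_comm[OF assms(4), of a b] by (simp add: mult.assoc)
  also have "\<dots> = z * w * (a' * b')" unfolding assms(5,6) using D_comm[OF assms(2), of a' b'] by (simp add: mult.assoc)
  finally show ?thesis using assms by (subst frac_eq) (simp_all add: D_mult)
qed

lemma frac_mult:
  assumes "z \<in> D" "w \<in> D" shows "frac G a z \<otimes>\<^bsub>Loc\<^esub> frac G b w = frac G (a * b) (z * w)"
proof -
  have "(\<Union>(a', z')\<in>frac G a z. \<Union>(b', w')\<in>frac G b w. frac G (a' * b') (z' * w')) = frac G (a * b) (z * w)"
    by (intro frac_union assms frac_mult_cong)
  then show ?thesis by (simp add: localization_def)
qed

lemma Loc_smult: "smult Loc = mult Loc" by (simp add: localization_def)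

lemma frac_add_cong:
  assumes "z \<in> D" "w \<in> D" "z' \<in> D" "w' \<in> D" "z' * a = z * a'" "w' * b = w * b'"
  shows "frac G (w' * a' + z' * b') (z' * w') = frac G (w * a + z * b) (z * w)"
proof -
  have "z' * w' * (w * a) = w * (w' * (z' * a))"
    using D_comm[OF assms(2), of "z' * w'" a] D_comm[OF assms(4), of z' a] by (simp add: mult.assoc)
  also have "\<dots> = z * w * (w' * a')" unfolding assms(5)
    using D_comm[OF assms(1), of w' a'] D_comm[OF assms(1), of w "w' * a'"] by (simp add: mult.assoc)
  finally have 1: "z' * w' * (w * a) = z * w * (w' * a')" .
  have "z' * w' * (z * b) = z * (z' * (w' * b))"
    using D_comm[OF assms(1), of "z' * w'" b] by (simp add: mult.assoc)
  also have "\<dots> = z * w * (z' * b')" unfolding assms(6)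
    using D_comm[OF assms(2), of z' b'] by (simp add: mult.assoc)
  finally have "z' * w' * (w * a + z * b) = z * w * (w' * a' + z' * b')" using 1 by (simp add: distrib_left)
  then show ?thesis using assms by (subst frac_eq) (simp_all add: D_mult)
qed

lemma frac_add':
  assumes "z \<in> D" "w \<in> D" shows "frac G a z \<oplus>\<^bsub>Loc\<^esub> frac G b w = frac G (w * a + z * b) (z * w)"
proof -
  have "(\<Union>(a', z')\<in>frac G a z. \<Union>(b', w')\<in>frac G b w. frac G (w' * a' + z' * b') (z' * w')) = frac G (w * a + z * b) (z * w)"
    by (intro frac_union assms frac_add_cong)
  then show ?thesis by (simp add: localization_def)
qed

lemma frac_add: assumes "s \<in> D" shows "frac G a s \<oplus>\<^bsub>Loc\<^esub> frac G b s = frac G (a + b) s"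
  using frac_add'[OF assms assms, of a b] frac_expand[OF assms assms, of "a + b"] by (simp add: distrib_left)

lemma frac_zero_eq: "z \<in> D \<Longrightarrow> frac G a z = frac G 0 w \<longleftrightarrow> a = 0" if "w \<in> D"
  using that frac_eq[of z w a 0] D_cancel[of w a 0] by simp

lemma Loc_zero: "s \<in> D \<Longrightarrow> \<zero>\<^bsub>Loc\<^esub> = frac G 0 s"
proof -
  assume s: "s \<in> D"
  have "frac G 0 z = frac G 0 s" if "z \<in> D" for z using that s by (simp add: frac_eq)
  then have "(\<Union>z\<in>D. frac G 0 z) = (\<Union>z\<in>D. frac G 0 s)" by (intro SUP_cong refl)
  also have "\<dots> = frac G 0 s" using s by auto
  finally have "(\<Union>z\<in>D. frac G 0 z) = frac G 0 s" .
  then show ?thesis by (simp add: localization_def)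
qed

lemma Loc_one: "s \<in> D \<Longrightarrow> \<one>\<^bsub>Loc\<^esub> = frac G s s"
proof -
  assume s: "s \<in> D"
  have "frac G z z = frac G s s" if "z \<in> D" for z using that s Zcomm[OF D_Z[OF s], of z] by (simp add: frac_eq)
  then have "(\<Union>z\<in>D. frac G z z) = (\<Union>z\<in>D. frac G s s)" by (intro SUP_cong refl)
  also have "\<dots> = frac G s s" using s by auto
  finally have "(\<Union>z\<in>D. frac G z z) = frac G s s" .
  then show ?thesis by (simp add: localization_def)
qed

lemma Loc_carrier: "x \<in> carrier Loc \<longleftrightarrow> (\<exists>a z. x = frac G a z \<and> z \<in> D)"
  by (auto simp: localization_def)

lemma Loc_grade: "x \<in> grade Loc i \<longleftrightarrow> (\<exists>a z. x = frac G a z \<and> a \<in> G i \<and> z \<in> D)"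
  by (auto simp: localization_def)

section \<open>The field of central fractions\<close>

abbreviation Fld where "Fld \<equiv> loc_field G"

lemma Fld_carrier: "x \<in> carrier Fld \<longleftrightarrow> (\<exists>a z. x = frac G a z \<and> a \<in> Z \<and> z \<in> D)"
  by (auto simp: loc_field_def)

lemma Fld_ops: "mult Fld = mult Loc" "add Fld = add Loc" "\<one>\<^bsub>Fld\<^esub> = \<one>\<^bsub>Loc\<^esub>" "\<zero>\<^bsub>Fld\<^esub> = \<zero>\<^bsub>Loc\<^esub>"
  by (simp_all add: loc_field_def)

lemma fracI: "z \<in> D \<Longrightarrow> frac G a z \<in> carrier Loc" by (auto simp: Loc_carrier)

lemma fracK: "z \<in> D \<Longrightarrow> a \<in> Z \<Longrightarrow> frac G a z \<in> carrier Fld" by (auto simp: Fld_carrier)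

lemma common2:
  assumes "z \<in> D" "w \<in> D"
  shows "w * z \<in> D" "frac G a z = frac G (w * a) (w * z)" "frac G b w = frac G (z * b) (w * z)"
proof -
  show "w * z \<in> D" "frac G a z = frac G (w * a) (w * z)"
    by (rule D_mult[OF assms(2,1)], rule frac_expand[OF assms])
  show "frac G b w = frac G (z * b) (w * z)"
    using frac_expand[OF assms(2,1), of b] Zcomm[OF D_Z[OF assms(1)], of w] by simp
qed

lemma Loc_common2: assumes "x \<in> carrier Loc" "y \<in> carrier Loc"
  obtains a b s where "s \<in> D" "x = frac G a s" "y = frac G b s"
proof -
  obtain a z where a: "x = frac G a z" "z \<in> D" using assms(1) by (auto simp: Loc_carrier)
  obtain b w where b: "y = frac G b w" "w \<in> D" using assms(2) by (auto simp: Loc_carrier)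
  note c = common2[OF a(2) b(2)]
  show ?thesis by (rule that[OF c(1)]) (unfold a(1) b(1), rule c(2), rule c(3))
qed

lemma Loc_common3: assumes "x \<in> carrier Loc" "y \<in> carrier Loc" "t \<in> carrier Loc"
  obtains a b c s where "s \<in> D" "x = frac G a s" "y = frac G b s" "t = frac G c s"
proof -
  obtain a b s where s: "s \<in> D" "x = frac G a s" "y = frac G b s" by (rule Loc_common2[OF assms(1,2)])
  obtain c v where v: "v \<in> D" "t = frac G c v" using assms(3) by (auto simp: Loc_carrier)
  show ?thesis
    using common2(1)[OF s(1) v(1)]
    by (rule that) (unfold s(2,3) v(2), rule common2(2)[OF s(1) v(1)], rule common2(2)[OF s(1) v(1)], rule common2(3)[OF s(1) v(1)])
qed

lemma Loc_neg_left: "s \<in> D \<Longrightarrow> frac G (- a) s \<oplus>\<^bsub>Loc\<^esub> frac G a s = \<zero>\<^bsub>Loc\<^esub>"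
  by (simp add: frac_add Loc_zero)

lemma Loc_ring: assumes D: "D \<noteq> {}" shows "ring Loc"
proof -
  obtain s where s: "s \<in> D" using D by blast
  show ?thesis
  proof (rule ringI)
    show "abelian_group Loc"
    proof (rule abelian_groupI)
      show "x \<oplus>\<^bsub>Loc\<^esub> y \<in> carrier Loc" if "x \<in> carrier Loc" "y \<in> carrier Loc" for x y
        by (rule Loc_common2[OF that]) (simp add: frac_add fracI)
      show "\<zero>\<^bsub>Loc\<^esub> \<in> carrier Loc" using s by (simp add: Loc_zero fracI)
      show "x \<oplus>\<^bsub>Loc\<^esub> y \<oplus>\<^bsub>Loc\<^esub> t = x \<oplus>\<^bsub>Loc\<^esub> (y \<oplus>\<^bsub>Loc\<^esub> t)"
        if "x \<in> carrier Loc" "y \<in> carrier Loc" "t \<in> carrier Loc" for x y t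
        by (rule Loc_common3[OF that]) (simp add: frac_add add.assoc)
      show "x \<oplus>\<^bsub>Loc\<^esub> y = y \<oplus>\<^bsub>Loc\<^esub> x" if "x \<in> carrier Loc" "y \<in> carrier Loc" for x y
        by (rule Loc_common2[OF that]) (simp add: frac_add add.commute)
      show "\<zero>\<^bsub>Loc\<^esub> \<oplus>\<^bsub>Loc\<^esub> x = x" if "x \<in> carrier Loc" for x
        by (rule Loc_common2[OF that that]) (simp add: frac_add Loc_zero)
      show "\<exists>y\<in>carrier Loc. y \<oplus>\<^bsub>Loc\<^esub> x = \<zero>\<^bsub>Loc\<^esub>" if "x \<in> carrier Loc" for x
      proof -
        obtain a z where a: "x = frac G a z" "z \<in> D" using \<open>x \<in> carrier Loc\<close> by (auto simp: Loc_carrier)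
        show ?thesis unfolding a(1) using Loc_neg_left[OF a(2)] fracI[OF a(2)] by blast
      qed
    qed
    show "monoid Loc"
    proof (rule monoidI)
      show "x \<otimes>\<^bsub>Loc\<^esub> y \<in> carrier Loc" if "x \<in> carrier Loc" "y \<in> carrier Loc" for x y
        by (rule Loc_common2[OF that]) (simp add: frac_mult fracI D_mult)
      show "\<one>\<^bsub>Loc\<^esub> \<in> carrier Loc" using s by (simp add: Loc_one fracI)
      show "x \<otimes>\<^bsub>Loc\<^esub> y \<otimes>\<^bsub>Loc\<^esub> t = x \<otimes>\<^bsub>Loc\<^esub> (y \<otimes>\<^bsub>Loc\<^esub> t)"
        if "x \<in> carrier Loc" "y \<in> carrier Loc" "t \<in> carrier Loc" for x y t
        by (rule Loc_common3[OF that]) (simp add: frac_mult D_mult mult.assoc)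
      show "\<one>\<^bsub>Loc\<^esub> \<otimes>\<^bsub>Loc\<^esub> x = x" if "x \<in> carrier Loc" for x
        by (rule Loc_common2[OF that that]) (simp add: Loc_one frac_mult frac_expand[symmetric])
      show "x \<otimes>\<^bsub>Loc\<^esub> \<one>\<^bsub>Loc\<^esub> = x" if "x \<in> carrier Loc" for x
      proof (rule Loc_common2[OF that that])
        fix a b s assume s: "s \<in> D" "x = frac G a s"
        have "frac G (a * s) (s * s) = frac G a s" using frac_expand[OF s(1) s(1), of a] Zcomm[OF D_Z[OF s(1)], of a] by simp
        then show ?thesis using s by (simp add: Loc_one[OF s(1)] frac_mult)
      qed
    qed
    show "(x \<oplus>\<^bsub>Loc\<^esub> y) \<otimes>\<^bsub>Loc\<^esub> t = x \<otimes>\<^bsub>Loc\<^esub> t \<oplus>\<^bsub>Loc\<^esub> y \<otimes>\<^bsub>Loc\<^esub> t"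
      if "x \<in> carrier Loc" "y \<in> carrier Loc" "t \<in> carrier Loc" for x y t
      by (rule Loc_common3[OF that]) (simp add: frac_mult frac_add D_mult distrib_right)
    show "t \<otimes>\<^bsub>Loc\<^esub> (x \<oplus>\<^bsub>Loc\<^esub> y) = t \<otimes>\<^bsub>Loc\<^esub> x \<oplus>\<^bsub>Loc\<^esub> t \<otimes>\<^bsub>Loc\<^esub> y"
      if "x \<in> carrier Loc" "y \<in> carrier Loc" "t \<in> carrier Loc" for x y t
      by (rule Loc_common3[OF that]) (simp add: frac_mult frac_add D_mult distrib_left)
  qed
qed

lemma Fld_sub: "carrier Fld \<subseteq> carrier Loc" by (auto simp: Fld_carrier fracI)

lemma Loc_neg: assumes s: "s \<in> D" shows "\<ominus>\<^bsub>Loc\<^esub> frac G a s = frac G (- a) s"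
proof -
  interpret L: ring Loc using Loc_ring s by blast
  show ?thesis using s Loc_neg_left[OF s] fracI[OF s] by (intro L.minus_equality) auto
qed

lemma Fld_add: assumes "x \<in> carrier Fld" "y \<in> carrier Fld" shows "x \<oplus>\<^bsub>Loc\<^esub> y \<in> carrier Fld"
proof -
  obtain a z b w where "x = frac G a z" "a \<in> Z" "z \<in> D" "y = frac G b w" "b \<in> Z" "w \<in> D"
    using assms unfolding Fld_carrier by blast
  then show ?thesis by (simp add: frac_add' fracK D_mult D_Z Z_add Z_mult)
qed

lemma Fld_mult: assumes "x \<in> carrier Fld" "y \<in> carrier Fld" shows "x \<otimes>\<^bsub>Loc\<^esub> y \<in> carrier Fld"
proof -
  obtain a z b w where "x = frac G a z" "a \<in> Z" "z \<in> D" "y = frac G b w" "b \<in> Z" "w \<in> D"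
    using assms unfolding Fld_carrier by blast
  then show ?thesis by (simp add: frac_mult fracK D_mult Z_mult)
qed

lemma Fld_central: assumes "c \<in> carrier Fld" "x \<in> carrier Loc" shows "c \<otimes>\<^bsub>Loc\<^esub> x = x \<otimes>\<^bsub>Loc\<^esub> c"
proof -
  obtain a z where a: "c = frac G a z" "a \<in> Z" "z \<in> D" using assms(1) unfolding Fld_carrier by blast
  obtain b w where b: "x = frac G b w" "w \<in> D" using assms(2) unfolding Loc_carrier by blast
  show ?thesis using a b Zcomm[OF a(2), of b] Zcomm[OF D_Z[OF a(3)], of w] by (simp add: frac_mult)
qed

lemma Fld_field: assumes D: "D \<noteq> {}" shows "field Fld"
proof -
  interpret L: ring Loc by (rule Loc_ring[OF D])
  obtain s where s: "s \<in> D" using D by blast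
  have sub: "x \<in> carrier Loc" if "x \<in> carrier Fld" for x using that Fld_sub by blast
  have one: "\<one>\<^bsub>Loc\<^esub> \<in> carrier Fld" using s by (simp add: Loc_one fracK D_Z)
  have "cring Fld"
  proof (rule cringI)
    show "abelian_group Fld"
    proof (rule abelian_groupI)
      show "\<zero>\<^bsub>Fld\<^esub> \<in> carrier Fld" using s by (simp add: Fld_ops Loc_zero fracK)
      show "\<exists>y\<in>carrier Fld. y \<oplus>\<^bsub>Fld\<^esub> x = \<zero>\<^bsub>Fld\<^esub>" if "x \<in> carrier Fld" for x
      proof -
        obtain a z where a: "x = frac G a z" "a \<in> Z" "z \<in> D" using \<open>x \<in> carrier Fld\<close> unfolding Fld_carrier by blast
        show ?thesis unfolding a(1) Fld_ops using Loc_neg_left[OF a(3)] fracK[OF a(3) Z_uminus[OF a(2)]] by blast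
      qed
    qed (simp_all add: Fld_ops Fld_add sub L.a_assoc, simp_all add: sub L.a_comm)
    show "comm_monoid Fld"
    proof (rule comm_monoidI)
      show "x \<otimes>\<^bsub>Fld\<^esub> y = y \<otimes>\<^bsub>Fld\<^esub> x" if "x \<in> carrier Fld" "y \<in> carrier Fld" for x y
        unfolding Fld_ops by (rule Fld_central[OF that(1) sub[OF that(2)]])
    qed (simp_all add: Fld_ops Fld_mult one sub L.m_assoc)
  qed (simp add: Fld_ops sub L.l_distr)
  moreover have "Units Fld = carrier Fld - {\<zero>\<^bsub>Fld\<^esub>}"
  proof
    have ne: "\<one>\<^bsub>Loc\<^esub> \<noteq> \<zero>\<^bsub>Loc\<^esub>"
      using s D_nz[OF s] frac_zero_eq[OF s s, of s] by (simp add: Loc_one[OF s] Loc_zero[OF s])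
    show "Units Fld \<subseteq> carrier Fld - {\<zero>\<^bsub>Fld\<^esub>}"
      using ne sub by (auto simp: Units_def Fld_ops)
    show "carrier Fld - {\<zero>\<^bsub>Fld\<^esub>} \<subseteq> Units Fld"
    proof
      fix x assume x: "x \<in> carrier Fld - {\<zero>\<^bsub>Fld\<^esub>}"
      then have "x \<in> carrier Fld" by simp
      then obtain a z where a: "x = frac G a z" "a \<in> Z" "z \<in> D" unfolding Fld_carrier by blast
      then have "a \<noteq> 0" using x by (auto simp: Fld_ops Loc_zero)
      then have aD: "a \<in> D" using a by (simp add: D_iff)
      let ?y = "frac G z a"
      have y: "?y \<in> carrier Fld" using aD a by (simp add: fracK D_Z)
      have "x \<otimes>\<^bsub>Loc\<^esub> ?y = \<one>\<^bsub>Loc\<^esub>"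
        using a aD Zcomm[OF a(2), of z] by (simp add: frac_mult Loc_one[OF D_mult[OF a(3) aD]])
      moreover have "?y \<otimes>\<^bsub>Loc\<^esub> x = x \<otimes>\<^bsub>Loc\<^esub> ?y" using x y by (intro Fld_central sub) auto
      ultimately show "x \<in> Units Fld" using x y by (auto simp: Units_def Fld_ops)
    qed
  qed
  ultimately show ?thesis by (rule cring.cring_fieldI)
qed

lemma Loc_central_subring: assumes "D \<noteq> {}" shows "central_subring Loc (carrier Fld)"
proof -
  obtain s where s: "s \<in> D" using assms by blast
  interpret L: ring Loc by (rule Loc_ring[OF assms])
  show ?thesis
  proof
    show "\<zero>\<^bsub>Loc\<^esub> \<in> carrier Fld" "\<one>\<^bsub>Loc\<^esub> \<in> carrier Fld" using s by (simp_all add: Loc_zero Loc_one fracK D_Z)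
    show "\<ominus>\<^bsub>Loc\<^esub> a \<in> carrier Fld" if a: "a \<in> carrier Fld" for a
    proof -
      obtain b z where "a = frac G b z" "b \<in> Z" "z \<in> D" using a unfolding Fld_carrier by blast
      then show ?thesis by (simp add: Loc_neg fracK Z_uminus)
    qed
    show "a \<otimes>\<^bsub>Loc\<^esub> b = b \<otimes>\<^bsub>Loc\<^esub> a" if "a \<in> carrier Fld" "b \<in> carrier Loc" for a b
      by (rule Fld_central[OF that])
  qed (simp_all add: Fld_sub Fld_add Fld_mult)
qed

section \<open>The algebra inside its localization\<close>

definition emb :: "'a \<Rightarrow> ('a \<times> 'a) set" where
  "emb a = (let s = SOME s. s \<in> D in frac G (s * a) s)"

text \<open>Without a unit there is no fraction with denominator 1, so \<open>a\<close> is
  represented by \<open>s a\<close> over \<open>s\<close>. The choice of \<open>s\<close> made in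
  \<open>emb\<close> does not affect the class.\<close>

lemma emb_eq: assumes "s \<in> D" shows "emb a = frac G (s * a) s"
proof -
  define t where "t = (SOME s. s \<in> D)"
  have t: "t \<in> D" unfolding t_def using assms by (rule someI)
  have "s * (t * a) = t * (s * a)" by (rule D_comm[OF t])
  then show ?thesis unfolding emb_def Let_def t_def[symmetric] using t assms by (simp add: frac_eq)
qed

lemma emb_frac: assumes "s \<in> D" shows "emb a \<otimes>\<^bsub>Loc\<^esub> frac G b s = frac G (a * b) s"
  using assms frac_expand[OF assms assms, of "a * b"] by (simp add: emb_eq frac_mult mult.assoc)

lemma emb_mult: assumes "D \<noteq> {}" shows "emb a \<otimes>\<^bsub>Loc\<^esub> emb b = emb (a * b)"
proof -
  obtain s where s: "s \<in> D" using assms by blast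
  show ?thesis unfolding emb_eq[OF s, of b] emb_frac[OF s] emb_eq[OF s, of "a * b"] using D_comm[OF s, of a b] by simp
qed

lemma emb_neg: assumes "D \<noteq> {}" shows "\<ominus>\<^bsub>Loc\<^esub> emb a = emb (- a)"
proof -
  obtain s where s: "s \<in> D" using assms by blast
  show ?thesis by (simp add: emb_eq[OF s] Loc_neg[OF s])
qed

lemma emb_Z: assumes "D \<noteq> {}" "a \<in> Z" shows "emb a \<in> carrier Fld"
proof -
  obtain s where s: "s \<in> D" using assms by blast
  show ?thesis using s assms(2) by (simp add: emb_eq[OF s] fracK Z_mult D_Z)
qed

lemma emb_carrier: assumes "D \<noteq> {}" shows "emb a \<in> carrier Loc"
proof -
  obtain s where s: "s \<in> D" using assms by blast
  show ?thesis using s by (simp add: emb_eq[OF s] fracI)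
qed

lemma emb_zero: assumes "D \<noteq> {}" "emb a = \<zero>\<^bsub>Loc\<^esub>" shows "a = 0"
proof -
  obtain s where s: "s \<in> D" using assms by blast
  have "s * a = 0" using assms(2) frac_zero_eq[OF s s] by (simp add: emb_eq[OF s] Loc_zero[OF s])
  then show ?thesis using Z_regular[OF D_Z[OF s]] D_nz[OF s] by blast
qed

lemma emb_G: assumes "D \<noteq> {}" "a \<in> G i" shows "emb a \<in> grade Loc i"
proof -
  obtain s where s: "s \<in> D" using assms by blast
  have "s * a \<in> G i" by (rule mult_E_G[OF ZE[OF D_Z[OF s]] assms(2)])
  then show ?thesis unfolding Loc_grade emb_eq[OF s] using s by blast
qed

lemma prod_span_prod_span_in: assumes "x \<in> prod_span Z es" "w \<in> D" shows "frac G x w \<in> prod_span_in Loc (carrier Fld) (map emb es)"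
  using assms
proof (induction es arbitrary: x)
  case (Cons e es)
  then obtain g h where gh: "x = g + e * h" "g \<in> prod_span Z es" "h \<in> prod_span Z es" by auto
  have "frac G x w = frac G g w \<oplus>\<^bsub>Loc\<^esub> emb e \<otimes>\<^bsub>Loc\<^esub> frac G h w"
    by (simp add: gh(1) emb_frac frac_add Cons.prems(2))
  then show ?case using Cons.IH gh Cons.prems(2) by auto
qed (simp add: fracK)

lemma prod_span_in_prod_span: assumes "x \<in> prod_span_in Loc (carrier Fld) (map emb es)"
  shows "\<exists>g w. x = frac G g w \<and> w \<in> D \<and> g \<in> prod_span Z es"
  using assms
proof (induction es arbitrary: x)
  case Nil
  then show ?case by (auto simp: Fld_carrier)
next
  case (Cons e es)
  then obtain y t where yt: "x = y \<oplus>\<^bsub>Loc\<^esub> emb e \<otimes>\<^bsub>Loc\<^esub> t"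
    "y \<in> prod_span_in Loc (carrier Fld) (map emb es)" "t \<in> prod_span_in Loc (carrier Fld) (map emb es)" by auto
  obtain g w where g: "y = frac G g w" "w \<in> D" "g \<in> prod_span Z es" using Cons.IH[OF yt(2)] by blast
  obtain h v where h: "t = frac G h v" "v \<in> D" "h \<in> prod_span Z es" using Cons.IH[OF yt(3)] by blast
  note c = common2[OF g(2) h(2)]
  have "x = frac G (v * g + e * (w * h)) (v * w)"
    unfolding yt(1) g(1) h(1) c(2)[of g] c(3)[of h] emb_frac[OF c(1)] by (rule frac_add[OF c(1)])
  moreover have "v * g \<in> prod_span Z es" "w * h \<in> prod_span Z es"
    using prod_span_Z_mult[OF D_Z[OF h(2)] _ g(3)] prod_span_Z_mult[OF D_Z[OF g(2)] _ h(3)] Z_mult D_Z g(2) h(2) by blast+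
  ultimately show ?case using c(1) by auto
qed

lemma prod_span_supercent:
  assumes "e \<in> Od" "set es \<subseteq> Od" "\<forall>f\<in>set es. e * f = - (f * e)" "x \<in> prod_span Z es" shows "x \<in> supercent [e]"
  using assms(2-4)
proof (induction es arbitrary: x)
  case Nil
  then show ?case using Z_supercent by simp
next
  case (Cons f es)
  then obtain g h where gh: "x = g + f * h" "g \<in> prod_span Z es" "h \<in> prod_span Z es" by auto
  have "f \<in> supercent [e]" using Cons.prems by (simp add: supercent_def)
  then show ?case unfolding gh(1) using Cons gh by (intro supercent_add supercent_mult) auto
qed

text \<open>The superbracket with \<open>e\<close> annihilates \<open>g\<close> and sends
  \<open>e * h\<close> to \<open>2 e^2 h\<close>, because \<open>g\<close> and \<open>h\<close>
  involve only generators anticommuting with \<open>e\<close>. So \<open>h = 0\<close>, and with it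
  \<open>g = 0\<close>.\<close>

lemma prod_span_indep:
  assumes o: "orthogonal (e # es)" and g: "g \<in> prod_span Z es" and h: "h \<in> prod_span Z es" and z: "g + e * h = 0"
  shows "g = 0 \<and> h = 0"
proof -
  have e: "e \<in> Od" "e * e \<in> Z" "e * e \<noteq> 0" using o by auto
  have C: "x \<in> supercent [e]" if "x \<in> prod_span Z es" for x
    using prod_span_supercent[OF e(1) _ _ that] orthogonal_Od[of es] o by auto
  have eg: "e * g = parity g * e" "e * h = parity h * e" using C[OF g] C[OF h] by (simp_all add: supercent_def)
  have "e * (g + e * h) - parity (g + e * h) * e = e * (e * h) + e * parity h * e"
    using e(1) by (simp add: parity_add parity_mult algebra_simps eg(1))
  also have "\<dots> = e * (e * h) + e * (e * h)" by (simp add: eg(2) mult.assoc)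
  finally have "e * (e * h) + e * (e * h) = 0" unfolding z by simp
  then have "e * (e * h) = 0" by (rule double_zero)
  then have "e * e * h = 0" by (simp only: mult.assoc)
  then have "h = 0" using Z_regular[OF e(2)] e(3) by blast
  then show ?thesis using z by simp
qed

lemma emb_orthogonal: assumes D: "D \<noteq> {}" and o: "orthogonal es" shows "orthogonal_in Loc (carrier Fld) (map emb es)"
  using o
proof (induction es)
  case (Cons e es)
  have "emb f \<otimes>\<^bsub>Loc\<^esub> emb e = \<ominus>\<^bsub>Loc\<^esub> (emb e \<otimes>\<^bsub>Loc\<^esub> emb f)" if "f \<in> set es" for f
  proof -
    have "e * f = - (f * e)" using Cons.prems that by simp
    then show ?thesis by (simp add: emb_mult[OF D] emb_neg[OF D])
  qed
  moreover have "emb e \<otimes>\<^bsub>Loc\<^esub> emb e \<in> carrier Fld" unfolding emb_mult[OF D] using Cons.prems by (intro emb_Z[OF D]) simp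
  ultimately show ?case using Cons emb_carrier[OF D] by auto
qed simp

lemma emb_indep: assumes D: "D \<noteq> {}" and o: "orthogonal es" shows "prod_indep Loc (carrier Fld) (map emb es)"
  using o
proof (induction es)
  case (Cons e es)
  have "x = \<zero>\<^bsub>Loc\<^esub> \<and> y = \<zero>\<^bsub>Loc\<^esub>"
    if x: "x \<in> prod_span_in Loc (carrier Fld) (map emb es)" and y: "y \<in> prod_span_in Loc (carrier Fld) (map emb es)"
      and z: "x \<oplus>\<^bsub>Loc\<^esub> emb e \<otimes>\<^bsub>Loc\<^esub> y = \<zero>\<^bsub>Loc\<^esub>" for x y
  proof -
    obtain g w where g: "x = frac G g w" "w \<in> D" "g \<in> prod_span Z es" using prod_span_in_prod_span[OF x] by blast
    obtain h v where h: "y = frac G h v" "v \<in> D" "h \<in> prod_span Z es" using prod_span_in_prod_span[OF y] by blast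
    note c = common2[OF g(2) h(2)]
    have m: "v * g \<in> prod_span Z es" "w * h \<in> prod_span Z es"
      using prod_span_Z_mult[OF D_Z[OF h(2)] _ g(3)] prod_span_Z_mult[OF D_Z[OF g(2)] _ h(3)] Z_mult D_Z g(2) h(2) by blast+
    have "x \<oplus>\<^bsub>Loc\<^esub> emb e \<otimes>\<^bsub>Loc\<^esub> y = frac G (v * g + e * (w * h)) (v * w)"
      unfolding g(1) h(1) c(2)[of g] c(3)[of h] emb_frac[OF c(1)] by (rule frac_add[OF c(1)])
    then have "frac G (v * g + e * (w * h)) (v * w) = frac G 0 (v * w)" using z by (simp only: Loc_zero[OF c(1)])
    then have "v * g + e * (w * h) = 0" by (simp only: frac_zero_eq[OF c(1) c(1)])
    from prod_span_indep[OF Cons.prems m this] have "v * g = 0" "w * h = 0" by blast+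
    then show ?thesis unfolding g(1) h(1) c(2)[of g] c(3)[of h] by (simp add: Loc_zero[OF c(1)])
  qed
  then show ?case using Cons by auto
qed simp

theorem spanning_central_order:
  assumes sp: "spanning es" shows "central_order_in_C (length es) G"
proof -
  have o: "orthogonal es" and dec: "\<And>a. \<exists>z\<in>Z - {0}. z * a \<in> prod_span Z es" using sp by (auto simp: spanning_def)
  \<comment> \<open>Spanning at the element 0 is used only to obtain some nonzero
    denominator.\<close>
  obtain s where s: "s \<in> D" using dec[of 0] by (auto simp: D_iff)
  then have D: "D \<noteq> {}" by blast
  interpret cs: central_subring Loc "carrier Fld" by (rule Loc_central_subring[OF D])
  have half0: "frac G s s \<oplus>\<^bsub>Loc\<^esub> frac G s s \<noteq> \<zero>\<^bsub>Loc\<^esub>"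
    unfolding frac_add[OF s] Loc_zero[OF s] frac_zero_eq[OF s s] by (rule double_nonzero[OF D_nz[OF s]])
  interpret M: clifford_model Fld Loc "map emb es"
  proof (intro clifford_model.intro clifford_model_axioms.intro cs.central_subring_axioms Fld_field[OF D] Fld_ops Loc_smult
      emb_orthogonal[OF D o] emb_indep[OF D o])
    show "\<one>\<^bsub>Loc\<^esub> \<oplus>\<^bsub>Loc\<^esub> \<one>\<^bsub>Loc\<^esub> \<noteq> \<zero>\<^bsub>Loc\<^esub>" using half0 by (simp add: Loc_one[OF s])
    show "e \<otimes>\<^bsub>Loc\<^esub> e \<noteq> \<zero>\<^bsub>Loc\<^esub>" if e: "e \<in> set (map emb es)" for e
    proof -
      obtain a where a: "e = emb a" "a \<in> set es" using e by auto
      have "a * a \<noteq> 0" using o a(2) by (induction es) auto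
      then show ?thesis unfolding a(1) emb_mult[OF D] using emb_zero[OF D] by blast
    qed
    show "prod_span_in Loc (carrier Fld) (map emb es) = carrier Loc"
    proof
      show "prod_span_in Loc (carrier Fld) (map emb es) \<subseteq> carrier Loc" using prod_span_in_prod_span fracI by blast
      show "carrier Loc \<subseteq> prod_span_in Loc (carrier Fld) (map emb es)"
      proof
        fix x assume "x \<in> carrier Loc"
        then obtain a t where a: "x = frac G a t" "t \<in> D" unfolding Loc_carrier by blast
        obtain z where z: "z \<in> D" "z * a \<in> prod_span Z es" using dec[of a] by (auto simp: D_iff)
        show "x \<in> prod_span_in Loc (carrier Fld) (map emb es)"
          unfolding a(1) frac_expand[OF a(2) z(1)] by (rule prod_span_prod_span_in[OF z(2) D_mult[OF z(1) a(2)]])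
      qed
    qed
    show "grade Loc i \<subseteq> carrier Loc" for i by (auto simp: Loc_grade fracI)
    show "grade Loc 0 \<inter> grade Loc 1 = {\<zero>\<^bsub>Loc\<^esub>}"
    proof
      show "{\<zero>\<^bsub>Loc\<^esub>} \<subseteq> grade Loc 0 \<inter> grade Loc 1" unfolding Loc_zero[OF s] Loc_grade[abs_def] using s by (auto simp: Loc_grade)
      show "grade Loc 0 \<inter> grade Loc 1 \<subseteq> {\<zero>\<^bsub>Loc\<^esub>}"
      proof
        fix x assume "x \<in> grade Loc 0 \<inter> grade Loc 1"
        then have "x \<in> grade Loc 0" "x \<in> grade Loc 1" by simp_all
        then obtain a z b w where x: "x = frac G a z" "a \<in> Ev" "z \<in> D" "x = frac G b w" "b \<in> Od" "w \<in> D"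
          unfolding Loc_grade by blast
        have "w * a = z * b" using x(1,4) unfolding frac_eq[OF x(3,6), symmetric] by simp
        moreover have "w * a \<in> Ev" by (rule mult_EE[OF ZE[OF D_Z[OF x(6)]] x(2)])
        moreover have "z * b \<in> Od" by (rule mult_EO[OF ZE[OF D_Z[OF x(3)]] x(5)])
        ultimately have "w * a = 0" by (intro E_O_zero) simp_all
        then have "a = 0" using Z_regular[OF D_Z[OF x(6)]] D_nz[OF x(6)] by blast
        then show "x \<in> {\<zero>\<^bsub>Loc\<^esub>}" using x(1,3) by (simp add: Loc_zero)
      qed
    qed
    show "x \<oplus>\<^bsub>Loc\<^esub> y \<in> grade Loc i" if xy: "x \<in> grade Loc i" "y \<in> grade Loc i" for x y i
    proof -
      obtain a z b w where x: "x = frac G a z" "a \<in> G i" "z \<in> D" "y = frac G b w" "b \<in> G i" "w \<in> D"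
        using xy unfolding Loc_grade by blast
      have "w * a + z * b \<in> G i" by (intro add_G mult_E_G ZE D_Z x)
      then show ?thesis unfolding x(1,4) frac_add'[OF x(3,6)] Loc_grade using D_mult[OF x(3,6)] by blast
    qed
    show "\<ominus>\<^bsub>Loc\<^esub> x \<in> grade Loc i" if x: "x \<in> grade Loc i" for x i
    proof -
      obtain a z where a: "x = frac G a z" "a \<in> G i" "z \<in> D" using x unfolding Loc_grade by blast
      show ?thesis unfolding a(1) Loc_neg[OF a(3)] Loc_grade using uminus_G[OF a(2)] a(3) by blast
    qed
    show "x \<otimes>\<^bsub>Loc\<^esub> y \<in> grade Loc (i + j)" if xy: "x \<in> grade Loc i" "y \<in> grade Loc j" for x y i j
    proof -
      obtain a z b w where x: "x = frac G a z" "a \<in> G i" "z \<in> D" "y = frac G b w" "b \<in> G j" "w \<in> D"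
        using xy unfolding Loc_grade by blast
      show ?thesis unfolding x(1,4) frac_mult[OF x(3,6)] Loc_grade
        using D_mult[OF x(3,6)] grade_mult[OF x(2,5)] by blast
    qed
    show "carrier Fld \<subseteq> grade Loc 0"
    proof
      fix x assume "x \<in> carrier Fld"
      then obtain a z where "x = frac G a z" "a \<in> Z" "z \<in> D" unfolding Fld_carrier by blast
      then show "x \<in> grade Loc 0" unfolding Loc_grade using ZE by blast
    qed
    show "set (map emb es) \<subseteq> grade Loc 1" using emb_G[OF D] orthogonal_Od[OF o] by auto
  qed
  have "even_center G \<noteq> {0}" using s by (auto simp: D_iff)
  moreover have "quadratic_space Fld M.V M.q (length es)" using M.V_quadratic by simp
  ultimately show ?thesis
    unfolding central_order_in_C_def using M.V_nondegenerate M.clifford_iso by blast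
qed

end

theorem lemma2p5:
  fixes scale :: "'f::comm_ring_1 \<Rightarrow> 'a::ring \<Rightarrow> 'a"
    and G :: "bit \<Rightarrow> 'a set"
    and L V :: "'a set"
  assumes "(2 :: 'f) dvd 1"
    and "superalgebra scale G"
    and "G 1 \<noteq> {0}"
    and "prime_superalgebra scale G"
    and "\<forall>n\<in>{1, 2, 3}. \<not> central_order_in_C n G"
    and "lie_ideal scale G L"
    and "graded_submodule scale G V"
    and "superbracket_span scale G V L \<subseteq> V"
    and "superbracket_span scale G V V \<subseteq> even_center G"
  shows "L \<subseteq> even_center G \<or> V \<subseteq> even_center G"
proof -
  interpret half_prime_superalgebra scale G
    using assms(1-4) by (intro half_prime_superalgebra.intro half_superalgebra.intro
      half_superalgebra_axioms.intro half_prime_superalgebra_axioms.intro)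
  have "\<not> spanning es" if "length es \<in> {1, 2, 3}" for es
    using spanning_central_order assms(5) that by blast
  then show ?thesis using lie_ideal_alternatives[OF assms(6-9)] by blast
qed

end
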